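(* Let $G$ be a finite group, $x\in G$ an element of prime order $p$, and set $\Gamma=G\ast_{C_p}G$, where a generator of the cyclic group $C_p$ of order $p$ is mapped onto $x$ in both copies of $G$. Then $\mu(\Gamma)=-\chi(\Gamma)$ holds true if and only if $|N_G(\langle x\rangle)|\leq 2p$.
   Context: For a finitely generated group $\Gamma$, $s_n(\Gamma)$ denotes the number of subgroups of index $n$ in $\Gamma$, and the growth coefficient of $\Gamma$ is $$\mu(\Gamma)=\limsup_{n\to\infty}\frac{\log s_n(\Gamma)}{n\log n}.$$ $\chi(\Gamma)$ denotes the (rational) Euler characteristic of the virtually free group $\Gamma$; for an amalgamated product of finite groups, $\chi(G\ast_U H)=\frac1{|G|}+\frac1{|H|}-\frac1{|U|}$, so here $\chi(\Gamma)=\frac{2}{|G|}-\frac1p$. $N_G(\langle x\rangle)$ is the normalizer of $\langle x\rangle$ in $G$.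
   Formalization: The formal theorem assumes that G is not equal to ⟨x⟩; for G = C_p the claim fails, since Γ = C_p has no subgroups of index n > p, so μ(Γ) is not −χ(Γ) = −1/p although |N_G(⟨x⟩)| = p ≤ 2p. *)

theory Defs
  imports "HOL-Algebra.Algebra" "HOL-Analysis.Extended_Real_Limits"
begin

section \<open>Amalgamated products\<close>

text \<open>
  The amalgamated product of \<open>G\<close> and \<open>H\<close> along \<open>\<phi> : U \<rightarrow> G\<close> and \<open>\<psi> : U \<rightarrow> H\<close> is the monoid of
  words in letters from \<open>G\<close> (tagged \<^const>\<open>Inl\<close>) and from \<open>H\<close> (tagged \<^const>\<open>Inr\<close>), modulo the
  congruence generated by the multiplication tables of \<open>G\<close> and \<open>H\<close> and the identifications
  \<open>\<phi> u = \<psi> u\<close>.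
\<close>

definition amalgam_words ::
  "('a, 'm) monoid_scheme \<Rightarrow> ('b, 'n) monoid_scheme \<Rightarrow> ('a + 'b) list set" where
  "amalgam_words G H = lists (carrier G <+> carrier H)"

inductive_set amalgam_rel ::
  "('a, 'm) monoid_scheme \<Rightarrow> ('b, 'n) monoid_scheme \<Rightarrow> ('c, 'k) monoid_scheme \<Rightarrow>
   ('c \<Rightarrow> 'a) \<Rightarrow> ('c \<Rightarrow> 'b) \<Rightarrow> (('a + 'b) list \<times> ('a + 'b) list) set"
  for G H U \<phi> \<psi> where
  refl: "w \<in> amalgam_words G H \<Longrightarrow> (w, w) \<in> amalgam_rel G H U \<phi> \<psi>"
| sym: "(v, w) \<in> amalgam_rel G H U \<phi> \<psi> \<Longrightarrow> (w, v) \<in> amalgam_rel G H U \<phi> \<psi>"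
| trans: "(u, v) \<in> amalgam_rel G H U \<phi> \<psi> \<Longrightarrow> (v, w) \<in> amalgam_rel G H U \<phi> \<psi> \<Longrightarrow>
    (u, w) \<in> amalgam_rel G H U \<phi> \<psi>"
| append: "(v, v') \<in> amalgam_rel G H U \<phi> \<psi> \<Longrightarrow> (w, w') \<in> amalgam_rel G H U \<phi> \<psi> \<Longrightarrow>
    (v @ w, v' @ w') \<in> amalgam_rel G H U \<phi> \<psi>"
| one_left: "([Inl \<one>\<^bsub>G\<^esub>], []) \<in> amalgam_rel G H U \<phi> \<psi>"
| one_right: "([Inr \<one>\<^bsub>H\<^esub>], []) \<in> amalgam_rel G H U \<phi> \<psi>"
| mult_left: "a \<in> carrier G \<Longrightarrow> b \<in> carrier G \<Longrightarrow>
    ([Inl a, Inl b], [Inl (a \<otimes>\<^bsub>G\<^esub> b)]) \<in> amalgam_rel G H U \<phi> \<psi>"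
| mult_right: "a \<in> carrier H \<Longrightarrow> b \<in> carrier H \<Longrightarrow>
    ([Inr a, Inr b], [Inr (a \<otimes>\<^bsub>H\<^esub> b)]) \<in> amalgam_rel G H U \<phi> \<psi>"
| amalgam: "u \<in> carrier U \<Longrightarrow> ([Inl (\<phi> u)], [Inr (\<psi> u)]) \<in> amalgam_rel G H U \<phi> \<psi>"

definition amalgamated_product ::
  "('a, 'm) monoid_scheme \<Rightarrow> ('b, 'n) monoid_scheme \<Rightarrow> ('c, 'k) monoid_scheme \<Rightarrow>
   ('c \<Rightarrow> 'a) \<Rightarrow> ('c \<Rightarrow> 'b) \<Rightarrow> ('a + 'b) list set monoid" where
  "amalgamated_product G H U \<phi> \<psi> =
    (let R = amalgam_rel G H U \<phi> \<psi> in
     \<lparr>carrier = amalgam_words G H // R,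
      monoid.mult = (\<lambda>A B. \<Union>v\<in>A. \<Union>w\<in>B. R `` {v @ w}),
      one = R `` {[]}\<rparr>)"

lemma amalgam_rel_words:
  assumes "group G" "group H" "\<phi> ` carrier U \<subseteq> carrier G" "\<psi> ` carrier U \<subseteq> carrier H"
    and "(v, w) \<in> amalgam_rel G H U \<phi> \<psi>"
  shows "v \<in> amalgam_words G H \<and> w \<in> amalgam_words G H"
  using assms(5)
  by induction
    (use assms(1-4) in \<open>auto simp: amalgam_words_def group.is_monoid monoid.m_closed\<close>)

lemma equiv_amalgam_rel:
  assumes "group G" "group H" "\<phi> ` carrier U \<subseteq> carrier G" "\<psi> ` carrier U \<subseteq> carrier H"
  shows "equiv (amalgam_words G H) (amalgam_rel G H U \<phi> \<psi>)"
proof (rule equivI)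
  show "amalgam_rel G H U \<phi> \<psi> \<subseteq> amalgam_words G H \<times> amalgam_words G H"
    using amalgam_rel_words[OF assms] by auto
  show "refl_on (amalgam_words G H) (amalgam_rel G H U \<phi> \<psi>)"
    by (rule refl_onI) (rule amalgam_rel.refl)
  show "sym_on UNIV (amalgam_rel G H U \<phi> \<psi>)"
    by (rule symI) (rule amalgam_rel.sym)
  show "trans (amalgam_rel G H U \<phi> \<psi>)"
    by (rule transI) (rule amalgam_rel.trans)
qed

lemma amalgam_mult_classes:
  assumes "group G" "group H" "\<phi> ` carrier U \<subseteq> carrier G" "\<psi> ` carrier U \<subseteq> carrier H"
    and "v \<in> amalgam_words G H" "w \<in> amalgam_words G H"
  defines "R \<equiv> amalgam_rel G H U \<phi> \<psi>"
  shows "R `` {v} \<otimes>\<^bsub>amalgamated_product G H U \<phi> \<psi>\<^esub> R `` {w} = R `` {v @ w}"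
proof -
  have eq: "equiv (amalgam_words G H) R"
    unfolding R_def by (rule equiv_amalgam_rel[OF assms(1-4)])
  have "R `` {v' @ w'} = R `` {v @ w}" if "(v, v') \<in> R" "(w, w') \<in> R" for v' w'
    using that equiv_class_eq[OF eq] unfolding R_def
    by (metis amalgam_rel.append amalgam_rel.sym)
  moreover have "(v, v) \<in> R" "(w, w) \<in> R"
    using assms(5,6) by (auto simp: R_def intro: amalgam_rel.refl)
  ultimately have "(\<Union>v'\<in>R `` {v}. \<Union>w'\<in>R `` {w}. R `` {v' @ w'}) = R `` {v @ w}"
    by blast
  then show ?thesis
    by (simp add: amalgamated_product_def R_def Let_def)
qed

lemma amalgam_word_inverse:
  assumes "group G" "group H" "w \<in> amalgam_words G H"
  shows "\<exists>v \<in> amalgam_words G H. (v @ w, []) \<in> amalgam_rel G H U \<phi> \<psi>"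
  using assms(3)
proof (induction w)
  case Nil
  have "[] \<in> amalgam_words G H" by (simp add: amalgam_words_def)
  then show ?case using amalgam_rel.refl by force
next
  case (Cons l w)
  let ?R = "amalgam_rel G H U \<phi> \<psi>"
  have w: "w \<in> amalgam_words G H" and l: "l \<in> carrier G <+> carrier H"
    using Cons.prems by (auto simp: amalgam_words_def)
  obtain v where v: "v \<in> amalgam_words G H" "(v @ w, []) \<in> ?R"
    using Cons.IH w by blast
  obtain k where k: "k \<in> carrier G <+> carrier H" "([k, l], []) \<in> ?R"
  proof (cases l)
    case (Inl a)
    then have a: "a \<in> carrier G" using l by auto
    have "([Inl (inv\<^bsub>G\<^esub> a), Inl a], [Inl (inv\<^bsub>G\<^esub> a \<otimes>\<^bsub>G\<^esub> a)]) \<in> ?R"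
      using a assms(1) by (intro amalgam_rel.mult_left) (auto simp: group.inv_closed)
    then have "([Inl (inv\<^bsub>G\<^esub> a), Inl a], []) \<in> ?R"
      using a assms(1) amalgam_rel.one_left by (metis amalgam_rel.trans group.l_inv)
    then show ?thesis using that[of "Inl (inv\<^bsub>G\<^esub> a)"] a assms(1) Inl
      by (simp add: group.inv_closed InlI)
  next
    case (Inr a)
    then have a: "a \<in> carrier H" using l by auto
    have "([Inr (inv\<^bsub>H\<^esub> a), Inr a], [Inr (inv\<^bsub>H\<^esub> a \<otimes>\<^bsub>H\<^esub> a)]) \<in> ?R"
      using a assms(2) by (intro amalgam_rel.mult_right) (auto simp: group.inv_closed)
    then have "([Inr (inv\<^bsub>H\<^esub> a), Inr a], []) \<in> ?R"
      using a assms(2) amalgam_rel.one_right by (metis amalgam_rel.trans group.l_inv)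
    then show ?thesis using that[of "Inr (inv\<^bsub>H\<^esub> a)"] a assms(2) Inr
      by (simp add: group.inv_closed InrI)
  qed
  have "([k, l] @ w, [] @ w) \<in> ?R"
    by (rule amalgam_rel.append[OF k(2) amalgam_rel.refl[OF w]])
  then have "(v @ ([k, l] @ w), v @ ([] @ w)) \<in> ?R"
    by (rule amalgam_rel.append[OF amalgam_rel.refl[OF v(1)]])
  then have "((v @ [k]) @ l # w, []) \<in> ?R"
    using v(2) by (auto intro: amalgam_rel.trans)
  moreover have "v @ [k] \<in> amalgam_words G H"
    using v(1) k(1) by (auto simp: amalgam_words_def)
  ultimately show ?case by blast
qed

lemma group_amalgamated_product:
  assumes "group G" "group H" "\<phi> ` carrier U \<subseteq> carrier G" "\<psi> ` carrier U \<subseteq> carrier H"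
  shows "group (amalgamated_product G H U \<phi> \<psi>)"
proof -
  let ?P = "amalgamated_product G H U \<phi> \<psi>" and ?R = "amalgam_rel G H U \<phi> \<psi>"
  let ?W = "amalgam_words G H"
  have carr: "carrier ?P = ?W // ?R" and one: "\<one>\<^bsub>?P\<^esub> = ?R `` {[]}"
    by (auto simp: amalgamated_product_def Let_def)
  have app: "v @ w \<in> ?W" if "v \<in> ?W" "w \<in> ?W" for v w
    using that by (auto simp: amalgam_words_def)
  have nil: "[] \<in> ?W" by (simp add: amalgam_words_def)
  note mult = amalgam_mult_classes[OF assms]
  show ?thesis
  proof (rule groupI)
    fix A assume "A \<in> carrier ?P"
    then obtain w where w: "w \<in> ?W" "A = ?R `` {w}" by (auto simp: carr quotient_def)
    show "\<one>\<^bsub>?P\<^esub> \<otimes>\<^bsub>?P\<^esub> A = A" using w nil by (simp add: one mult)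
    obtain v where v: "v \<in> ?W" "(v @ w, []) \<in> ?R"
      using amalgam_word_inverse[OF assms(1,2) w(1)] by blast
    then have "?R `` {v} \<otimes>\<^bsub>?P\<^esub> A = \<one>\<^bsub>?P\<^esub>"
      using w equiv_class_eq[OF equiv_amalgam_rel[OF assms]] by (simp add: one mult)
    then show "\<exists>B\<in>carrier ?P. B \<otimes>\<^bsub>?P\<^esub> A = \<one>\<^bsub>?P\<^esub>"
      using v(1) by (auto simp: carr intro: quotientI)
  qed (auto simp: carr one mult nil app quotient_def)
qed


section \<open>Subgroup growth\<close>

definition subgroups_of_index :: "('a, 'm) monoid_scheme \<Rightarrow> nat \<Rightarrow> 'a set set" where
  "subgroups_of_index G n =
    {H. subgroup H G \<and> finite (rcosets\<^bsub>G\<^esub> H) \<and> card (rcosets\<^bsub>G\<^esub> H) = n}"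

text \<open>
  The quotient is taken in \<^typ>\<open>ereal\<close> with \<open>log 0 = -\<infinity>\<close>; the value \<open>ln 0 = 0\<close> of the real
  logarithm would give a wrong upper limit for groups without subgroups of large index.
\<close>

definition growth_coefficient :: "('a, 'm) monoid_scheme \<Rightarrow> ereal" where
  "growth_coefficient G =
    limsup (\<lambda>n. let s = card (subgroups_of_index G n) in
      if s = 0 then -\<infinity> else ereal (ln (real s) / (real n * ln (real n))))"


section \<open>The rational Euler characteristic\<close>

text \<open>A letter \<open>(s, True)\<close> stands for \<open>s\<close>, a letter \<open>(s, False)\<close> for its inverse.\<close>

definition eval_word :: "('a, 'm) monoid_scheme \<Rightarrow> ('a \<times> bool) list \<Rightarrow> 'a" where
  "eval_word G w =
    foldr (\<lambda>(s, e) g. (if e then s else inv\<^bsub>G\<^esub> s) \<otimes>\<^bsub>G\<^esub> g) w \<one>\<^bsub>G\<^esub>"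

definition reduced_word :: "('a \<times> bool) list \<Rightarrow> bool" where
  "reduced_word w \<longleftrightarrow>
    (\<forall>i. Suc i < length w \<longrightarrow>
      \<not> (fst (w ! i) = fst (w ! Suc i) \<and> snd (w ! i) \<noteq> snd (w ! Suc i)))"

definition free_basis :: "('a, 'm) monoid_scheme \<Rightarrow> 'a set \<Rightarrow> bool" where
  "free_basis G S \<longleftrightarrow>
    S \<subseteq> carrier G \<and> generate G S = carrier G \<and>
    (\<forall>w \<in> lists (S \<times> UNIV). reduced_word w \<and> eval_word G w = \<one>\<^bsub>G\<^esub> \<longrightarrow> w = [])"

text \<open>
  Any free subgroup \<open>F\<close> of finite index and finite rank computes the Euler characteristic of a
  finitely generated virtually free group, as \<open>\<chi>(F) / [G : F]\<close> with \<open>\<chi>(F) = 1 - rank F\<close>.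
\<close>

definition euler_characteristic :: "('a, 'm) monoid_scheme \<Rightarrow> real" where
  "euler_characteristic G =
    (THE q. \<exists>F S. subgroup F G \<and> finite (rcosets\<^bsub>G\<^esub> F) \<and>
       finite S \<and> free_basis (G\<lparr>carrier := F\<rparr>) S \<and>
       q = (1 - real (card S)) / real (card (rcosets\<^bsub>G\<^esub> F)))"

end

theory Submission
  imports Defs "HOL-Analysis.Convex"
begin

text \<open>
  Transitive actions of \<open>\<Gamma>\<close> on \<open>n\<close> points correspond to \<open>(n - 1)!\<close> times the subgroups of index
  \<open>n\<close>, and an action of \<open>\<Gamma>\<close> is a pair of actions of \<open>G\<close> that agree on \<open>U = \<langle>x\<rangle>\<close>. If \<open>U\<close> has \<open>q\<close>
  orbits, the number of extensions to an action of \<open>G\<close> with \<open>M\<close> orbits is at most \<open>q!/M!\<close> up to an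
  exponential factor, so the pairs with \<open>M\<close> and \<open>M'\<close> orbits number about \<open>n! q!/(M! M'!)\<close>. Counting
  fixed points with Burnside's lemma gives \<open>q \<le> 2 M - \<chi>(\<Gamma>) n\<close> for every action of \<open>G\<close> as soon as
  \<open>|N(U)| \<le> 2 p\<close>, hence \<open>\<mu> \<le> -\<chi>\<close>. Conversely, if \<open>N\<close> copies of \<open>G/H\<close> are used and \<open>U\<close> has \<open>q\<close>
  orbits on \<open>G/H\<close>, Cauchy--Schwarz over the restrictions to \<open>U\<close> gives at least \<open>n! (q N)!/N!\<^sup>2\<close> pairs
  up to an exponential factor, hence \<open>\<mu> \<ge> (q - 2)/|G/H|\<close>. For \<open>H = 1\<close> this bound is \<open>-\<chi>\<close>, and for \<open>H = U\<close>
  it exceeds \<open>-\<chi>\<close> if and only if \<open>|N(U)| > 2 p\<close>.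

  The Euler characteristic is read off the kernel of the folding map \<open>\<Gamma> \<rightarrow> G\<close>, which is free on the
  elements \<open>\<iota>\<^sub>1 g (\<iota>\<^sub>2 g)\<inverse>\<close> for nontrivial cosets \<open>g U\<close>. Any two free subgroups of finite index give the
  same value because \<open>|Hom(L, \<int>/2)|\<close> for their intersection \<open>L\<close> determines \<open>(rank - 1)/index\<close>.
\<close>

section \<open>Group actions\<close>

text \<open>Everything is measured on the scale n ln n, so factors C^n are harmless and only
  coefficients of n ln n are tracked. The threshold 2 p is the same in both directions for a reason.
  By Burnside and a conjugation count, q - n/p is at most |N(U)|/p times M - n/|G|, and |N(U)|/p
  \<le> 2 matches the factor 2 supplied by the two copies of G. For H = U, with f = |N(U)|/p and d =
  [G:U], Burnside gives p q = d + (p - 1) f, and (q - 2)/d exceeds 1/p - 2/|G| if and only if f > 2.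
  The obstacle in the lower bound is that the pairs constructed need not act transitively, while
  subgroups correspond to transitive actions. The proportion of transitive actions is not estimated.
  Instead a supposed bound s_k \<le> C exp(c k ln k) for all k is summed over orbit decompositions;
  superadditivity of n ln n turns it into a bound of the same order for all actions, which the pairs
  contradict. The case |G| = 2 p is separate: there -\<chi>(\<Gamma>) = 0, and for H = 1 the
  counting argument, which needs q > 2, says nothing.\<close>

definition actions :: "('a, 'm) monoid_scheme \<Rightarrow> 'e set \<Rightarrow> ('a \<Rightarrow> 'e \<Rightarrow> 'e) set" where
  "actions G E =
    {\<alpha> \<in> carrier G \<rightarrow>\<^sub>E (E \<rightarrow>\<^sub>E E).
      (\<forall>e\<in>E. \<alpha> \<one>\<^bsub>G\<^esub> e = e) \<and>
      (\<forall>g\<in>carrier G. \<forall>h\<in>carrier G. \<forall>e\<in>E. \<alpha> (g \<otimes>\<^bsub>G\<^esub> h) e = \<alpha> g (\<alpha> h e))}"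

text \<open>Extensionality in both arguments makes \<open>actions G E\<close> finite for finite data
  and makes two actions equal once they agree on \<open>carrier G\<close> and \<open>E\<close>.
  Constructions are normalized this way before they are counted.\<close>

definition restrict_act ::
  "('a, 'm) monoid_scheme \<Rightarrow> 'e set \<Rightarrow> ('a \<Rightarrow> 'e \<Rightarrow> 'e) \<Rightarrow> 'a \<Rightarrow> 'e \<Rightarrow> 'e" where
  "restrict_act G E f = (\<lambda>g\<in>carrier G. \<lambda>e\<in>E. f g e)"

lemma finite_actions: "finite (carrier G) \<Longrightarrow> finite E \<Longrightarrow> finite (actions G E)"
  unfolding actions_def
  by (rule finite_subset[of _ "carrier G \<rightarrow>\<^sub>E (E \<rightarrow>\<^sub>E E)"]) (auto intro!: finite_PiE)

lemma restrict_act_eq [simp]: "g \<in> carrier G \<Longrightarrow> e \<in> E \<Longrightarrow> restrict_act G E f g e = f g e"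
  by (simp add: restrict_act_def)

lemma restrict_act_cong:
  "(\<And>g e. g \<in> carrier G \<Longrightarrow> e \<in> E \<Longrightarrow> f g e = f' g e) \<Longrightarrow>
    restrict_act G E f = restrict_act G E f'"
  unfolding restrict_act_def by (intro restrict_ext) auto

lemma act_closed: "\<alpha> \<in> actions G E \<Longrightarrow> g \<in> carrier G \<Longrightarrow> e \<in> E \<Longrightarrow> \<alpha> g e \<in> E"
  unfolding actions_def by (auto simp: PiE_iff)

lemma act_one: "\<alpha> \<in> actions G E \<Longrightarrow> e \<in> E \<Longrightarrow> \<alpha> \<one>\<^bsub>G\<^esub> e = e"
  unfolding actions_def by auto

lemma act_mult:
  "\<alpha> \<in> actions G E \<Longrightarrow> g \<in> carrier G \<Longrightarrow> h \<in> carrier G \<Longrightarrow> e \<in> E \<Longrightarrow>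
    \<alpha> (g \<otimes>\<^bsub>G\<^esub> h) e = \<alpha> g (\<alpha> h e)"
  unfolding actions_def by auto

lemma act_eqI:
  assumes "\<alpha> \<in> actions G E" "\<beta> \<in> actions G E"
    and "\<And>g e. g \<in> carrier G \<Longrightarrow> e \<in> E \<Longrightarrow> \<alpha> g e = \<beta> g e"
  shows "\<alpha> = \<beta>"
proof -
  have "\<alpha> \<in> carrier G \<rightarrow>\<^sub>E (E \<rightarrow>\<^sub>E E)" "\<beta> \<in> carrier G \<rightarrow>\<^sub>E (E \<rightarrow>\<^sub>E E)"
    using assms by (auto simp: actions_def)
  then show ?thesis
    using assms(3) by (intro PiE_ext[of \<alpha>]) (auto simp: PiE_iff intro!: extensionalityI[of _ E])
qed

lemma restrict_act_self: "\<alpha> \<in> actions G E \<Longrightarrow> restrict_act G E \<alpha> = \<alpha>"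
  unfolding actions_def restrict_act_def
  by (auto simp: PiE_iff fun_eq_iff restrict_def extensional_def)

context group
begin

lemma restrict_act_in_actions:
  assumes "\<And>g e. g \<in> carrier G \<Longrightarrow> e \<in> E \<Longrightarrow> f g e \<in> E"
    and "\<And>e. e \<in> E \<Longrightarrow> f \<one> e = e"
    and "\<And>g h e. g \<in> carrier G \<Longrightarrow> h \<in> carrier G \<Longrightarrow> e \<in> E \<Longrightarrow> f (g \<otimes> h) e = f g (f h e)"
  shows "restrict_act G E f \<in> actions G E"
  unfolding actions_def restrict_act_def using assms by auto

lemma act_inv:
  assumes "\<alpha> \<in> actions G E" "g \<in> carrier G" "e \<in> E"
  shows "\<alpha> (inv g) (\<alpha> g e) = e" "\<alpha> g (\<alpha> (inv g) e) = e"
  using act_mult[OF assms(1), of "inv g" g e] act_mult[OF assms(1), of g "inv g" e]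
    act_one[OF assms(1,3)] assms by auto

lemma act_bij:
  assumes "\<alpha> \<in> actions G E" "g \<in> carrier G"
  shows "bij_betw (\<alpha> g) E E"
  by (rule bij_betw_byWitness[where f' = "\<alpha> (inv g)"])
    (use assms act_inv[OF assms] act_closed[OF assms(1)] in \<open>auto simp: image_subset_iff\<close>)

lemma act_group_action:
  assumes "\<alpha> \<in> actions G E"
  shows "group_action G E \<alpha>"
proof -
  have ext: "\<alpha> g \<in> Bij E" if "g \<in> carrier G" for g
    using assms that act_bij[OF assms that] by (auto simp: Bij_def actions_def PiE_iff)
  have "\<alpha> (g \<otimes> h) = compose E (\<alpha> g) (\<alpha> h)" if "g \<in> carrier G" "h \<in> carrier G" for g h
    using ext[of "g \<otimes> h"] ext[OF that(1)] that act_mult[OF assms that]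
    by (intro extensionalityI[of _ E]) (auto simp: Bij_def compose_def)
  then have "\<alpha> \<in> hom G (BijGroup E)"
    using ext by (auto simp: hom_def BijGroup_def)
  then show ?thesis
    unfolding group_action_def
    by (simp add: group_BijGroup group_hom.intro group_hom_axioms.intro is_group)
qed

section \<open>Orbits and restriction to invariant subsets\<close>

lemma orbit_subset: "\<alpha> \<in> actions G E \<Longrightarrow> e \<in> E \<Longrightarrow> orbit G \<alpha> e \<subseteq> E"
  by (auto simp: orbit_def act_closed)

lemma orbit_invariant:
  assumes "\<alpha> \<in> actions G E" "e \<in> E" "g \<in> carrier G" "y \<in> orbit G \<alpha> e"
  shows "\<alpha> g y \<in> orbit G \<alpha> e"
proof -
  obtain h where "h \<in> carrier G" "y = \<alpha> h e" using assms by (auto simp: orbit_def)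
  then have "\<alpha> g y = \<alpha> (g \<otimes> h) e" using act_mult[OF assms(1)] assms by simp
  then show ?thesis using assms \<open>h \<in> carrier G\<close> unfolding orbit_def by blast
qed

lemma orbit_eq_carrier_image: "orbit G \<alpha> e = (\<lambda>g. \<alpha> g e) ` carrier G"
  by (auto simp: orbit_def)

lemma invariant_Diff:
  assumes "\<alpha> \<in> actions G E" "O' \<subseteq> E" "\<And>g e. g \<in> carrier G \<Longrightarrow> e \<in> O' \<Longrightarrow> \<alpha> g e \<in> O'"
    and "g \<in> carrier G" "e \<in> E - O'"
  shows "\<alpha> g e \<in> E - O'"
  using act_closed[OF assms(1,4), of e] assms(3)[of "inv g" "\<alpha> g e"] act_inv(1)[OF assms(1,4), of e]
    assms(4,5)
  by auto

lemma restrict_act_invariant: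
  assumes "\<alpha> \<in> actions G E" "O' \<subseteq> E" "\<And>g e. g \<in> carrier G \<Longrightarrow> e \<in> O' \<Longrightarrow> \<alpha> g e \<in> O'"
  shows "restrict_act G O' \<alpha> \<in> actions G O'"
  using assms act_mult[OF assms(1)] act_one[OF assms(1)]
  by (intro restrict_act_in_actions) (auto simp: subset_iff)

lemma restrict_act_orbit:
  assumes "\<alpha> \<in> actions G E" "e \<in> E"
  shows "restrict_act G (orbit G \<alpha> e) \<alpha> \<in> actions G (orbit G \<alpha> e)"
    and "restrict_act G (E - orbit G \<alpha> e) \<alpha> \<in> actions G (E - orbit G \<alpha> e)"
proof -
  note inv = orbit_invariant[OF assms]
  show "restrict_act G (orbit G \<alpha> e) \<alpha> \<in> actions G (orbit G \<alpha> e)"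
    using assms inv by (intro restrict_act_invariant[OF _ orbit_subset]) auto
  show "restrict_act G (E - orbit G \<alpha> e) \<alpha> \<in> actions G (E - orbit G \<alpha> e)"
    using assms invariant_Diff[OF assms(1) orbit_subset[OF assms] inv]
    by (intro restrict_act_invariant[OF assms(1)]) auto
qed

lemma restrict_act_eqD:
  assumes "\<alpha> \<in> actions G E" "\<beta> \<in> actions G E" "O' \<subseteq> E"
    and "restrict_act G O' \<alpha> = restrict_act G O' \<beta>"
    and "restrict_act G (E - O') \<alpha> = restrict_act G (E - O') \<beta>"
  shows "\<alpha> = \<beta>"
proof (rule act_eqI[OF assms(1,2)])
  fix g e assume ge: "g \<in> carrier G" "e \<in> E"
  show "\<alpha> g e = \<beta> g e"
    using fun_cong[OF fun_cong[OF assms(4), of g], of e] fun_cong[OF fun_cong[OF assms(5), of g], of e] ge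
    by (cases "e \<in> O'") auto
qed

lemma orbit_restrict_act:
  "e \<in> O' \<Longrightarrow> orbit G (restrict_act G O' \<alpha>) e = orbit G \<alpha> e"
  unfolding orbit_eq_carrier_image by (intro image_cong) auto

lemma orbits_eq_image: "orbits G E \<alpha> = orbit G \<alpha> ` E"
  unfolding orbits_def by blast

lemma orbits_restrict_act: "orbits G O' (restrict_act G O' \<alpha>) = orbits G O' \<alpha>"
  unfolding orbits_eq_image by (rule image_cong[OF HOL.refl orbit_restrict_act])

lemma orbit_self: "\<alpha> \<in> actions G E \<Longrightarrow> e \<in> E \<Longrightarrow> e \<in> orbit G \<alpha> e"
  using group_action.orbit_refl[OF act_group_action] .

lemma orbit_eq:
  assumes "\<alpha> \<in> actions G E" "e \<in> E" "y \<in> orbit G \<alpha> e"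
  shows "orbit G \<alpha> y = orbit G \<alpha> e"
proof -
  have y: "y \<in> E" using orbit_subset[OF assms(1,2)] assms(3) by (rule subsetD)
  have "orbit G \<alpha> y = orbit G \<alpha> e \<or> orbit G \<alpha> y \<inter> orbit G \<alpha> e = {}"
    by (rule group_action.disjoint_union[OF act_group_action[OF assms(1)]])
      (use y assms(2) in \<open>auto simp: orbits_eq_image\<close>)
  then show ?thesis
    using orbit_self[OF assms(1) y] assms(3) by blast
qed

lemma orbits_Diff_orbit:
  assumes "\<alpha> \<in> actions G E" "e \<in> E"
  shows "orbits G (E - orbit G \<alpha> e) \<alpha> = orbits G E \<alpha> - {orbit G \<alpha> e}"
proof -
  have "orbit G \<alpha> y \<noteq> orbit G \<alpha> e" if "y \<in> E - orbit G \<alpha> e" for y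
    using orbit_self[OF assms(1), of y] that by auto
  moreover have "y \<notin> orbit G \<alpha> e" if "orbit G \<alpha> y \<noteq> orbit G \<alpha> e" for y
    using orbit_eq[OF assms, of y] that by auto
  ultimately show ?thesis
    unfolding orbits_eq_image by auto
qed

lemma orbit_card_le:
  "finite (carrier G) \<Longrightarrow> card (orbit G \<alpha> e) \<le> card (carrier G)"
  unfolding orbit_eq_carrier_image by (rule card_image_le)

lemma burnside_actions:
  assumes "\<alpha> \<in> actions G E" "finite (carrier G)" "finite E"
  shows "card (orbits G E \<alpha>) * card (carrier G) =
    (\<Sum>g\<in>carrier G. card {e \<in> E. \<alpha> g e = e})"
  using group_action.burnside[OF act_group_action[OF assms(1)] assms(2,3)]
  by (simp add: invariants_def order_def)

lemma rcos_eq_iff: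
  assumes "subgroup H G" "a \<in> carrier G" "b \<in> carrier G"
  shows "H #> a = H #> b \<longleftrightarrow> a \<otimes> inv b \<in> H"
  using assms
  by (metis is_group rcos_self repr_independence subgroup.rcos_module)

lemma restrict_subgroup_actions:
  assumes "\<alpha> \<in> actions G E" "subgroup U G"
  shows "restrict \<alpha> U \<in> actions (G\<lparr>carrier := U\<rparr>) E"
  using assms subgroup.mem_carrier[OF assms(2)] subgroup.m_closed[OF assms(2)]
    subgroup.one_closed[OF assms(2)]
  by (auto simp: actions_def PiE_iff)

end

section \<open>Transitive actions and subgroups of finite index\<close>

context group
begin

definition transitive_actions :: "'e set \<Rightarrow> ('a \<Rightarrow> 'e \<Rightarrow> 'e) set" where
  "transitive_actions E = {\<alpha> \<in> actions G E. \<forall>e\<in>E. orbit G \<alpha> e = E}"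

text \<open>The Schreier action on right cosets, transported to \<open>E\<close> along a labelling
  \<open>f\<close>. Right multiplication needs \<open>inv g\<close> to become a left action; the
  point \<open>f H\<close> then has stabilizer \<open>H\<close>.\<close>

definition coset_action :: "'a set \<Rightarrow> ('a set \<Rightarrow> 'e) \<Rightarrow> 'e set \<Rightarrow> 'a \<Rightarrow> 'e \<Rightarrow> 'e" where
  "coset_action H f E = restrict_act G E (\<lambda>g e. f (inv_into (rcosets H) f e #> inv g))"

lemma rcosets_mult_closed:
  assumes "subgroup H G" "C \<in> rcosets H" "g \<in> carrier G"
  shows "C #> g \<in> rcosets H"
proof -
  obtain k where "k \<in> carrier G" "C = H #> k" using assms(2) by (auto simp: RCOSETS_def)
  then show ?thesis
    using assms subgroup.subset[OF assms(1)] by (simp add: coset_mult_assoc rcosetsI)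
qed

lemma rcosets_mult_assoc:
  assumes "subgroup H G" "C \<in> rcosets H" "g \<in> carrier G" "h \<in> carrier G"
  shows "C #> g #> h = C #> (g \<otimes> h)"
  using assms subgroup.rcosets_carrier[OF assms(1) is_group assms(2)]
  by (simp add: coset_mult_assoc)

lemma rcosets_mult_one:
  assumes "subgroup H G" "C \<in> rcosets H"
  shows "C #> \<one> = C"
  using subgroup.rcosets_carrier[OF assms(1) is_group assms(2)] by simp

lemma coset_action_apply:
  assumes "bij_betw f (rcosets H) E" "C \<in> rcosets H" "g \<in> carrier G"
  shows "coset_action H f E g (f C) = f (C #> inv g)"
  using assms bij_betw_inv_into_left[OF assms(1,2)] bij_betwE[OF assms(1)]
  by (simp add: coset_action_def)

lemma coset_action_transitive:
  assumes H: "subgroup H G" and f: "bij_betw f (rcosets H) E"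
  shows "coset_action H f E \<in> transitive_actions E"
proof -
  have mem: "f C \<in> E" if "C \<in> rcosets H" for C using bij_betwE[OF f] that by blast
  have ex: "\<exists>C \<in> rcosets H. e = f C" if "e \<in> E" for e
    using f that by (auto simp: bij_betw_def)
  have act: "coset_action H f E \<in> actions G E"
    unfolding coset_action_def
  proof (rule restrict_act_in_actions)
    fix g h e assume gh: "g \<in> carrier G" "h \<in> carrier G" and e: "e \<in> E"
    obtain C where C: "C \<in> rcosets H" "e = f C" using ex[OF e] by blast
    have inv: "inv_into (rcosets H) f (f B) = B" if "B \<in> rcosets H" for B
      by (rule bij_betw_inv_into_left[OF f that])
    have Ch: "C #> inv h \<in> rcosets H" using rcosets_mult_closed[OF H C(1)] gh by simp
    show "f (inv_into (rcosets H) f e #> inv (g \<otimes> h)) =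
        f (inv_into (rcosets H) f (f (inv_into (rcosets H) f e #> inv h)) #> inv g)"
      using rcosets_mult_assoc[OF H C(1), of "inv h" "inv g"] gh
      by (simp add: C inv[OF C(1)] inv[OF Ch] inv_mult_group)
  next
    fix g e assume gh: "g \<in> carrier G" and e: "e \<in> E"
    obtain C where C: "C \<in> rcosets H" "e = f C" using ex[OF e] by blast
    have inv: "inv_into (rcosets H) f (f B) = B" if "B \<in> rcosets H" for B
      by (rule bij_betw_inv_into_left[OF f that])
    show "f (inv_into (rcosets H) f e #> inv g) \<in> E"
      using mem[OF rcosets_mult_closed[OF H C(1), of "inv g"]] gh by (simp add: C inv)
  next
    fix e assume e: "e \<in> E"
    obtain C where C: "C \<in> rcosets H" "e = f C" using ex[OF e] by blast
    show "f (inv_into (rcosets H) f e #> inv \<one>) = e"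
      using rcosets_mult_one[OF H C(1)] bij_betw_inv_into_left[OF f C(1)] by (simp add: C)
  qed
  have "e' \<in> orbit G (coset_action H f E) e" if e: "e \<in> E" "e' \<in> E" for e e'
  proof -
    obtain C C' where C: "C \<in> rcosets H" "e = f C" "C' \<in> rcosets H" "e' = f C'"
      using ex e by metis
    then obtain k k' where k: "k \<in> carrier G" "C = H #> k" "k' \<in> carrier G" "C' = H #> k'"
      by (auto simp: RCOSETS_def)
    have "C #> inv (inv k' \<otimes> k) = C'"
      using k subgroup.subset[OF H] by (simp add: coset_mult_assoc inv_mult_group m_assoc[symmetric])
    then have "coset_action H f E (inv k' \<otimes> k) e = e'"
      using coset_action_apply[OF f C(1), of "inv k' \<otimes> k"] C k by simp
    then show ?thesis using k unfolding orbit_eq_carrier_image by blast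
  qed
  then show ?thesis
    using act orbit_subset[OF act] by (auto simp: transitive_actions_def)
qed

text \<open>A transitive action with a marked point returns the subgroup as the stabilizer of that
  point, and the labelling because \<open>f (H #> k)\<close> must be the image of the marked point
  under \<open>inv k\<close>. Counting both sides, with n! labellings for each subgroup and n marked
  points for each action, relates s_n to transitive actions.\<close>

lemma bij_betw_pointed_transitive_actions:
  assumes fin: "finite E" "E \<noteq> {}"
  shows "bij_betw (\<lambda>(H, f). (coset_action H f E, f H))
    (SIGMA H : subgroups_of_index G (card E). {f \<in> rcosets H \<rightarrow>\<^sub>E E. inj_on f (rcosets H)})
    (transitive_actions E \<times> E)" (is "bij_betw ?\<Phi> ?S ?T")
proof -
  have sub: "subgroup H G" and bij: "bij_betw f (rcosets H) E" and HH: "H \<in> rcosets H"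
    if "(H, f) \<in> ?S" for H f
  proof -
    have s: "subgroup H G" "finite (rcosets H)" "card (rcosets H) = card E"
      "f \<in> rcosets H \<rightarrow> E" "inj_on f (rcosets H)"
      using that by (auto simp: subgroups_of_index_def PiE_iff)
    show "subgroup H G" by (rule s)
    show "bij_betw f (rcosets H) E"
      using s card_subset_eq[OF fin(1), of "f ` (rcosets H)"] card_image[OF s(5)]
      by (auto simp: bij_betw_def)
    show "H \<in> rcosets H" by (rule subgroup.subgroup_in_rcosets[OF s(1) is_group])
  qed
  have stab: "H = {g \<in> carrier G. coset_action H f E g (f H) = f H}"
    if Hf: "(H, f) \<in> ?S" for H f
  proof -
    note H = sub[OF Hf] and f = bij[OF Hf] and HH = HH[OF Hf]
    have "coset_action H f E g (f H) = f H \<longleftrightarrow> g \<in> H" if g: "g \<in> carrier G" for g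
    proof -
      have "coset_action H f E g (f H) = f H \<longleftrightarrow> H #> inv g = H"
        using coset_action_apply[OF f HH g] rcosets_mult_closed[OF H HH, of "inv g"] g HH
          inj_on_eq_iff[OF bij_betw_imp_inj_on[OF f]] by simp
      also have "\<dots> \<longleftrightarrow> inv g \<in> H"
        using rcos_eq_iff[OF H, of "inv g" \<one>] g subgroup.subset[OF H] by simp
      also have "\<dots> \<longleftrightarrow> g \<in> H"
        using g subgroup.m_inv_closed[OF H, of g] subgroup.m_inv_closed[OF H, of "inv g"] by auto
      finally show ?thesis .
    qed
    then show ?thesis using subgroup.subset[OF H] by auto
  qed
  have val: "f C = coset_action H f E (inv k) (f H)"
    if Hf: "(H, f) \<in> ?S" and "k \<in> carrier G" "C = H #> k" for H f C k
    using coset_action_apply[OF bij[OF Hf] HH[OF Hf], of "inv k"] that by simp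
  have "inj_on ?\<Phi> ?S"
  proof (rule inj_onI)
    fix u v assume u: "u \<in> ?S" "v \<in> ?S" "?\<Phi> u = ?\<Phi> v"
    obtain H f H' f' where uv: "u = (H, f)" "v = (H', f')" by (cases u, cases v)
    have eq: "coset_action H f E = coset_action H' f' E" "f H = f' H'"
      using u uv by auto
    have HH': "H = H'" using stab[of H f] stab[of H' f'] u uv eq by simp
    have "f = f'"
    proof (rule PiE_ext[of f "rcosets H" "\<lambda>_. E"])
      show "f \<in> rcosets H \<rightarrow>\<^sub>E E" "f' \<in> rcosets H \<rightarrow>\<^sub>E E" using u uv HH' by auto
      fix C assume "C \<in> rcosets H"
      then obtain k where "k \<in> carrier G" "C = H #> k" by (auto simp: RCOSETS_def)
      then show "f C = f' C" using val[of H f k C] val[of H' f' k C] u uv eq HH' by simp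
    qed
    then show "u = v" using uv HH' by simp
  qed
  moreover have "?\<Phi> ` ?S = ?T"
  proof (intro equalityI subsetI)
    fix z assume "z \<in> ?\<Phi> ` ?S"
    then obtain H f where z: "(H, f) \<in> ?S" "z = (coset_action H f E, f H)" by auto
    show "z \<in> ?T"
      using coset_action_transitive[OF sub[OF z(1)] bij[OF z(1)]]
        bij_betwE[OF bij[OF z(1)]] HH[OF z(1)] z(2) by auto
  next
    fix z assume "z \<in> ?T"
    then obtain \<alpha> e0 where z: "z = (\<alpha>, e0)" "\<alpha> \<in> actions G E" "e0 \<in> E"
      "orbit G \<alpha> e0 = E" by (auto simp: transitive_actions_def)
    interpret ga: group_action G E \<alpha> by (rule act_group_action[OF z(2)])
    define H where "H = stabilizer G \<alpha> e0"
    define f where "f = (\<lambda>C\<in>rcosets H. orb_stab_fun G \<alpha> C e0)"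
    have H: "subgroup H G" unfolding H_def by (rule ga.stabilizer_subgroup[OF z(3)])
    have f0: "bij_betw f (rcosets H) E"
    proof -
      have "bij_betw (\<lambda>R. \<alpha> (inv (SOME h. h \<in> R)) e0) (rcosets H) E"
        using ga.orbit_stab_fun_is_bij[OF z(3)] z(4) unfolding H_def by simp
      moreover have "f R = \<alpha> (inv (SOME h. h \<in> R)) e0" if "R \<in> rcosets H" for R
        using that by (simp add: f_def orb_stab_fun_def)
      ultimately show ?thesis
        by (subst bij_betw_cong) auto
    qed
    have fk: "f (H #> k) = \<alpha> (inv k) e0" if "k \<in> carrier G" for k
      using ga.orbit_stab_fun_is_well_defined1[OF z(3), of "H #> k" k] that
        rcosetsI[OF subgroup.subset[OF H] that] rcos_self[OF that H]
      by (simp add: f_def H_def orb_stab_fun_def)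
    have card: "finite (rcosets H)" "card (rcosets H) = card E"
      using bij_betw_finite[OF f0] bij_betw_same_card[OF f0] fin by auto
    have S: "(H, f) \<in> ?S"
      using H card f0 by (auto simp: subgroups_of_index_def f_def bij_betw_def)
    have fH: "f H = e0"
      using fk[of \<one>] act_one[OF z(2,3)] subgroup.subset[OF H] by simp
    have "coset_action H f E = \<alpha>"
    proof (rule act_eqI[OF _ z(2)])
      show "coset_action H f E \<in> actions G E"
        using coset_action_transitive[OF H f0] by (simp add: transitive_actions_def)
      fix g e assume g: "g \<in> carrier G" "e \<in> E"
      then obtain k where k: "k \<in> carrier G" "e = \<alpha> k e0"
        using z(4) unfolding orbit_eq_carrier_image by blast
      have "e = f (H #> inv k)" using fk[of "inv k"] k by simp
      then have "coset_action H f E g e = f (H #> inv k #> inv g)"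
        using coset_action_apply[OF f0 rcosetsI[OF subgroup.subset[OF H]], of "inv k" g] k g by simp
      also have "\<dots> = f (H #> inv (g \<otimes> k))"
        using k g subgroup.subset[OF H] by (simp add: coset_mult_assoc inv_mult_group)
      also have "\<dots> = \<alpha> (g \<otimes> k) e0" using fk[of "inv (g \<otimes> k)"] k g by simp
      also have "\<dots> = \<alpha> g e" using act_mult[OF z(2) g(1) k(1) z(3)] k by simp
      finally show "coset_action H f E g e = \<alpha> g e" .
    qed
    then show "z \<in> ?\<Phi> ` ?S" using S fH z(1) by (auto intro!: image_eqI[of _ _ "(H, f)"])
  qed
  ultimately show ?thesis by (simp add: bij_betw_def)
qed

lemma card_inj_PiE:
  assumes "finite A" "finite B" "card A = card B"
  shows "card {f \<in> A \<rightarrow>\<^sub>E B. inj_on f A} = fact (card B)"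
  using card_inj_on_subset_funcset[OF assms(1,2), of A] assms(3)
  by (simp add: fact_prod_rev[where 'a = nat])

lemma card_transitive_actions:
  assumes fin: "finite E" "E \<noteq> {}" "finite (actions G E)"
  shows "finite (subgroups_of_index G (card E))"
    and "fact (card E) * card (subgroups_of_index G (card E)) =
      card E * card (transitive_actions E)"
proof -
  let ?S = "SIGMA H : subgroups_of_index G (card E). {f \<in> rcosets H \<rightarrow>\<^sub>E E. inj_on f (rcosets H)}"
  note bij = bij_betw_pointed_transitive_actions[OF fin(1,2)]
  have c: "card {f \<in> rcosets H \<rightarrow>\<^sub>E E. inj_on f (rcosets H)} = fact (card E)"
    if "H \<in> subgroups_of_index G (card E)" for H
    using card_inj_PiE[of "rcosets H" E] that fin by (simp add: subgroups_of_index_def)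
  have "finite (transitive_actions E)"
    using fin(3) by (rule rev_finite_subset) (auto simp: transitive_actions_def)
  then have finS: "finite ?S" using bij_betw_finite[OF bij] fin by simp
  have fst: "fst ` ?S = subgroups_of_index G (card E)"
  proof -
    have "{f \<in> rcosets H \<rightarrow>\<^sub>E E. inj_on f (rcosets H)} \<noteq> {}"
      if "H \<in> subgroups_of_index G (card E)" for H
    proof
      assume "{f \<in> rcosets H \<rightarrow>\<^sub>E E. inj_on f (rcosets H)} = {}"
      then have "fact (card E) = (0 :: nat)"
        using c[OF that] by (simp only: card.empty)
      then show False by simp
    qed
    then show ?thesis unfolding fst_image_Sigma by auto
  qed
  then show finI: "finite (subgroups_of_index G (card E))"
    using finite_imageI[OF finS, of fst] by (simp only:)
  have "card ?S = (\<Sum>H\<in>subgroups_of_index G (card E). fact (card E))"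
  proof (subst card_SigmaI[OF finI])
    show "\<forall>H\<in>subgroups_of_index G (card E).
        finite {f \<in> rcosets H \<rightarrow>\<^sub>E E. inj_on f (rcosets H)}"
      by (intro ballI card_ge_0_finite) (simp only: c fact_gt_zero)
  qed (simp add: c)
  then show "fact (card E) * card (subgroups_of_index G (card E)) =
      card E * card (transitive_actions E)"
    using bij_betw_same_card[OF bij] by (simp add: card_cartesian_product mult.commute)
qed

end

section \<open>From subgroup growth to the number of actions\<close>

lemma sum_Pow_card:
  fixes g :: "nat \<Rightarrow> real"
  assumes "finite A"
  shows "(\<Sum>R\<in>Pow A. g (card R)) = (\<Sum>i\<le>card A. real (card A choose i) * g i)"
proof -
  have fin: "finite (Pow A)" using assms by simp
  have "(\<Sum>R\<in>Pow A. g (card R)) =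
      (\<Sum>i\<le>card A. \<Sum>R\<in>{R \<in> Pow A. card R = i}. g (card R))"
    by (rule sum.group[symmetric]) (use assms fin in \<open>auto intro: card_mono\<close>)
  also have "\<dots> = (\<Sum>i\<le>card A. real (card A choose i) * g i)"
  proof (rule sum.cong)
    fix i
    have "card {R \<in> Pow A. card R = i} = card A choose i"
      using n_subsets[OF assms, of i] by (simp add: Pow_def)
    then show "(\<Sum>R\<in>{R \<in> Pow A. card R = i}. g (card R)) = real (card A choose i) * g i"
      by simp
  qed simp
  finally show ?thesis .
qed

text \<open>The binomial coefficient and the two factorials combine to m!, and A times the geometric
  sum of (A + 1)^i telescopes to (A + 1)^(m+1) - 1. This is why a factor A per orbit turns into the
  base A + 1 in the inductions below.\<close>

lemma sum_binomial_fact: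
  fixes A :: real
  assumes "A \<ge> 0"
  shows "(\<Sum>i\<le>m. real (m choose i) * (fact (m - i) * (fact i * (A * (A + 1) ^ i))))
    \<le> fact m * (A + 1) ^ Suc m"
proof -
  have "(\<Sum>i\<le>m. real (m choose i) * (fact (m - i) * (fact i * (A * (A + 1) ^ i)))) =
      (\<Sum>i\<le>m. fact m * (A * (A + 1) ^ i))"
  proof (rule sum.cong)
    fix i assume "i \<in> {..m}"
    then have "real (fact i * fact (m - i) * (m choose i)) = real (fact m)"
      using binomial_fact_lemma[of i m] by (simp only: atMost_iff)
    then have "fact i * fact (m - i) * real (m choose i) = (fact m :: real)"
      by simp
    then show "real (m choose i) * (fact (m - i) * (fact i * (A * (A + 1) ^ i))) =
        fact m * (A * (A + 1) ^ i)"
      by (metis (no_types, opaque_lifting) mult.assoc mult.commute)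
  qed simp
  also have "\<dots> = fact m * (A * (\<Sum>i<Suc m. (A + 1) ^ i))"
    by (simp add: sum_distrib_left lessThan_Suc_atMost)
  also have "A * (\<Sum>i<Suc m. (A + 1) ^ i) = (A + 1) ^ Suc m - 1"
    using power_diff_1_eq[of "A + 1" "Suc m"] by simp
  also have "fact m * ((A + 1) ^ Suc m - 1) \<le> fact m * (A + 1) ^ Suc m"
    by simp
  finally show ?thesis .
qed

definition nlog :: "nat \<Rightarrow> real" where
  "nlog n = real n * ln (real n)"

lemma nlog_nonneg: "nlog n \<ge> 0"
  by (cases "n = 0") (auto simp: nlog_def)

text \<open>Splitting a set into an orbit and its complement does not increase the exponent, so an
  induction over orbit decompositions closes with the same coefficient \<open>c\<close>. The
  convention \<open>ln 0 = 0\<close> makes \<open>nlog 0\<close> vanish.\<close>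

lemma nlog_superadditive: "nlog i + nlog j \<le> nlog (i + j)"
proof (cases "i = 0 \<or> j = 0")
  case False
  then have "ln (real i) \<le> ln (real (i + j))" "ln (real j) \<le> ln (real (i + j))" by auto
  then have "real i * ln (real i) + real j * ln (real j) \<le>
      real i * ln (real (i + j)) + real j * ln (real (i + j))"
    by (intro add_mono mult_left_mono) auto
  then show ?thesis by (simp add: nlog_def algebra_simps)
qed (auto simp: nlog_def)

context group
begin

lemma inj_on_split_orbit:
  assumes "e \<in> E"
  shows "inj_on (\<lambda>\<alpha>. (orbit G \<alpha> e, restrict_act G (orbit G \<alpha> e) \<alpha>,
    restrict_act G (E - orbit G \<alpha> e) \<alpha>)) (actions G E)"
proof (rule inj_onI)
  fix \<alpha> \<beta> assume ab: "\<alpha> \<in> actions G E" "\<beta> \<in> actions G E"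
    "(orbit G \<alpha> e, restrict_act G (orbit G \<alpha> e) \<alpha>, restrict_act G (E - orbit G \<alpha> e) \<alpha>) =
     (orbit G \<beta> e, restrict_act G (orbit G \<beta> e) \<beta>, restrict_act G (E - orbit G \<beta> e) \<beta>)"
  show "\<alpha> = \<beta>"
    by (rule restrict_act_eqD[OF ab(1,2) orbit_subset[OF ab(1) assms]]) (use ab(3) in auto)
qed

lemma restrict_act_orbit_transitive:
  assumes "\<alpha> \<in> actions G E" "e \<in> E"
  shows "restrict_act G (orbit G \<alpha> e) \<alpha> \<in> transitive_actions (orbit G \<alpha> e)"
  using restrict_act_orbit(1)[OF assms] orbit_eq[OF assms]
  by (auto simp: transitive_actions_def orbit_restrict_act)

text \<open>The action is cut at the orbit of \<open>e\<close>. Summing over the complement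
  \<open>R\<close> of that orbit makes the index set \<open>Pow (E - {e})\<close>, so bounds that
  depend only on \<open>card R\<close> can be summed by \<open>sum_Pow_card\<close>.\<close>

lemma card_actions_le_sum:
  assumes fin: "finite E" "\<And>E'. E' \<subseteq> E \<Longrightarrow> finite (actions G E')" and e: "e \<in> E"
  shows "card (actions G E) \<le>
    (\<Sum>R\<in>Pow (E - {e}). card (transitive_actions (E - R)) * card (actions G R))"
proof -
  let ?f = "\<lambda>\<alpha>. (E - orbit G \<alpha> e, restrict_act G (orbit G \<alpha> e) \<alpha>,
    restrict_act G (E - orbit G \<alpha> e) \<alpha>)"
  let ?S = "SIGMA R : Pow (E - {e}). transitive_actions (E - R) \<times> actions G R"
  have finT: "finite (transitive_actions (E - R))" for R
    using fin(2)[of "E - R"] by (rule rev_finite_subset) (auto simp: transitive_actions_def)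
  have finS: "finite ?S"
    using fin finT by (intro finite_SigmaI) auto
  have inj: "inj_on ?f (actions G E)"
  proof (rule inj_onI)
    fix \<alpha> \<beta> assume ab: "\<alpha> \<in> actions G E" "\<beta> \<in> actions G E" "?f \<alpha> = ?f \<beta>"
    have "orbit G \<alpha> e = orbit G \<beta> e"
      using ab(3) orbit_subset[OF ab(1) e] orbit_subset[OF ab(2) e] by auto
    then show "\<alpha> = \<beta>"
      using inj_onD[OF inj_on_split_orbit[OF e], of \<alpha> \<beta>] ab by auto
  qed
  have "?f ` actions G E \<subseteq> ?S"
  proof
    fix z assume "z \<in> ?f ` actions G E"
    then obtain \<alpha> where a: "\<alpha> \<in> actions G E" "z = ?f \<alpha>" by auto
    have "E - (E - orbit G \<alpha> e) = orbit G \<alpha> e"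
      using orbit_subset[OF a(1) e] by auto
    then show "z \<in> ?S"
      using a(2) restrict_act_orbit_transitive[OF a(1) e] restrict_act_orbit(2)[OF a(1) e]
        orbit_self[OF a(1) e] by auto
  qed
  then have "card (actions G E) \<le> card ?S"
    by (rule card_inj_on_le[OF inj _ finS])
  also have "\<dots> = (\<Sum>R\<in>Pow (E - {e}). card (transitive_actions (E - R)) * card (actions G R))"
    using fin finT by (subst card_SigmaI) (auto simp: card_cartesian_product)
  finally show ?thesis .
qed

lemma card_actions_empty: "card (actions G {}) \<le> 1"
proof -
  have "actions G {} \<subseteq> {\<lambda>g\<in>carrier G. \<lambda>e\<in>{}. undefined}"
    by (auto simp: actions_def PiE_iff extensional_def fun_eq_iff)
  from card_mono[OF _ this] show ?thesis by simp
qed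

text \<open>Converts a bound for every s_k into one for all actions, transitive or not, at the price
  of n! (C + 1)^n. An orbit of \<open>e\<close> with k points carries (k - 1)! s_k transitive
  actions; the remaining points are handled by induction, and the exponents merge by
  superadditivity.\<close>

lemma card_actions_le_of_subgroups_of_index_le:
  fixes c C :: real and E :: "'e set"
  assumes fin: "\<And>E' :: 'e set. finite E' \<Longrightarrow> finite (actions G E')"
    and c: "c \<ge> 0" and C: "C \<ge> 0"
    and s: "\<And>k. k \<ge> 1 \<Longrightarrow> real (card (subgroups_of_index G k)) \<le> C * exp (c * nlog k)"
    and E: "finite E"
  shows "real (card (actions G E)) \<le> fact (card E) * (C + 1) ^ card E * exp (c * nlog (card E))"
  using E
proof (induction "card E" arbitrary: E rule: less_induct)
  case less
  show ?case
  proof (cases "E = {}")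
    case True
    then show ?thesis using card_actions_empty by (simp add: nlog_def)
  next
    case False
    then obtain e where e: "e \<in> E" by blast
    define n where "n = card E"
    have n: "n \<ge> 1" using False less.prems by (simp add: n_def Suc_le_eq card_gt_0_iff)
    have ce: "card (E - {e}) = n - 1" using e by (simp add: n_def less.prems)
    have bound: "real (card (transitive_actions (E - R)) * card (actions G R)) \<le>
      fact (n - 1 - card R) * (fact (card R) * (C * (C + 1) ^ card R)) * exp (c * nlog n)"
      if R: "R \<in> Pow (E - {e})" for R
    proof -
      have finR: "finite R" using R less.prems finite_subset by auto
      have RE: "R \<subset> E" using R e by auto
      have cR: "card R < n" unfolding n_def by (rule psubset_card_mono[OF less.prems RE])
      have cER: "card (E - R) = n - card R"
        using RE finR by (simp add: n_def card_Diff_subset)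
      have "E - R \<noteq> {}" using RE by auto
      note T = card_transitive_actions[OF finite_Diff[OF less.prems, of R] this
          fin[OF finite_Diff[OF less.prems, of R]], unfolded cER]
      have F: "fact (n - card R) = (n - card R) * fact (n - 1 - card R)"
        using fact_reduce[of "n - card R", where 'a = nat] cR by (simp add: diff_right_commute)
      have "(n - card R) * card (transitive_actions (E - R)) =
          (n - card R) * (fact (n - 1 - card R) * card (subgroups_of_index G (n - card R)))"
        by (simp only: T(2)[symmetric] F mult.assoc)
      moreover have "n - card R \<noteq> 0" using cR by simp
      \<comment> \<open>The relation k! s_k = k t_k is divided by k = n - card R, which is positive
        because \<open>R\<close> omits \<open>e\<close>.\<close>
      ultimately have Teq: "card (transitive_actions (E - R)) =
          fact (n - 1 - card R) * card (subgroups_of_index G (n - card R))"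
        using mult_left_cancel by blast
      have 1: "real (card (transitive_actions (E - R))) \<le>
          fact (n - 1 - card R) * (C * exp (c * nlog (n - card R)))"
        unfolding Teq using s[of "n - card R"] cR by simp
      have 2: "real (card (actions G R)) \<le>
          fact (card R) * (C + 1) ^ card R * exp (c * nlog (card R))"
        by (rule less.hyps) (use cR finR in \<open>auto simp: n_def\<close>)
      have 3: "exp (c * nlog (n - card R)) * exp (c * nlog (card R)) \<le> exp (c * nlog n)"
        using nlog_superadditive[of "n - card R" "card R"] cR c
        by (simp add: exp_add[symmetric] distrib_left[symmetric] mult_left_mono)
      have "real (card (transitive_actions (E - R)) * card (actions G R)) \<le>
          (fact (n - 1 - card R) * (C * exp (c * nlog (n - card R)))) *
          (fact (card R) * (C + 1) ^ card R * exp (c * nlog (card R)))"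
        unfolding of_nat_mult by (rule mult_mono[OF 1 2]) (use C in auto)
      also have "\<dots> = fact (n - 1 - card R) * (fact (card R) * (C * (C + 1) ^ card R)) *
          (exp (c * nlog (n - card R)) * exp (c * nlog (card R)))"
        by (simp add: mult_ac)
      also have "\<dots> \<le> fact (n - 1 - card R) * (fact (card R) * (C * (C + 1) ^ card R)) *
          exp (c * nlog n)"
        by (rule mult_left_mono[OF 3]) (use C in simp)
      finally show ?thesis .
    qed
    have "real (card (actions G E)) \<le>
        real (\<Sum>R\<in>Pow (E - {e}). card (transitive_actions (E - R)) * card (actions G R))"
      by (rule of_nat_mono[OF card_actions_le_sum[OF less.prems _ e]])
        (use fin less.prems finite_subset in blast)
    also have "\<dots> \<le> (\<Sum>R\<in>Pow (E - {e}).
        fact (n - 1 - card R) * (fact (card R) * (C * (C + 1) ^ card R)) * exp (c * nlog n))"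
      unfolding of_nat_sum by (rule sum_mono[OF bound])
    also have "\<dots> = (\<Sum>i\<le>n - 1. real (n - 1 choose i) *
        (fact (n - 1 - i) * (fact i * (C * (C + 1) ^ i)))) * exp (c * nlog n)"
      using sum_Pow_card[of "E - {e}" "\<lambda>i. fact (n - 1 - i) * (fact i * (C * (C + 1) ^ i))"]
        less.prems ce by (simp add: sum_distrib_right[symmetric])
    also have "\<dots> \<le> (fact (n - 1) * (C + 1) ^ Suc (n - 1)) * exp (c * nlog n)"
      by (rule mult_right_mono[OF sum_binomial_fact[OF C]]) simp
    also have "\<dots> \<le> fact n * (C + 1) ^ n * exp (c * nlog n)"
    proof -
      have "fact (n - 1) \<le> (fact n :: real)" by (rule fact_mono) simp
      then show ?thesis using n C by (intro mult_right_mono) auto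
    qed
    finally show ?thesis by (simp add: n_def)
  qed
qed

end

section \<open>Counting extensions of an action of a subgroup\<close>

context group
begin

text \<open>\<open>\<sigma>\<close> is a bare function of which only the values on \<open>U\<close>
  and \<open>E\<close> count, so the same \<open>\<sigma>\<close> serves for all invariant subsets
  of \<open>E\<close> during the induction.\<close>

definition extensions :: "'a set \<Rightarrow> 'e set \<Rightarrow> ('a \<Rightarrow> 'e \<Rightarrow> 'e) \<Rightarrow> nat \<Rightarrow> ('a \<Rightarrow> 'e \<Rightarrow> 'e) set" where
  "extensions U E \<sigma> M =
    {\<beta> \<in> actions G E. (\<forall>u\<in>U. \<forall>e\<in>E. \<beta> u e = \<sigma> u e) \<and> card (orbits G E \<beta>) = M}"

abbreviation sub_orbits :: "'a set \<Rightarrow> 'e set \<Rightarrow> ('a \<Rightarrow> 'e \<Rightarrow> 'e) \<Rightarrow> 'e set set" where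
  "sub_orbits U E \<sigma> \<equiv> orbits (G\<lparr>carrier := U\<rparr>) E \<sigma>"

abbreviation sub_orbit :: "'a set \<Rightarrow> ('a \<Rightarrow> 'e \<Rightarrow> 'e) \<Rightarrow> 'e \<Rightarrow> 'e set" where
  "sub_orbit U \<sigma> e \<equiv> orbit (G\<lparr>carrier := U\<rparr>) \<sigma> e"

lemma sub_orbit_eq_image: "sub_orbit U \<sigma> e = (\<lambda>u. \<sigma> u e) ` U"
  by (auto simp: orbit_def)

lemma sub_orbits_eq_image: "sub_orbits U E \<sigma> = sub_orbit U \<sigma> ` E"
  by (auto simp: orbits_def)

lemma sub_orbits_cong:
  assumes "\<And>u e. u \<in> U \<Longrightarrow> e \<in> E \<Longrightarrow> \<beta> u e = \<sigma> u e"
  shows "sub_orbits U E \<beta> = sub_orbits U E \<sigma>"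
  unfolding sub_orbits_eq_image sub_orbit_eq_image using assms by (intro image_cong) auto

lemma sub_orbit_subset_orbit:
  "subgroup U G \<Longrightarrow> sub_orbit U \<beta> e \<subseteq> orbit G \<beta> e"
  unfolding sub_orbit_eq_image orbit_eq_carrier_image using subgroup.subset by blast

lemma sub_orbit_eq:
  assumes "\<beta> \<in> actions G E" "subgroup U G" "e \<in> E" "y \<in> sub_orbit U \<beta> e"
  shows "sub_orbit U \<beta> y = sub_orbit U \<beta> e"
proof -
  have o: "sub_orbit U (restrict \<beta> U) z = sub_orbit U \<beta> z" for z
    unfolding sub_orbit_eq_image by (rule image_cong) auto
  show ?thesis
    using group.orbit_eq[OF subgroup_imp_group[OF assms(2)] restrict_subgroup_actions[OF assms(1,2)],
        of e y] assms o by simp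
qed

lemma sub_orbit_self:
  assumes "\<beta> \<in> actions G E" "subgroup U G" "e \<in> E"
  shows "e \<in> sub_orbit U \<beta> e"
  using act_one[OF assms(1,3)] subgroup.one_closed[OF assms(2)]
  unfolding sub_orbit_eq_image by (metis imageI)

lemma card_orbits_le_sub_orbits:
  assumes "\<beta> \<in> actions G E" "subgroup U G" "finite E"
  shows "card (orbits G E \<beta>) \<le> card (sub_orbits U E \<beta>)"
proof -
  have "orbit G \<beta> (SOME y. y \<in> sub_orbit U \<beta> e) = orbit G \<beta> e" if "e \<in> E" for e
  proof -
    have "(SOME y. y \<in> sub_orbit U \<beta> e) \<in> sub_orbit U \<beta> e"
      by (rule someI) (rule sub_orbit_self[OF assms(1,2) that])
    then show ?thesis
      using sub_orbit_subset_orbit[OF assms(2), of \<beta> e] orbit_eq[OF assms(1) that] by auto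
  qed
  then have "orbits G E \<beta> = (\<lambda>Z. orbit G \<beta> (SOME y. y \<in> Z)) ` sub_orbits U E \<beta>"
    unfolding orbits_eq_image sub_orbits_eq_image image_image by (intro image_cong) auto
  then show ?thesis
    using card_image_le[of "sub_orbits U E \<beta>"] assms(3) by (simp add: sub_orbits_eq_image)
qed

text \<open>An orbit has at most |G| points, so a set carrying a transitive action has bounded size,
  and the bound on the number of such actions does not depend on \<open>B\<close>.\<close>

lemma card_transitive_actions_le:
  assumes "finite (carrier G)" "finite B"
  shows "card (transitive_actions B) \<le> (card (carrier G) ^ card (carrier G)) ^ card (carrier G)"
proof (cases "transitive_actions B = {} \<or> B = {}")
  case True
  have "card (transitive_actions B) \<le> 1"
  proof (cases "B = {}")
    case True
    have "card (transitive_actions B) \<le> card (actions G B)"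
      using finite_actions[OF assms] by (rule card_mono) (auto simp: transitive_actions_def)
    then show ?thesis using card_actions_empty True by (metis le_trans)
  next
    case False
    then show ?thesis using \<open>transitive_actions B = {} \<or> B = {}\<close> by simp
  qed
  also have "1 \<le> (card (carrier G) ^ card (carrier G)) ^ card (carrier G)"
    using assms(1) by (simp add: Suc_le_eq card_gt_0_iff)
  finally show ?thesis .
next
  case False
  then obtain \<alpha> b where "\<alpha> \<in> transitive_actions B" "b \<in> B" by blast
  then have le: "card B \<le> card (carrier G)"
    using orbit_card_le[OF assms(1), of \<alpha> b] by (auto simp: transitive_actions_def)
  have B: "card B \<ge> 1" using False assms by (simp add: Suc_le_eq card_gt_0_iff)
  have "transitive_actions B \<subseteq> carrier G \<rightarrow>\<^sub>E (B \<rightarrow>\<^sub>E B)"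
    by (auto simp: transitive_actions_def actions_def)
  then have "card (transitive_actions B) \<le> card (carrier G \<rightarrow>\<^sub>E (B \<rightarrow>\<^sub>E B))"
    by (rule card_mono[rotated]) (intro finite_PiE assms)
  also have "\<dots> = (card B ^ card B) ^ card (carrier G)"
    using assms by (simp add: card_funcsetE)
  also have "card B ^ card B \<le> card (carrier G) ^ card (carrier G)"
    using le B by (meson le_trans power_increasing power_mono zero_le)
  finally show ?thesis by (simp add: power_mono)
qed

definition trans_bound :: real where
  "trans_bound = real ((card (carrier G) ^ card (carrier G)) ^ card (carrier G))"

text \<open>The G-orbit of \<open>e\<close> is a union of U-orbits. Its complement is encoded as a
  set \<open>R\<close> of U-orbits rather than of points, so the recursion counts in q instead of n.
  The given extension \<open>\<beta>0\<close> ensures that the U-orbits of \<open>\<sigma>\<close>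
  stay inside \<open>E\<close>.\<close>

lemma card_extensions_step:
  assumes fin: "finite (carrier G)" "finite E" and U: "subgroup U G" and e: "e \<in> E"
    and \<beta>0: "\<beta>0 \<in> extensions U E \<sigma> M"
  shows "card (extensions U E \<sigma> M) \<le>
    (\<Sum>R\<in>Pow (sub_orbits U E \<sigma> - {sub_orbit U \<sigma> e}).
      card (transitive_actions (E - \<Union>R)) * card (extensions U (\<Union>R) \<sigma> (M - 1)))"
proof -
  let ?Q = "sub_orbits U E \<sigma>"
  let ?f = "\<lambda>\<alpha>. (sub_orbits U (E - orbit G \<alpha> e) \<sigma>, restrict_act G (orbit G \<alpha> e) \<alpha>,
    restrict_act G (E - orbit G \<alpha> e) \<alpha>)"
  let ?S = "SIGMA R : Pow (?Q - {sub_orbit U \<sigma> e}).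
    transitive_actions (E - \<Union>R) \<times> extensions U (\<Union>R) \<sigma> (M - 1)"
  have finQ: "finite ?Q" using fin by (simp add: sub_orbits_eq_image)
  have QE: "\<Union>?Q \<subseteq> E"
  proof -
    have "?Q = sub_orbits U E \<beta>0"
      by (rule sub_orbits_cong[symmetric]) (use \<beta>0 in \<open>auto simp: extensions_def\<close>)
    moreover have "sub_orbit U \<beta>0 y \<subseteq> E" if "y \<in> E" for y
      using sub_orbit_subset_orbit[OF U, of \<beta>0 y] orbit_subset[OF _ that, of \<beta>0] \<beta>0
      by (auto simp: extensions_def)
    ultimately show ?thesis unfolding sub_orbits_eq_image by blast
  qed
  have finT: "finite (transitive_actions (E - \<Union>R))" for R
    using finite_actions[OF fin(1), of "E - \<Union>R"] fin
    by (rule_tac rev_finite_subset) (auto simp: transitive_actions_def)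
  have finR: "finite (extensions U (\<Union>R) \<sigma> (M - 1))" if "R \<in> Pow (?Q - {sub_orbit U \<sigma> e})" for R
  proof -
    have "\<Union>R \<subseteq> E" using that QE by auto
    then have "finite (actions G (\<Union>R))"
      by (intro finite_actions[OF fin(1)] finite_subset[OF _ fin(2)])
    then show ?thesis by (rule rev_finite_subset) (auto simp: extensions_def)
  qed
  have finS: "finite ?S"
    using finQ finT finR by (intro finite_SigmaI) auto
  have un: "\<Union>(sub_orbits U (E - orbit G \<beta> e) \<sigma>) = E - orbit G \<beta> e"
    and fS: "?f \<beta> \<in> ?S" if b: "\<beta> \<in> extensions U E \<sigma> M" for \<beta>
  proof -
    have act: "\<beta> \<in> actions G E" and eq: "\<And>u y. u \<in> U \<Longrightarrow> y \<in> E \<Longrightarrow> \<beta> u y = \<sigma> u y"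
      and M: "card (orbits G E \<beta>) = M"
      using b by (auto simp: extensions_def)
    let ?O = "orbit G \<beta> e"
    have Oe: "e \<in> ?O" by (rule orbit_self[OF act e])
    have OE: "?O \<subseteq> E" by (rule orbit_subset[OF act e])
    have so: "sub_orbit U \<sigma> y = sub_orbit U \<beta> y" if "y \<in> E" for y
      unfolding sub_orbit_eq_image using eq that by (intro image_cong) auto
    have self: "y \<in> sub_orbit U \<sigma> y" if "y \<in> E" for y
      using sub_orbit_self[OF act U that] so[OF that] by simp
    have sub: "sub_orbit U \<sigma> y \<subseteq> E - ?O" if y: "y \<in> E - ?O" for y
    proof -
      have "\<sigma> u y \<in> E - ?O" if "u \<in> U" for u
        using invariant_Diff[OF act OE orbit_invariant[OF act e], of u y] that y eq[of u y]
          subgroup.mem_carrier[OF U that] by auto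
      then show ?thesis unfolding sub_orbit_eq_image by auto
    qed
    show un: "\<Union>(sub_orbits U (E - ?O) \<sigma>) = E - ?O"
      unfolding sub_orbits_eq_image using self sub by auto
    have 1: "sub_orbits U (E - ?O) \<sigma> \<in> Pow (?Q - {sub_orbit U \<sigma> e})"
      using self[OF e] sub Oe unfolding sub_orbits_eq_image by auto
    have 2: "restrict_act G ?O \<beta> \<in> transitive_actions (E - (E - ?O))"
      using restrict_act_orbit_transitive[OF act e] OE by (simp add: double_diff)
    have finO: "finite (orbits G E \<beta>)" using fin by (simp add: orbits_eq_image)
    have "restrict_act G (E - ?O) \<beta> \<in> extensions U (E - ?O) \<sigma> (M - 1)"
      using restrict_act_orbit(2)[OF act e] eq subgroup.mem_carrier[OF U] M e finO
      by (auto simp: extensions_def orbits_restrict_act orbits_Diff_orbit[OF act e])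
        (simp add: orbits_eq_image)
    then show "?f \<beta> \<in> ?S" using 1 2 un by auto
  qed
  have inj: "inj_on ?f (extensions U E \<sigma> M)"
  proof (rule inj_onI)
    fix \<alpha> \<beta> assume ab: "\<alpha> \<in> extensions U E \<sigma> M" "\<beta> \<in> extensions U E \<sigma> M" "?f \<alpha> = ?f \<beta>"
    have act: "\<alpha> \<in> actions G E" "\<beta> \<in> actions G E" using ab by (auto simp: extensions_def)
    have "E - orbit G \<alpha> e = E - orbit G \<beta> e"
      using arg_cong[OF ab(3), of "\<lambda>t. \<Union>(fst t)"] unfolding fst_conv un[OF ab(1)] un[OF ab(2)] .
    then have "orbit G \<alpha> e = orbit G \<beta> e"
      using orbit_subset[OF act(1) e] orbit_subset[OF act(2) e] by blast
    then show "\<alpha> = \<beta>"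
      using inj_onD[OF inj_on_split_orbit[OF e], of \<alpha> \<beta>] ab act by auto
  qed
  have "?f ` extensions U E \<sigma> M \<subseteq> ?S" by (rule image_subsetI) (rule fS)
  then have "card (extensions U E \<sigma> M) \<le> card ?S"
    by (rule card_inj_on_le[OF inj _ finS])
  also have "\<dots> = (\<Sum>R\<in>Pow (?Q - {sub_orbit U \<sigma> e}).
      card (transitive_actions (E - \<Union>R)) * card (extensions U (\<Union>R) \<sigma> (M - 1)))"
    using finQ finT finR by (subst card_SigmaI) (auto simp: card_cartesian_product)
  finally show ?thesis .
qed

lemma sub_orbits_Union:
  assumes "\<beta> \<in> actions G E" "subgroup U G" "R \<subseteq> sub_orbits U E \<beta>"
  shows "sub_orbits U (\<Union>R) \<beta> = R"
proof -
  have Z: "Z \<noteq> {} \<and> (\<forall>y\<in>Z. sub_orbit U \<beta> y = Z)" if ZR: "Z \<in> R" for Z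
  proof -
    obtain z where z: "z \<in> E" "Z = sub_orbit U \<beta> z"
      using assms(3) ZR unfolding sub_orbits_eq_image by blast
    have "\<forall>y\<in>Z. sub_orbit U \<beta> y = Z"
      unfolding z(2) using sub_orbit_eq[OF assms(1,2) z(1)] by (intro ballI)
    moreover have "Z \<noteq> {}"
      using sub_orbit_self[OF assms(1,2) z(1)] unfolding z(2) by (rule ex_in_conv[THEN iffD1, OF exI])
    ultimately show ?thesis by blast
  qed
  show ?thesis
    unfolding sub_orbits_eq_image
  proof (intro equalityI subsetI)
    fix Z assume "Z \<in> sub_orbit U \<beta> ` \<Union>R"
    then obtain y Z' where "y \<in> Z'" "Z' \<in> R" "Z = sub_orbit U \<beta> y" by blast
    then show "Z \<in> R" using Z[of Z'] by simp
  next
    fix Z assume ZR: "Z \<in> R"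
    then obtain y where "y \<in> Z" using Z[of Z] by blast
    then show "Z \<in> sub_orbit U \<beta> ` \<Union>R" using Z[OF ZR] ZR by blast
  qed
qed

text \<open>An extension groups the q U-orbits into M G-orbits, each carrying boundedly many
  structures. Removing the G-orbit of \<open>e\<close> lowers M by one, and the sum over the
  remaining U-orbits collapses to (q - 1)! by \<open>sum_binomial_fact\<close>.\<close>

lemma card_extensions_le:
  assumes fin: "finite (carrier G)" "finite E" and U: "subgroup U G"
  shows "real (card (extensions U E \<sigma> M)) \<le>
    (trans_bound + 1) ^ card (sub_orbits U E \<sigma>) * (fact (card (sub_orbits U E \<sigma>)) / fact M)"
  using fin(2)
proof (induction "card E" arbitrary: E M rule: less_induct)
  case less
  let ?C = trans_bound
  have C: "?C \<ge> 0" by (simp add: trans_bound_def)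
  show ?case
  proof (cases "extensions U E \<sigma> M = {}")
    case True
    then show ?thesis using C by simp
  next
    case False
    then obtain \<beta> where b: "\<beta> \<in> extensions U E \<sigma> M" by blast
    then have act: "\<beta> \<in> actions G E" and M: "card (orbits G E \<beta>) = M"
      and eq: "\<And>u y. u \<in> U \<Longrightarrow> y \<in> E \<Longrightarrow> \<beta> u y = \<sigma> u y"
      by (auto simp: extensions_def)
    have so: "sub_orbits U A \<sigma> = sub_orbits U A \<beta>" if "A \<subseteq> E" for A
      by (rule sub_orbits_cong[symmetric]) (use eq that in auto)
    define q where "q = card (sub_orbits U E \<sigma>)"
    have Mq: "M \<le> q"
      using card_orbits_le_sub_orbits[OF act U less.prems] M so[OF subset_refl] by (simp add: q_def)
    show ?thesis
    proof (cases "E = {}")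
      case True
      have "card (extensions U E \<sigma> M) \<le> card (actions G E)"
        using finite_actions[OF fin(1) less.prems] by (rule card_mono) (auto simp: extensions_def)
      also have "\<dots> \<le> 1" using card_actions_empty True by simp
      finally show ?thesis using True M by (simp add: orbits_def)
    next
      case False
      then obtain e where e: "e \<in> E" by blast
      let ?o = "sub_orbit U \<sigma> e"
      have finQ: "finite (sub_orbits U E \<sigma>)" using less.prems by (simp add: sub_orbits_eq_image)
      have M1: "M \<ge> 1"
        using e M less.prems by (auto simp: Suc_le_eq card_gt_0_iff orbits_eq_image)
      have oQ: "?o \<in> sub_orbits U E \<sigma>" using e by (simp add: sub_orbits_eq_image)
      have cQ: "card (sub_orbits U E \<sigma> - {?o}) = q - 1"
        using oQ finQ by (simp add: q_def)
      have bound: "real (card (transitive_actions (E - \<Union>R)) *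
          card (extensions U (\<Union>R) \<sigma> (M - 1))) \<le>
          fact (q - 1 - card R) * (fact (card R) * (?C * (?C + 1) ^ card R)) / fact (M - 1)"
        if R: "R \<in> Pow (sub_orbits U E \<sigma> - {?o})" for R
      proof -
        have R': "R \<subseteq> sub_orbits U E \<beta>" using R so[OF subset_refl] by auto
        have RE: "\<Union>R \<subseteq> E"
        proof -
          have "sub_orbit U \<beta> y \<subseteq> E" if "y \<in> E" for y
            using sub_orbit_subset_orbit[OF U, of \<beta> y] orbit_subset[OF act that] by blast
          then show ?thesis using R' unfolding sub_orbits_eq_image by blast
        qed
        have sR: "sub_orbits U (\<Union>R) \<sigma> = R"
          unfolding so[OF RE] by (rule sub_orbits_Union[OF act U R'])
        have "e \<notin> \<Union>R"
        proof
          assume "e \<in> \<Union>R"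
          then have "sub_orbit U \<sigma> e \<in> sub_orbits U (\<Union>R) \<sigma>"
            unfolding sub_orbits_eq_image by blast
          then show False using sR R by auto
        qed
        then have lt: "card (\<Union>R) < card E"
          using RE e by (intro psubset_card_mono less.prems) auto
        have 1: "real (card (transitive_actions (E - \<Union>R))) \<le> ?C"
          unfolding trans_bound_def of_nat_le_iff
          by (rule card_transitive_actions_le) (use fin less.prems in auto)
        have 2: "real (card (extensions U (\<Union>R) \<sigma> (M - 1))) \<le>
            (?C + 1) ^ card R * (fact (card R) / fact (M - 1))"
          using less.hyps[OF lt finite_subset[OF RE less.prems], of "M - 1"] sR by simp
        have "real (card (transitive_actions (E - \<Union>R)) * card (extensions U (\<Union>R) \<sigma> (M - 1))) \<le>
            ?C * ((?C + 1) ^ card R * (fact (card R) / fact (M - 1)))"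
          unfolding of_nat_mult by (rule mult_mono[OF 1 2]) (use C in auto)
        \<comment> \<open>The factorial is at least 1; it is inserted to produce the summand of
          \<open>sum_binomial_fact\<close>.\<close>
        also have "\<dots> \<le> fact (q - 1 - card R) *
            (?C * ((?C + 1) ^ card R * (fact (card R) / fact (M - 1))))"
          using mult_right_mono[OF fact_ge_1[of "q - 1 - card R", where 'a = real],
              of "?C * ((?C + 1) ^ card R * (fact (card R) / fact (M - 1)))"] C by simp
        finally show ?thesis by (simp add: mult_ac)
      qed
      have "real (card (extensions U E \<sigma> M)) \<le>
          real (\<Sum>R\<in>Pow (sub_orbits U E \<sigma> - {?o}).
            card (transitive_actions (E - \<Union>R)) * card (extensions U (\<Union>R) \<sigma> (M - 1)))"
        by (rule of_nat_mono[OF card_extensions_step[OF fin(1) less.prems U e b]])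
      also have "\<dots> \<le> (\<Sum>R\<in>Pow (sub_orbits U E \<sigma> - {?o}).
          fact (q - 1 - card R) * (fact (card R) * (?C * (?C + 1) ^ card R)) / fact (M - 1))"
        unfolding of_nat_sum by (rule sum_mono[OF bound])
      also have "\<dots> = (\<Sum>i\<le>q - 1. real (q - 1 choose i) *
          (fact (q - 1 - i) * (fact i * (?C * (?C + 1) ^ i)))) / fact (M - 1)"
        using sum_Pow_card[of "sub_orbits U E \<sigma> - {?o}"
            "\<lambda>i. fact (q - 1 - i) * (fact i * (?C * (?C + 1) ^ i))"]
          finQ cQ by (simp add: sum_divide_distrib[symmetric])
      also have "\<dots> \<le> (fact (q - 1) * (?C + 1) ^ Suc (q - 1)) / fact (M - 1)"
        by (rule divide_right_mono[OF sum_binomial_fact[OF C]]) simp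
      also have "\<dots> = (?C + 1) ^ q * (fact (q - 1) / fact (M - 1))"
        using M1 Mq by simp
      \<comment> \<open>Passing from (q - 1)!/(M - 1)! to q!/M! multiplies by q/M, which is at least
        1 because every G-orbit contains a U-orbit.\<close>
      also have "\<dots> \<le> (?C + 1) ^ q * (fact q / fact M)"
      proof (rule mult_left_mono)
        have "fact q / fact M = (real q / real M) * (fact (q - 1) / fact (M - 1))"
          using M1 Mq by (simp add: fact_reduce)
        moreover have "real q / real M \<ge> 1" using M1 Mq by simp
        ultimately show "fact (q - 1) / fact (M - 1) \<le> (fact q / fact M :: real)"
          using mult_right_mono[of 1 "real q / real M" "fact (q - 1) / fact (M - 1)"] by simp
      qed (use C in simp)
      finally show ?thesis by (simp add: q_def)
    qed
  qed
qed

end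

section \<open>The universal property of the amalgam\<close>

definition word_act :: "('a \<Rightarrow> 'e \<Rightarrow> 'e) \<Rightarrow> ('b \<Rightarrow> 'e \<Rightarrow> 'e) \<Rightarrow> ('a + 'b) list \<Rightarrow> 'e \<Rightarrow> 'e" where
  "word_act \<alpha> \<beta> w = foldr (\<lambda>l. case l of Inl a \<Rightarrow> \<alpha> a | Inr b \<Rightarrow> \<beta> b) w"

lemma word_act_simps [simp]:
  "word_act \<alpha> \<beta> [] e = e"
  "word_act \<alpha> \<beta> (Inl a # w) e = \<alpha> a (word_act \<alpha> \<beta> w e)"
  "word_act \<alpha> \<beta> (Inr b # w) e = \<beta> b (word_act \<alpha> \<beta> w e)"
  "word_act \<alpha> \<beta> (v @ w) e = word_act \<alpha> \<beta> v (word_act \<alpha> \<beta> w e)"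
  by (simp_all add: word_act_def)

text \<open>Fixes the product of two copies of \<open>G\<close> along the same map on both sides.
  The counting refers to the image \<open>U\<close>; \<open>C\<close> and \<open>\<phi>\<close> are
  kept so that \<open>\<Gamma>\<close> is literally an \<open>amalgamated_product\<close>.\<close>

locale double = group G for G (structure) +
  fixes C :: "('c, 'k) monoid_scheme" and \<phi> :: "'c \<Rightarrow> 'a" and U :: "'a set"
  assumes image: "\<phi> ` carrier C = U" and U: "subgroup U G"
begin

definition amalg :: "('a + 'a) list set monoid" (\<open>\<Gamma>\<close>) where
  "\<Gamma> = amalgamated_product G G C \<phi> \<phi>"

abbreviation "rel \<equiv> amalgam_rel G G C \<phi> \<phi>"

definition left :: "'a \<Rightarrow> ('a + 'a) list set" (\<open>\<iota>\<^sub>1\<close>) where "\<iota>\<^sub>1 g = rel `` {[Inl g]}"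
definition right :: "'a \<Rightarrow> ('a + 'a) list set" (\<open>\<iota>\<^sub>2\<close>) where "\<iota>\<^sub>2 g = rel `` {[Inr g]}"

lemma image_subset: "\<phi> ` carrier C \<subseteq> carrier G"
  using image subgroup.subset[OF U] by simp

lemma equiv_rel: "equiv (amalgam_words G G) rel"
  by (rule equiv_amalgam_rel[OF is_group is_group image_subset image_subset])

lemma group_amalg: "group \<Gamma>"
  unfolding amalg_def
  by (rule group_amalgamated_product[OF is_group is_group image_subset image_subset])

lemma carrier_amalg: "carrier \<Gamma> = amalgam_words G G // rel"
  and one_amalg: "\<one>\<^bsub>\<Gamma>\<^esub> = rel `` {[]}"
  by (auto simp: amalg_def amalgamated_product_def Let_def)

lemma mult_amalg:
  "v \<in> amalgam_words G G \<Longrightarrow> w \<in> amalgam_words G G \<Longrightarrow>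
    rel `` {v} \<otimes>\<^bsub>\<Gamma>\<^esub> rel `` {w} = rel `` {v @ w}"
  unfolding amalg_def
  by (rule amalgam_mult_classes[OF is_group is_group image_subset image_subset])

lemma Inl_words: "g \<in> carrier G \<Longrightarrow> [Inl g] \<in> amalgam_words G G"
  and Inr_words: "g \<in> carrier G \<Longrightarrow> [Inr g] \<in> amalgam_words G G"
  by (auto simp: amalgam_words_def)

lemma left_closed: "g \<in> carrier G \<Longrightarrow> \<iota>\<^sub>1 g \<in> carrier \<Gamma>"
  and right_closed: "g \<in> carrier G \<Longrightarrow> \<iota>\<^sub>2 g \<in> carrier \<Gamma>"
  by (simp_all add: left_def right_def carrier_amalg quotientI Inl_words Inr_words)

lemma left_mult: "g \<in> carrier G \<Longrightarrow> h \<in> carrier G \<Longrightarrow> \<iota>\<^sub>1 (g \<otimes> h) = \<iota>\<^sub>1 g \<otimes>\<^bsub>\<Gamma>\<^esub> \<iota>\<^sub>1 h"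
  using equiv_class_eq[OF equiv_rel amalgam_rel.mult_left] mult_amalg[OF Inl_words Inl_words]
  by (simp add: left_def)

lemma right_mult: "g \<in> carrier G \<Longrightarrow> h \<in> carrier G \<Longrightarrow> \<iota>\<^sub>2 (g \<otimes> h) = \<iota>\<^sub>2 g \<otimes>\<^bsub>\<Gamma>\<^esub> \<iota>\<^sub>2 h"
  using equiv_class_eq[OF equiv_rel amalgam_rel.mult_right] mult_amalg[OF Inr_words Inr_words]
  by (simp add: right_def)

lemma left_one: "\<iota>\<^sub>1 \<one> = \<one>\<^bsub>\<Gamma>\<^esub>" and right_one: "\<iota>\<^sub>2 \<one> = \<one>\<^bsub>\<Gamma>\<^esub>"
  using equiv_class_eq[OF equiv_rel amalgam_rel.one_left]
    equiv_class_eq[OF equiv_rel amalgam_rel.one_right]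
  by (simp_all add: left_def right_def one_amalg)

lemma left_eq_right: "u \<in> U \<Longrightarrow> \<iota>\<^sub>1 u = \<iota>\<^sub>2 u"
proof -
  assume "u \<in> U"
  then obtain c where "c \<in> carrier C" "u = \<phi> c" using image by auto
  then show ?thesis
    using equiv_class_eq[OF equiv_rel amalgam_rel.amalgam] by (simp add: left_def right_def)
qed

lemma amalg_induct [consumes 1, case_names one left right]:
  assumes "A \<in> carrier \<Gamma>"
    and "P \<one>\<^bsub>\<Gamma>\<^esub>"
    and "\<And>g A. g \<in> carrier G \<Longrightarrow> A \<in> carrier \<Gamma> \<Longrightarrow> P A \<Longrightarrow> P (\<iota>\<^sub>1 g \<otimes>\<^bsub>\<Gamma>\<^esub> A)"
    and "\<And>g A. g \<in> carrier G \<Longrightarrow> A \<in> carrier \<Gamma> \<Longrightarrow> P A \<Longrightarrow> P (\<iota>\<^sub>2 g \<otimes>\<^bsub>\<Gamma>\<^esub> A)"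
  shows "P A"
proof -
  obtain w where w: "w \<in> amalgam_words G G" "A = rel `` {w}"
    using assms(1) by (auto simp: carrier_amalg quotient_def)
  have "P (rel `` {w})"
    using w(1)
  proof (induction w)
    case Nil
    then show ?case using assms(2) by (simp add: one_amalg)
  next
    case (Cons l w)
    have lw: "w \<in> amalgam_words G G" "l \<in> carrier G <+> carrier G"
      using Cons.prems by (auto simp: amalgam_words_def)
    have A: "rel `` {w} \<in> carrier \<Gamma>" using lw by (simp add: carrier_amalg quotientI)
    show ?case
    proof (cases l)
      case (Inl g)
      then have g: "g \<in> carrier G" using lw by auto
      have "rel `` {l # w} = \<iota>\<^sub>1 g \<otimes>\<^bsub>\<Gamma>\<^esub> rel `` {w}"
        using mult_amalg[OF Inl_words[OF g] lw(1)] Inl by (simp add: left_def)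
      then show ?thesis using assms(3)[OF g A Cons.IH[OF lw(1)]] by simp
    next
      case (Inr g)
      then have g: "g \<in> carrier G" using lw by auto
      have "rel `` {l # w} = \<iota>\<^sub>2 g \<otimes>\<^bsub>\<Gamma>\<^esub> rel `` {w}"
        using mult_amalg[OF Inr_words[OF g] lw(1)] Inr by (simp add: right_def)
      then show ?thesis using assms(4)[OF g A Cons.IH[OF lw(1)]] by simp
    qed
  qed
  then show ?thesis using w by simp
qed

lemma word_act_closed:
  assumes "\<alpha> \<in> actions G E" "\<beta> \<in> actions G E" "w \<in> amalgam_words G G" "e \<in> E"
  shows "word_act \<alpha> \<beta> w e \<in> E"
  using assms(3)
proof (induction w)
  case (Cons l w)
  then have "word_act \<alpha> \<beta> w e \<in> E" "l \<in> carrier G <+> carrier G"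
    by (auto simp: amalgam_words_def)
  then show ?case
    using act_closed[OF assms(1)] act_closed[OF assms(2)] by (cases l) auto
qed (use assms(4) in simp)

text \<open>Induction over the congruence. Among its generators only the identification of
  \<open>Inl (\<phi> u)\<close> with \<open>Inr (\<phi> u)\<close> compares the two actions, and
  there they agree because \<open>\<phi> u\<close> lies in \<open>U\<close>.\<close>

lemma word_act_rel:
  assumes a: "\<alpha> \<in> actions G E" and b: "\<beta> \<in> actions G E"
    and agree: "\<And>u e. u \<in> U \<Longrightarrow> e \<in> E \<Longrightarrow> \<alpha> u e = \<beta> u e"
    and "(v, w) \<in> rel"
  shows "\<forall>e\<in>E. word_act \<alpha> \<beta> v e = word_act \<alpha> \<beta> w e"
  using assms(4)
proof induction
  case (append v v' w w')
  have "w \<in> amalgam_words G G" "w' \<in> amalgam_words G G"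
    using amalgam_rel_words[OF is_group is_group image_subset image_subset append.hyps(2)] by auto
  then show ?case
    using append.IH word_act_closed[OF a b, of w'] by simp
next
  case (amalgam u)
  then have "\<phi> u \<in> U" using image by auto
  then show ?case using agree by simp
qed (auto simp: act_one[OF a] act_one[OF b] act_mult[OF a] act_mult[OF b])

text \<open>The action of \<Gamma> induced by a pair. A class acts through an arbitrarily chosen
  word; \<open>word_act_rel\<close> makes the choice irrelevant as soon as the two actions agree on
  \<open>U\<close>.\<close>

definition amalg_act :: "'e set \<Rightarrow> ('a \<Rightarrow> 'e \<Rightarrow> 'e) \<Rightarrow> ('a \<Rightarrow> 'e \<Rightarrow> 'e) \<Rightarrow>
    ('a + 'a) list set \<Rightarrow> 'e \<Rightarrow> 'e" where
  "amalg_act E \<alpha> \<beta> = restrict_act \<Gamma> E (\<lambda>A. word_act \<alpha> \<beta> (SOME w. w \<in> A))"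

context
  fixes \<alpha> \<beta> :: "'a \<Rightarrow> 'e \<Rightarrow> 'e" and E
  assumes a: "\<alpha> \<in> actions G E" and b: "\<beta> \<in> actions G E"
    and agree: "\<And>u e. u \<in> U \<Longrightarrow> e \<in> E \<Longrightarrow> \<alpha> u e = \<beta> u e"
begin

lemma amalg_act_class:
  assumes "w \<in> amalgam_words G G" "e \<in> E"
  shows "amalg_act E \<alpha> \<beta> (rel `` {w}) e = word_act \<alpha> \<beta> w e"
proof -
  have "(w, w) \<in> rel" using assms(1) by (rule amalgam_rel.refl)
  then have "w \<in> rel `` {w}" by simp
  then have "(SOME v. v \<in> rel `` {w}) \<in> rel `` {w}" by (rule someI)
  then have "(w, SOME v. v \<in> rel `` {w}) \<in> rel" by (simp only: Image_singleton_iff)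
  from bspec[OF word_act_rel[OF a b agree this] assms(2)]
  have "word_act \<alpha> \<beta> (SOME v. v \<in> rel `` {w}) e = word_act \<alpha> \<beta> w e" by (rule HOL.sym)
  moreover have "rel `` {w} \<in> carrier \<Gamma>"
    unfolding carrier_amalg by (rule quotientI[OF assms(1)])
  ultimately show ?thesis
    using assms(2) by (simp only: amalg_act_def restrict_act_eq)
qed

lemma amalg_act_in_actions: "amalg_act E \<alpha> \<beta> \<in> actions \<Gamma> E"
proof -
  have app: "v @ w \<in> amalgam_words G G"
    if "v \<in> amalgam_words G G" "w \<in> amalgam_words G G" for v w
    using that by (auto simp: amalgam_words_def)
  have nil: "[] \<in> amalgam_words G G" by (simp add: amalgam_words_def)
  have rep: "\<exists>w \<in> amalgam_words G G. A = rel `` {w}" if "A \<in> carrier \<Gamma>" for A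
    using that by (auto simp: carrier_amalg quotient_def)
  have "restrict_act \<Gamma> E (amalg_act E \<alpha> \<beta>) \<in> actions \<Gamma> E"
  proof (rule group.restrict_act_in_actions[OF group_amalg])
    fix A e assume "A \<in> carrier \<Gamma>" and e: "e \<in> E"
    then obtain w where "w \<in> amalgam_words G G" "A = rel `` {w}" using rep by blast
    then show "amalg_act E \<alpha> \<beta> A e \<in> E"
      using amalg_act_class[OF _ e] word_act_closed[OF a b _ e] by simp
  next
    fix e assume e: "e \<in> E"
    show "amalg_act E \<alpha> \<beta> \<one>\<^bsub>\<Gamma>\<^esub> e = e"
      using amalg_act_class[OF nil e] by (simp add: one_amalg)
  next
    fix A B e assume "A \<in> carrier \<Gamma>" "B \<in> carrier \<Gamma>" and e: "e \<in> E"
    then obtain v w where v: "v \<in> amalgam_words G G" "A = rel `` {v}"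
      and w: "w \<in> amalgam_words G G" "B = rel `` {w}"
      using rep by blast
    show "amalg_act E \<alpha> \<beta> (A \<otimes>\<^bsub>\<Gamma>\<^esub> B) e = amalg_act E \<alpha> \<beta> A (amalg_act E \<alpha> \<beta> B e)"
      unfolding v(2) w(2)
      by (simp add: mult_amalg[OF v(1) w(1)] amalg_act_class[OF app[OF v(1) w(1)] e]
          amalg_act_class[OF w(1) e] amalg_act_class[OF v(1) word_act_closed[OF a b w(1) e]])
  qed
  moreover have "restrict_act \<Gamma> E (amalg_act E \<alpha> \<beta>) = amalg_act E \<alpha> \<beta>"
    unfolding amalg_act_def by (rule restrict_act_cong) simp
  ultimately show ?thesis by simp
qed

lemma amalg_act_left: "g \<in> carrier G \<Longrightarrow> e \<in> E \<Longrightarrow> amalg_act E \<alpha> \<beta> (\<iota>\<^sub>1 g) e = \<alpha> g e"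
  and amalg_act_right: "g \<in> carrier G \<Longrightarrow> e \<in> E \<Longrightarrow> amalg_act E \<alpha> \<beta> (\<iota>\<^sub>2 g) e = \<beta> g e"
  by (simp_all add: left_def right_def amalg_act_class Inl_words Inr_words)

end

section \<open>Actions of the amalgam as compatible pairs of actions\<close>

lemma pull_back_actions:
  assumes "\<gamma> \<in> actions \<Gamma> E"
  shows "restrict_act G E (\<lambda>g. \<gamma> (\<iota>\<^sub>1 g)) \<in> actions G E"
    and "restrict_act G E (\<lambda>g. \<gamma> (\<iota>\<^sub>2 g)) \<in> actions G E"
  using act_closed[OF assms left_closed] act_closed[OF assms right_closed] act_one[OF assms]
    act_mult[OF assms left_closed left_closed] act_mult[OF assms right_closed right_closed]
  by (intro restrict_act_in_actions; simp add: left_one right_one left_mult right_mult)+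

lemma amalg_act_eqI:
  assumes "\<gamma> \<in> actions \<Gamma> E" "\<gamma>' \<in> actions \<Gamma> E"
    and "\<And>g e. g \<in> carrier G \<Longrightarrow> e \<in> E \<Longrightarrow> \<gamma> (\<iota>\<^sub>1 g) e = \<gamma>' (\<iota>\<^sub>1 g) e"
    and "\<And>g e. g \<in> carrier G \<Longrightarrow> e \<in> E \<Longrightarrow> \<gamma> (\<iota>\<^sub>2 g) e = \<gamma>' (\<iota>\<^sub>2 g) e"
  shows "\<gamma> = \<gamma>'"
proof (rule act_eqI[OF assms(1,2)])
  fix A e assume "A \<in> carrier \<Gamma>" "e \<in> E"
  then show "\<gamma> A e = \<gamma>' A e"
  proof (induction A rule: amalg_induct)
    case one
    then show ?case using act_one[OF assms(1)] act_one[OF assms(2)] by simp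
  next
    case (left g A)
    then show ?case
      using act_mult[OF assms(1) left_closed, of g A e] act_mult[OF assms(2) left_closed, of g A e]
        assms(3)[of g "\<gamma>' A e"] act_closed[OF assms(2), of A e] by simp
  next
    case (right g A)
    then show ?case
      using act_mult[OF assms(1) right_closed, of g A e] act_mult[OF assms(2) right_closed, of g A e]
        assms(4)[of g "\<gamma>' A e"] act_closed[OF assms(2), of A e] by simp
  qed
qed

definition compatible_pairs :: "'e set \<Rightarrow> (('a \<Rightarrow> 'e \<Rightarrow> 'e) \<times> ('a \<Rightarrow> 'e \<Rightarrow> 'e)) set" where
  "compatible_pairs E =
    {(\<alpha>, \<beta>). \<alpha> \<in> actions G E \<and> \<beta> \<in> actions G E \<and> (\<forall>u\<in>U. \<forall>e\<in>E. \<alpha> u e = \<beta> u e)}"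

lemma bij_betw_compatible_pairs:
  "bij_betw (\<lambda>\<gamma>. (restrict_act G E (\<lambda>g. \<gamma> (\<iota>\<^sub>1 g)), restrict_act G E (\<lambda>g. \<gamma> (\<iota>\<^sub>2 g))))
    (actions \<Gamma> E) (compatible_pairs E)" (is "bij_betw ?f _ _")
  unfolding bij_betw_def
proof
  show "inj_on ?f (actions \<Gamma> E)"
  proof (rule inj_onI)
    fix \<gamma> \<gamma>' assume g: "\<gamma> \<in> actions \<Gamma> E" "\<gamma>' \<in> actions \<Gamma> E" "?f \<gamma> = ?f \<gamma>'"
    have 1: "restrict_act G E (\<lambda>g. \<gamma> (\<iota>\<^sub>1 g)) = restrict_act G E (\<lambda>g. \<gamma>' (\<iota>\<^sub>1 g))"
      and 2: "restrict_act G E (\<lambda>g. \<gamma> (\<iota>\<^sub>2 g)) = restrict_act G E (\<lambda>g. \<gamma>' (\<iota>\<^sub>2 g))"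
      using g(3) by (simp_all only: prod.inject)
    show "\<gamma> = \<gamma>'"
    proof (rule amalg_act_eqI[OF g(1,2)])
      fix h e assume "h \<in> carrier G" "e \<in> E"
      then show "\<gamma> (\<iota>\<^sub>1 h) e = \<gamma>' (\<iota>\<^sub>1 h) e" "\<gamma> (\<iota>\<^sub>2 h) e = \<gamma>' (\<iota>\<^sub>2 h) e"
        using fun_cong[OF fun_cong[OF 1, of h], of e] fun_cong[OF fun_cong[OF 2, of h], of e]
        by simp_all
    qed
  qed
  show "?f ` actions \<Gamma> E = compatible_pairs E"
  proof (intro equalityI image_subsetI subsetI)
    fix \<gamma> assume "\<gamma> \<in> actions \<Gamma> E"
    then show "?f \<gamma> \<in> compatible_pairs E"
      using pull_back_actions[of \<gamma> E] left_eq_right subgroup.mem_carrier[OF U]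
      by (simp add: compatible_pairs_def)
  next
    fix z
    assume "z \<in> compatible_pairs E"
    then obtain \<alpha> \<beta> where z: "z = (\<alpha>, \<beta>)" "\<alpha> \<in> actions G E" "\<beta> \<in> actions G E"
      "\<And>u e. u \<in> U \<Longrightarrow> e \<in> E \<Longrightarrow> \<alpha> u e = \<beta> u e"
      by (auto simp: compatible_pairs_def)
    have "restrict_act G E (\<lambda>g. amalg_act E \<alpha> \<beta> (\<iota>\<^sub>1 g)) = restrict_act G E \<alpha>"
      by (rule restrict_act_cong) (rule amalg_act_left[OF z(2-4)])
    moreover have "restrict_act G E (\<lambda>g. amalg_act E \<alpha> \<beta> (\<iota>\<^sub>2 g)) = restrict_act G E \<beta>"
      by (rule restrict_act_cong) (rule amalg_act_right[OF z(2-4)])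
    ultimately have "z = ?f (amalg_act E \<alpha> \<beta>)"
      using restrict_act_self[OF z(2)] restrict_act_self[OF z(3)] z(1) by simp
    then show "z \<in> ?f ` actions \<Gamma> E"
      by (rule image_eqI[where x = "amalg_act E \<alpha> \<beta>"]) (rule amalg_act_in_actions[OF z(2-4)])
  qed
qed

lemma card_actions_amalg: "card (actions \<Gamma> E) = card (compatible_pairs E)"
  by (rule bij_betw_same_card[OF bij_betw_compatible_pairs])

lemma finite_compatible_pairs:
  "finite (carrier G) \<Longrightarrow> finite E \<Longrightarrow> finite (compatible_pairs E)"
  by (rule finite_subset[of _ "actions G E \<times> actions G E"])
    (auto simp: compatible_pairs_def finite_actions)

lemma finite_actions_amalg: "finite (carrier G) \<Longrightarrow> finite E \<Longrightarrow> finite (actions \<Gamma> E)"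
  unfolding bij_betw_finite[OF bij_betw_compatible_pairs] by (rule finite_compatible_pairs)

end

section \<open>The upper bound for the growth coefficient\<close>

lemma fact_le_fact_mult_power: "a \<le> q \<Longrightarrow> (fact q :: real) \<le> fact a * real q ^ (q - a)"
proof (induction q rule: dec_induct)
  case (step q)
  have "(fact (Suc q) :: real) = real (Suc q) * fact q" by simp
  also have "\<dots> \<le> real (Suc q) * (fact a * real q ^ (q - a))"
    by (rule mult_left_mono[OF step.IH]) simp
  also have "\<dots> \<le> real (Suc q) * (fact a * real (Suc q) ^ (q - a))"
    by (intro mult_left_mono power_mono) auto
  also have "\<dots> = fact a * real (Suc q) ^ (Suc q - a)"
    using step.hyps by (simp add: Suc_diff_le)
  finally show ?case .
qed simp

text \<open>If q exceeds M + M', the surplus consists of at most e n factors of size at most n,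
  giving n^(e n), that is, exp(e n ln n). The factor 4^n bounds the binomial coefficient by which (M
  + M')! differs from M! M'!, since M + M' \<le> 2 n.\<close>

lemma fact_quotient_bound:
  fixes e :: real
  assumes "real q \<le> real M + real M' + e * real n" "q \<le> n" "M \<le> n" "M' \<le> n" "e \<ge> 0"
  shows "fact q \<le> fact M * fact M' * 4 ^ n * exp (e * nlog n)"
proof -
  have "fact (M + M') = fact M * fact M' * ((M + M') choose M)"
    using binomial_fact_lemma[of M "M + M'"] by (simp add: mult.commute)
  then have "real (fact (M + M')) = real (fact M * fact M' * ((M + M') choose M))"
    by (simp only:)
  then have "(fact (M + M') :: real) = fact M * fact M' * real ((M + M') choose M)"
    by simp
  also have "\<dots> \<le> fact M * fact M' * 4 ^ n"
  proof (rule mult_left_mono)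
    have "((M + M') choose M) \<le> 2 ^ (M + M')" by (rule binomial_le_pow2)
    also have "(2::nat) ^ (M + M') \<le> 2 ^ (2 * n)" using assms by (intro power_increasing) auto
    finally have "real ((M + M') choose M) \<le> real (2 ^ (2 * n))" by (simp only: of_nat_le_iff)
    then show "real ((M + M') choose M) \<le> 4 ^ n" by (simp add: power_mult)
  qed simp
  finally have 1: "fact (M + M') \<le> (fact M * fact M' * 4 ^ n :: real)" .
  have 2: "fact q \<le> fact (M + M') * exp (e * nlog n)"
  proof (cases "q \<le> M + M'")
    case True
    have "(fact q :: real) \<le> fact (M + M')" using True by (rule fact_mono)
    also have "\<dots> \<le> fact (M + M') * exp (e * nlog n)"
      using assms(5) nlog_nonneg[of n] by simp
    finally show ?thesis .
  next
    case False
    then have n: "n \<ge> 1" using assms by simp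
    have "(fact q :: real) \<le> fact (M + M') * real q ^ (q - (M + M'))"
      using False by (intro fact_le_fact_mult_power) simp
    also have "\<dots> \<le> fact (M + M') * real n ^ (q - (M + M'))"
      using assms by (intro mult_left_mono power_mono) auto
    also have "real n ^ (q - (M + M')) = exp (real (q - (M + M')) * ln (real n))"
      using n by (simp add: exp_of_nat_mult)
    also have "\<dots> \<le> exp (e * nlog n)"
    proof -
      have "real (q - (M + M')) \<le> e * real n" using assms False by simp
      then have "real (q - (M + M')) * ln (real n) \<le> (e * real n) * ln (real n)"
        by (rule mult_right_mono) (use n in simp)
      then show ?thesis by (simp add: nlog_def mult.assoc)
    qed
    finally show ?thesis by simp
  qed
  also have "\<dots> \<le> (fact M * fact M' * 4 ^ n) * exp (e * nlog n)"
    by (rule mult_right_mono[OF 1]) simp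
  finally show ?thesis .
qed

lemma Suc_le_two_power: "Suc n \<le> 2 ^ n"
  by (induction n) auto

context group
begin

text \<open>Every action extends the trivial action of the trivial subgroup, whose orbits are the
  single points; hence q = n in the extension bound.\<close>

lemma card_actions_with_orbits_le:
  assumes fin: "finite (carrier G)" "finite E"
  shows "real (card {\<alpha> \<in> actions G E. card (orbits G E \<alpha>) = M}) \<le>
    (trans_bound + 1) ^ card E * (fact (card E) / fact M)"
proof -
  have "extensions {\<one>} E (\<lambda>u e. e) M = {\<alpha> \<in> actions G E. card (orbits G E \<alpha>) = M}"
    by (auto simp: extensions_def act_one)
  moreover have "sub_orbits {\<one>} E (\<lambda>u e. e) = (\<lambda>e. {e}) ` E"
    by (simp add: sub_orbits_eq_image sub_orbit_eq_image)
  moreover have "card ((\<lambda>e. {e}) ` E) = card E" by (rule card_image) simp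
  ultimately show ?thesis
    using card_extensions_le[OF fin triv_subgroup, of "\<lambda>u e. e" M] by simp
qed

lemma card_orbits_le: "finite E \<Longrightarrow> card (orbits G E \<alpha>) \<le> card E"
  unfolding orbits_eq_image by (rule card_image_le)

text \<open>The weight M! cancels the 1/M! in the number of actions with M orbits, leaving the same
  bound for each of the n + 1 possible values of M.\<close>

lemma sum_fact_orbits_le:
  assumes fin: "finite (carrier G)" "finite E"
  shows "(\<Sum>\<alpha>\<in>actions G E. fact (card (orbits G E \<alpha>))) \<le>
    real (Suc (card E)) * ((trans_bound + 1) ^ card E * fact (card E))"
proof -
  have finA: "finite (actions G E)" by (rule finite_actions[OF fin])
  have "(\<Sum>\<alpha>\<in>actions G E. fact (card (orbits G E \<alpha>))) =
      (\<Sum>M\<le>card E. \<Sum>\<alpha>\<in>{\<alpha> \<in> actions G E. card (orbits G E \<alpha>) = M}.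
        fact (card (orbits G E \<alpha>)) :: real)"
    by (rule sum.group[symmetric]) (use finA card_orbits_le[OF fin(2)] in auto)
  also have "\<dots> = (\<Sum>M\<le>card E.
      real (card {\<alpha> \<in> actions G E. card (orbits G E \<alpha>) = M}) * fact M)"
    by (intro sum.cong) auto
  also have "\<dots> \<le> (\<Sum>M\<le>card E. (trans_bound + 1) ^ card E * fact (card E))"
  proof (rule sum_mono)
    fix M
    show "real (card {\<alpha> \<in> actions G E. card (orbits G E \<alpha>) = M}) * fact M \<le>
        (trans_bound + 1) ^ card E * fact (card E)"
      using mult_right_mono[OF card_actions_with_orbits_le[OF fin, of M], of "fact M"] by simp
  qed
  finally show ?thesis by simp
qed

end

context double
begin

text \<open>A pair is an action \<open>\<alpha>\<close> together with an extension
  \<open>\<beta>\<close> of its restriction to \<open>U\<close>. Both have the same q U-orbits, so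
  averaging the hypothesis over the two gives q \<le> M + M' + e n, the form that
  \<open>fact_quotient_bound\<close> needs. In the constant, 16 = 2 * 2 * 4 comes from two factors n
  + 1 \<le> 2^n and from the binomial bound, and the square from the two uses of the extension
  count.\<close>

lemma card_compatible_pairs_le:
  fixes e :: real
  assumes fin: "finite (carrier G)" "finite E" and e: "e \<ge> 0"
    and orb: "\<And>\<alpha>. \<alpha> \<in> actions G E \<Longrightarrow>
      real (card (sub_orbits U E \<alpha>)) \<le> 2 * real (card (orbits G E \<alpha>)) + e * real (card E)"
  shows "real (card (compatible_pairs E)) \<le>
    fact (card E) * (16 * (trans_bound + 1) ^ 2) ^ card E * exp (e * nlog (card E))"
proof -
  let ?K = "trans_bound + 1" and ?n = "card E"
  let ?D = "?K ^ ?n * (4 ^ ?n * exp (e * nlog ?n))"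
  have K: "?K \<ge> 1" by (simp add: trans_bound_def)
  have finA: "finite (actions G E)" by (rule finite_actions[OF fin])
  have ext: "real (card (extensions U E \<alpha> M')) \<le> fact (card (orbits G E \<alpha>)) * ?D"
    if a: "\<alpha> \<in> actions G E" for \<alpha> M'
  proof (cases "extensions U E \<alpha> M' = {}")
    case True
    then show ?thesis using K by simp
  next
    case False
    then obtain \<beta> where b: "\<beta> \<in> actions G E" "\<And>u y. u \<in> U \<Longrightarrow> y \<in> E \<Longrightarrow> \<beta> u y = \<alpha> u y"
      "card (orbits G E \<beta>) = M'" by (auto simp: extensions_def)
    let ?q = "card (sub_orbits U E \<alpha>)" and ?M = "card (orbits G E \<alpha>)"
    have "sub_orbits U E \<beta> = sub_orbits U E \<alpha>" by (rule sub_orbits_cong) (rule b(2))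
    then have "2 * real ?q \<le> 2 * (real ?M + real M' + e * real ?n)"
      using orb[OF a] orb[OF b(1)] b(3) by simp
    then have q: "real ?q \<le> real ?M + real M' + e * real ?n" by simp
    have qn: "?q \<le> ?n" unfolding sub_orbits_eq_image by (rule card_image_le[OF fin(2)])
    have M': "M' \<le> ?n" using card_orbits_le[OF fin(2), of \<beta>] b(3) by simp
    have "real (card (extensions U E \<alpha> M')) \<le> ?K ^ ?q * (fact ?q / fact M')"
      by (rule card_extensions_le[OF fin U])
    also have "\<dots> \<le> ?K ^ ?n * (fact ?M * (4 ^ ?n * exp (e * nlog ?n)))"
    proof (rule mult_mono)
      show "?K ^ ?q \<le> ?K ^ ?n" by (rule power_increasing[OF qn K])
      show "fact ?q / fact M' \<le> fact ?M * (4 ^ ?n * exp (e * nlog ?n))"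
        using fact_quotient_bound[OF q qn card_orbits_le[OF fin(2)] M' e]
        by (simp add: divide_le_eq mult_ac)
    qed (use K in auto)
    finally show ?thesis by (simp add: mult_ac)
  qed
  have fib: "real (card {\<beta> \<in> actions G E. \<forall>u\<in>U. \<forall>y\<in>E. \<alpha> u y = \<beta> u y}) \<le>
      real (Suc ?n) * (fact (card (orbits G E \<alpha>)) * ?D)"
    if a: "\<alpha> \<in> actions G E" for \<alpha>
  proof -
    have "{\<beta> \<in> actions G E. \<forall>u\<in>U. \<forall>y\<in>E. \<alpha> u y = \<beta> u y} \<subseteq> (\<Union>M'\<le>?n. extensions U E \<alpha> M')"
      using card_orbits_le[OF fin(2)] by (auto simp: extensions_def)
    moreover have finU: "finite (\<Union>M'\<le>?n. extensions U E \<alpha> M')"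
      using finA by (auto simp: extensions_def)
    ultimately have "card {\<beta> \<in> actions G E. \<forall>u\<in>U. \<forall>y\<in>E. \<alpha> u y = \<beta> u y} \<le>
        card (\<Union>M'\<le>?n. extensions U E \<alpha> M')"
      by (intro card_mono)
    also have "\<dots> \<le> (\<Sum>M'\<le>?n. card (extensions U E \<alpha> M'))"
      by (rule card_UN_le) simp
    finally have "real (card {\<beta> \<in> actions G E. \<forall>u\<in>U. \<forall>y\<in>E. \<alpha> u y = \<beta> u y}) \<le>
        (\<Sum>M'\<le>?n. real (card (extensions U E \<alpha> M')))"
      by (simp flip: of_nat_sum)
    also have "\<dots> \<le> (\<Sum>M'\<le>?n. fact (card (orbits G E \<alpha>)) * ?D)"
      by (rule sum_mono) (rule ext[OF a])
    finally show ?thesis by simp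
  qed
  have "compatible_pairs E =
      (SIGMA \<alpha> : actions G E. {\<beta> \<in> actions G E. \<forall>u\<in>U. \<forall>y\<in>E. \<alpha> u y = \<beta> u y})"
    by (auto simp: compatible_pairs_def)
  then have "real (card (compatible_pairs E)) =
      (\<Sum>\<alpha>\<in>actions G E. real (card {\<beta> \<in> actions G E. \<forall>u\<in>U. \<forall>y\<in>E. \<alpha> u y = \<beta> u y}))"
    using finA by (simp add: card_SigmaI)
  also have "\<dots> \<le> (\<Sum>\<alpha>\<in>actions G E. real (Suc ?n) * (fact (card (orbits G E \<alpha>)) * ?D))"
    by (rule sum_mono) (rule fib)
  also have "\<dots> = real (Suc ?n) * ((\<Sum>\<alpha>\<in>actions G E. fact (card (orbits G E \<alpha>))) * ?D)"
    by (simp only: sum_distrib_left sum_distrib_right)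
  also have "\<dots> \<le> real (Suc ?n) * ((real (Suc ?n) * (?K ^ ?n * fact ?n)) * ?D)"
    by (intro mult_left_mono mult_right_mono sum_fact_orbits_le fin) (use K in auto)
  also have "\<dots> = (real (Suc ?n) * real (Suc ?n)) * (?K ^ ?n * fact ?n * ?D)"
    by (simp only: mult_ac)
  also have "\<dots> \<le> (2 ^ ?n * 2 ^ ?n) * (?K ^ ?n * fact ?n * ?D)"
  proof (rule mult_right_mono)
    have "real (Suc ?n) \<le> real (2 ^ ?n)" using Suc_le_two_power by (simp only: of_nat_le_iff)
    then have "real (Suc ?n) \<le> 2 ^ ?n" by simp
    then show "real (Suc ?n) * real (Suc ?n) \<le> 2 ^ ?n * 2 ^ ?n" by (intro mult_mono) auto
  qed (use K in auto)
  also have "\<dots> = fact ?n * ((2 * 2 * ?K * ?K * 4) ^ ?n) * exp (e * nlog ?n)"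
    by (simp only: power_mult_distrib mult_ac)
  also have "2 * 2 * ?K * ?K * 4 = 16 * ?K ^ 2" by (simp add: power2_eq_square)
  finally show ?thesis .
qed

end

text \<open>After division by n ln n the factor B^n contributes ln B / ln n, which tends to 0.
  Indices without subgroups contribute minus infinity and respect any bound.\<close>

lemma growth_coefficient_leI:
  fixes e B :: real
  assumes B: "B \<ge> 1"
    and s: "\<And>n. n \<ge> 1 \<Longrightarrow> real (card (subgroups_of_index G n)) \<le> B ^ n * exp (e * nlog n)"
  shows "growth_coefficient G \<le> ereal e"
proof -
  let ?f = "\<lambda>n. let s = card (subgroups_of_index G n) in
      if s = 0 then -\<infinity> else ereal (ln (real s) / (real n * ln (real n)))"
  have "\<forall>\<^sub>F n in sequentially. ?f n \<le> ereal (e + ln B / ln (real n))"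
    using eventually_ge_at_top[of 2]
  proof eventually_elim
    case (elim n)
    let ?s = "card (subgroups_of_index G n)"
    have ln: "ln (real n) > 0" using elim by simp
    show ?case
    proof (cases "?s = 0")
      case False
      have "ln (real ?s) \<le> ln (B ^ n * exp (e * nlog n))"
        using s[of n] elim False by (subst ln_le_cancel_iff) (use B in auto)
      also have "\<dots> = real n * ln B + e * nlog n"
        using B by (simp add: ln_mult ln_realpow)
      finally have "ln (real ?s) / (real n * ln (real n)) \<le>
          (real n * ln B + e * nlog n) / (real n * ln (real n))"
        using ln by (intro divide_right_mono) auto
      also have "\<dots> = e + ln B / ln (real n)"
        using ln elim by (simp add: nlog_def field_simps)
      finally show ?thesis using False by (simp add: Let_def)
    qed (simp add: Let_def)
  qed
  then have "growth_coefficient G \<le> limsup (\<lambda>n. ereal (e + ln B / ln (real n)))"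
    unfolding growth_coefficient_def by (rule Limsup_mono)
  also have "(\<lambda>n. ereal (e + ln B / ln (real n))) \<longlonglongrightarrow> ereal e"
  proof -
    have "filterlim (\<lambda>n. ln (real n)) at_top sequentially"
      by (rule filterlim_compose[OF ln_at_top filterlim_real_sequentially])
    then have "(\<lambda>n. ln B / ln (real n)) \<longlonglongrightarrow> 0"
      by (intro real_tendsto_divide_at_top[OF tendsto_const])
    then have "(\<lambda>n. e + ln B / ln (real n)) \<longlonglongrightarrow> e + 0"
      by (intro tendsto_intros)
    then show ?thesis by simp
  qed
  then have "limsup (\<lambda>n. ereal (e + ln B / ln (real n))) = ereal e"
    by (rule lim_imp_Limsup[OF sequentially_bot])
  finally show ?thesis .
qed

lemma growth_coefficient_lessD:
  fixes c :: real
  assumes c: "growth_coefficient G < ereal c" "c \<ge> 0"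
  shows "\<exists>C\<ge>0. \<forall>k\<ge>1. real (card (subgroups_of_index G k)) \<le> C * exp (c * nlog k)"
proof -
  let ?s = "\<lambda>n. card (subgroups_of_index G n)"
  have "\<forall>\<^sub>F n in sequentially. (let s = ?s n in
      if s = 0 then -\<infinity> else ereal (ln (real s) / (real n * ln (real n)))) < ereal c"
    using c(1) unfolding growth_coefficient_def by (rule Limsup_lessD)
  then have "\<forall>\<^sub>F n in sequentially. real (?s n) \<le> exp (c * nlog n)"
    using eventually_ge_at_top[of 2]
  proof eventually_elim
    case (elim n)
    show ?case
    proof (cases "?s n = 0")
      case False
      then have "ln (real (?s n)) / (real n * ln (real n)) < c"
        using elim by (simp add: Let_def)
      then have "ln (real (?s n)) \<le> c * nlog n"
        using elim by (simp add: nlog_def divide_less_eq)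
      then have "exp (ln (real (?s n))) \<le> exp (c * nlog n)" by simp
      then show ?thesis using False by simp
    qed simp
  qed
  then obtain n0 where n0: "\<And>n. n \<ge> n0 \<Longrightarrow> real (?s n) \<le> exp (c * nlog n)"
    by (auto simp: eventually_sequentially)
  \<comment> \<open>The upper limit controls only large n; the finitely many earlier counts are
    absorbed in the constant, where c \<ge> 0 keeps the exponential factor at least 1.\<close>
  define C where "C = 1 + (\<Sum>k<n0. real (?s k))"
  have C: "C \<ge> 1" by (simp add: C_def sum_nonneg)
  have "real (?s k) \<le> C * exp (c * nlog k)" for k
  proof (cases "k \<ge> n0")
    case True
    have "exp (c * nlog k) \<le> C * exp (c * nlog k)"
      using mult_right_mono[OF C exp_ge_zero[of "c * nlog k"]] by (simp only: mult_1)
    with n0[OF True] show ?thesis by (rule order_trans)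
  next
    case False
    then have "real (?s k) \<le> (\<Sum>k<n0. real (?s k))"
      by (intro member_le_sum) auto
    then have "real (?s k) \<le> C * 1" by (simp add: C_def)
    also have "\<dots> \<le> C * exp (c * nlog k)"
      using C c(2) nlog_nonneg[of k] by (intro mult_left_mono) auto
    finally show ?thesis .
  qed
  then show ?thesis using C by (intro exI[of _ C]) auto
qed

context double
begin

text \<open>Transitive actions are bounded by all actions, that is, by compatible pairs. The n! in
  the count of pairs cancels against n! s_n = n t_n, and the remaining factor n is absorbed by
  doubling the base \<open>?B\<close>.\<close>

lemma growth_coefficient_amalg_le:
  fixes e :: real
  assumes fin: "finite (carrier G)" and e: "e \<ge> 0"
    and orb: "\<And>(E :: nat set) \<alpha>. finite E \<Longrightarrow> \<alpha> \<in> actions G E \<Longrightarrow>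
      real (card (sub_orbits U E \<alpha>)) \<le> 2 * real (card (orbits G E \<alpha>)) + e * real (card E)"
  shows "growth_coefficient \<Gamma> \<le> ereal e"
proof -
  let ?B = "16 * (trans_bound + 1) ^ 2 :: real"
  have "1 \<le> trans_bound + 1" by (simp add: trans_bound_def)
  then have B: "?B \<ge> 1"
    using one_le_power[of "trans_bound + 1" 2] by linarith
  have "real (card (subgroups_of_index \<Gamma> n)) \<le> (2 * ?B) ^ n * exp (e * nlog n)" if n: "n \<ge> 1" for n
  proof -
    let ?E = "{..<n}"
    have E: "finite ?E" "?E \<noteq> {}" using n by (auto simp: lessThan_empty_iff)
    have finA: "finite (actions \<Gamma> ?E)" by (rule finite_actions_amalg[OF fin E(1)])
    have "card (group.transitive_actions \<Gamma> ?E) \<le> card (actions \<Gamma> ?E)"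
      using finA by (rule card_mono) (auto simp: group.transitive_actions_def[OF group_amalg])
    moreover have "fact n * card (subgroups_of_index \<Gamma> n) =
        n * card (group.transitive_actions \<Gamma> ?E)"
      using group.card_transitive_actions(2)[OF group_amalg E finA] by simp
    ultimately have "fact n * card (subgroups_of_index \<Gamma> n) \<le> n * card (compatible_pairs ?E)"
      unfolding card_actions_amalg by simp
    then have "real (fact n * card (subgroups_of_index \<Gamma> n)) \<le> real (n * card (compatible_pairs ?E))"
      by (rule of_nat_mono)
    also have "\<dots> \<le> real n * (fact n * ?B ^ n * exp (e * nlog n))"
      using card_compatible_pairs_le[OF fin E(1) e orb] by (simp add: mult_left_mono)
    also have "\<dots> \<le> 2 ^ n * (fact n * ?B ^ n * exp (e * nlog n))"
    proof (rule mult_right_mono)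
      have "real n \<le> real (2 ^ n)" using Suc_le_two_power[of n] by (simp only: of_nat_le_iff)
      then show "real n \<le> 2 ^ n" by simp
    qed (use B in auto)
    also have "\<dots> = fact n * ((2 * ?B) ^ n * exp (e * nlog n))"
      by (simp only: power_mult_distrib mult_ac)
    finally show ?thesis by simp
  qed
  then show ?thesis using B by (intro growth_coefficient_leI[of "2 * ?B"]) auto
qed

end

section \<open>Fixed points and the normalizer\<close>

lemma card_le_mult_of_fibers:
  assumes "finite A" "finite B" "f ` A \<subseteq> B"
    and "\<And>a. a \<in> A \<Longrightarrow> card {a' \<in> A. f a' = f a} \<le> m"
  shows "card A \<le> m * card B"
proof -
  have "card A = (\<Sum>a\<in>A. 1)" by simp
  also have "\<dots> = (\<Sum>b\<in>f ` A. \<Sum>a\<in>{a \<in> A. f a = b}. 1)"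
    by (rule sum.group[symmetric]) (use assms(1) in auto)
  also have "\<dots> = (\<Sum>b\<in>f ` A. card {a \<in> A. f a = b})" by simp
  also have "\<dots> \<le> (\<Sum>b\<in>f ` A. m)" by (rule sum_mono) (use assms(4) in auto)
  also have "\<dots> = m * card (f ` A)" by simp
  also have "\<dots> \<le> m * card B" by (intro mult_left_mono card_mono assms) simp
  finally show ?thesis .
qed

context group
begin

lemma inv_mult_cancel:
  assumes "a \<in> carrier G" "b \<in> carrier G"
  shows "inv a \<otimes> (a \<otimes> b) = b" "a \<otimes> (inv a \<otimes> b) = b"
  using assms by (simp_all add: m_assoc[symmetric])

lemma mem_normalizer_iff:
  assumes "H \<subseteq> carrier G"
  shows "g \<in> normalizer G H \<longleftrightarrow> g \<in> carrier G \<and> g <# H #> inv g = H"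
  using assms by (simp add: normalizer_def stabilizer_def)

lemma conj_mem_of_normalizer:
  assumes "H \<subseteq> carrier G" "g \<in> normalizer G H" "h \<in> H"
  shows "g \<otimes> h \<otimes> inv g \<in> H"
proof -
  have "g \<otimes> h \<otimes> inv g \<in> g <# H #> inv g"
    using assms(3) by (auto simp: l_coset_def r_coset_def)
  then show ?thesis using assms(1,2) by (simp add: mem_normalizer_iff)
qed

text \<open>By Lagrange inside \<open>U\<close>, the order of \<open>U \<inter> V\<close> divides a
  prime, and \<open>u\<close> rules out order 1.\<close>

lemma prime_subgroup_subset:
  assumes U: "subgroup U G" "Factorial_Ring.prime (card U)" and V: "subgroup V G"
    and u: "u \<in> U" "u \<in> V" "u \<noteq> \<one>"
  shows "U \<subseteq> V"
proof -
  have finU: "finite U" using prime_gt_0_nat[OF U(2)] by (rule card_ge_0_finite)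
  interpret GU: group "G\<lparr>carrier := U\<rparr>" by (rule subgroup_imp_group[OF U(1)])
  have "subgroup (U \<inter> V) (G\<lparr>carrier := U\<rparr>)"
    using subgroup_incl[OF subgroups_Inter_pair[OF U(1) V] U(1)] by simp
  from GU.lagrange[OF this] have "card (U \<inter> V) dvd order (G\<lparr>carrier := U\<rparr>)"
    using dvd_triv_right[of "card (U \<inter> V)" "card (rcosets\<^bsub>G\<lparr>carrier := U\<rparr>\<^esub> (U \<inter> V))"]
    by (simp only:)
  then have "card (U \<inter> V) dvd card U" by (simp add: order_def)
  moreover have "card (U \<inter> V) \<noteq> 1"
  proof
    assume "card (U \<inter> V) = 1"
    then obtain z where "U \<inter> V = {z}" by (auto simp: card_1_singleton_iff)
    moreover have "\<one> \<in> U \<inter> V" using subgroup.one_closed U V by blast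
    ultimately show False using u by (metis IntI singletonD)
  qed
  ultimately have "card (U \<inter> V) = card U"
    using U(2) unfolding prime_nat_iff by blast
  then have "U \<inter> V = U" by (intro card_subset_eq finU) auto
  then show ?thesis by blast
qed

text \<open>Because \<open>U\<close> has prime order, one nontrivial element determines it: a
  conjugate of \<open>U\<close> that meets \<open>U\<close> nontrivially coincides with it. Fixed
  points of single elements are therefore controlled by the normalizer of the whole of
  \<open>U\<close>.\<close>

lemma mem_normalizer_of_conj:
  assumes U: "subgroup U G" "Factorial_Ring.prime (card U)" and g: "g \<in> carrier G"
    and u: "u \<in> U" "u \<noteq> \<one>" "g \<otimes> u \<otimes> inv g \<in> U"
  shows "g \<in> normalizer G U"
proof -
  let ?V = "inv g <# U #> g"
  note sub = subgroup.subset[OF U(1)]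
  have finU: "finite U" using prime_gt_0_nat[OF U(2)] by (rule card_ge_0_finite)
  have V: "subgroup ?V G" by (rule subgroup_conjugation_is_surj1[OF g U(1)])
  have Veq: "?V = (\<lambda>h. inv g \<otimes> h \<otimes> g) ` U"
    by (auto simp: l_coset_def r_coset_def)
  have uc: "u \<in> carrier G" using u sub by blast
  have "u = inv g \<otimes> (g \<otimes> u \<otimes> inv g) \<otimes> g"
    using g uc by (simp add: m_assoc inv_mult_cancel)
  then have "u \<in> ?V" unfolding Veq using u(3) by blast
  then have "U \<subseteq> ?V" by (rule prime_subgroup_subset[OF U V u(1) _ u(2)])
  moreover have "card ?V \<le> card U" unfolding Veq by (rule card_image_le[OF finU])
  moreover have "finite ?V" unfolding Veq using finU by simp
  ultimately have "U = ?V" by (intro card_seteq)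
  then have "g <# U #> inv g = U"
    using subgroup_conjugation_is_surj0[OF g sub] by simp
  then show ?thesis using g sub by (simp add: mem_normalizer_iff)
qed

lemma act_conj_fixed:
  assumes a: "\<alpha> \<in> actions G E" and "k \<in> carrier G" "u \<in> carrier G" "e \<in> E" "\<alpha> u e = e"
  shows "\<alpha> (k \<otimes> u \<otimes> inv k) (\<alpha> k e) = \<alpha> k e"
proof -
  have "\<alpha> (k \<otimes> u \<otimes> inv k) (\<alpha> k e) = \<alpha> (k \<otimes> u) (\<alpha> (inv k) (\<alpha> k e))"
    using assms act_closed[OF a] by (intro act_mult[OF a]) auto
  also have "\<dots> = \<alpha> k (\<alpha> u e)" using assms act_inv(1)[OF a] act_mult[OF a] by simp
  finally show ?thesis using assms by simp
qed

text \<open>Conjugation by k carries a fixed point of u to a fixed point of the conjugate of u. In a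
  fibre of (k, u, e) -> (k u k^-1, k e) the element k determines u and e, and k0^-1 k conjugates u
  to u0, so it normalizes \<open>U\<close>. A fibre thus has at most |N(U)| elements.\<close>

lemma card_fixed_pairs_le:
  assumes fin: "finite (carrier G)" "finite E" and a: "\<alpha> \<in> actions G E"
    and U: "subgroup U G" "Factorial_Ring.prime (card U)"
  shows "card (carrier G) * card (SIGMA u : U - {\<one>}. {e \<in> E. \<alpha> u e = e}) \<le>
    card (normalizer G U) * card (SIGMA g : carrier G - {\<one>}. {e \<in> E. \<alpha> g e = e})"
    (is "_ * card ?T \<le> _ * card ?T'")
proof -
  note sub = subgroup.subset[OF U(1)]
  have finU: "finite U" using fin sub finite_subset by blast
  let ?f = "\<lambda>(k, u, e). (k \<otimes> u \<otimes> inv k, \<alpha> k e)"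
  have finN: "finite (normalizer G U)"
    using normalizer_imp_subgroup[OF sub] fin subgroup.subset finite_subset by blast
  have "card (carrier G \<times> ?T) \<le> card (normalizer G U) * card ?T'"
  proof (rule card_le_mult_of_fibers)
    show "finite (carrier G \<times> ?T)" using fin finU by (intro finite_cartesian_product finite_SigmaI) auto
    show "finite ?T'" using fin by (intro finite_SigmaI) auto
    show "?f ` (carrier G \<times> ?T) \<subseteq> ?T'"
    proof
      fix z assume "z \<in> ?f ` (carrier G \<times> ?T)"
      then obtain k u e where z: "k \<in> carrier G" "u \<in> U" "u \<noteq> \<one>" "e \<in> E" "\<alpha> u e = e"
        "z = (k \<otimes> u \<otimes> inv k, \<alpha> k e)" by auto
      then have u: "u \<in> carrier G" using sub by auto
      have "k \<otimes> u \<otimes> inv k \<noteq> \<one>"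
        using z(1,3) u by (metis conjugation_is_inj one_closed r_inv r_one)
      then show "z \<in> ?T'"
        using z u act_closed[OF a z(1,4)] act_conj_fixed[OF a z(1) u z(4,5)] by auto
    qed
    fix t assume "t \<in> carrier G \<times> ?T"
    then obtain k0 u0 e0 where t: "t = (k0, u0, e0)" "k0 \<in> carrier G" "u0 \<in> U" "u0 \<noteq> \<one>" "e0 \<in> E"
      by auto
    let ?A = "{t' \<in> carrier G \<times> ?T. ?f t' = ?f t}"
    have "inj_on (\<lambda>(k, u, e). inv k0 \<otimes> k) ?A"
    proof (rule inj_onI)
      fix s s' assume s: "s \<in> ?A" "s' \<in> ?A"
        "(case s of (k, u, e) \<Rightarrow> inv k0 \<otimes> k) = (case s' of (k, u, e) \<Rightarrow> inv k0 \<otimes> k)"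
      obtain k u e k' u' e' where ss: "s = (k, u, e)" "s' = (k', u', e')" by (cases s, cases s')
      have c: "k \<in> carrier G" "k' \<in> carrier G" "u \<in> U" "u' \<in> U" "e \<in> E" "e' \<in> E"
        and eq: "k \<otimes> u \<otimes> inv k = k' \<otimes> u' \<otimes> inv k'" "\<alpha> k e = \<alpha> k' e'"
        using s ss t by auto
      have k: "k = k'" using s(3) ss t(2) c by simp
      have "u = u'"
        using eq(1) c(1-4) sub unfolding k by (intro conjugation_is_inj[of k' u u']) auto
      moreover have "e = e'"
        using act_inv(1)[OF a c(1,5)] act_inv(1)[OF a c(2,6)] eq(2) k by metis
      ultimately show "s = s'" using ss k by simp
    qed
    moreover have "(\<lambda>(k, u, e). inv k0 \<otimes> k) ` ?A \<subseteq> normalizer G U"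
    proof
      fix z assume "z \<in> (\<lambda>(k, u, e). inv k0 \<otimes> k) ` ?A"
      then obtain k u e where z: "z = inv k0 \<otimes> k" and k: "k \<in> carrier G" "u \<in> U" "u \<noteq> \<one>"
        "k \<otimes> u \<otimes> inv k = k0 \<otimes> u0 \<otimes> inv k0" using t by auto
      have uc: "u \<in> carrier G" "u0 \<in> carrier G" using k t sub by auto
      have "z \<otimes> u \<otimes> inv z = inv k0 \<otimes> (k \<otimes> u \<otimes> inv k) \<otimes> k0"
        using z k(1) uc t(2) by (simp add: inv_mult_group m_assoc inv_mult_cancel)
      also have "\<dots> = u0"
        unfolding k(4) using uc t(2) by (simp add: m_assoc inv_mult_cancel)
      finally show "z \<in> normalizer G U"
        using mem_normalizer_of_conj[OF U, of z u] z k t by simp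
    qed
    ultimately show "card ?A \<le> card (normalizer G U)"
      using finN by (rule card_inj_on_le)
  qed
  then show ?thesis by (simp add: card_cartesian_product)
qed

lemma burnside_fixed_pairs:
  assumes fin: "finite (carrier G)" "finite E" and a: "\<alpha> \<in> actions G E" and U: "subgroup U G"
  shows "card (sub_orbits U E \<alpha>) * card U =
    card E + card (SIGMA u : U - {\<one>}. {e \<in> E. \<alpha> u e = e})"
proof -
  have finU: "finite U" using fin subgroup.subset[OF U] finite_subset by blast
  have "sub_orbits U E (restrict \<alpha> U) = sub_orbits U E \<alpha>"
    by (rule sub_orbits_cong) simp
  then have "card (sub_orbits U E \<alpha>) * card U = (\<Sum>u\<in>U. card {e \<in> E. \<alpha> u e = e})"
    using group.burnside_actions[OF subgroup_imp_group[OF U] restrict_subgroup_actions[OF a U]]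
      finU fin by simp
  also have "\<dots> = card {e \<in> E. \<alpha> \<one> e = e} + (\<Sum>u\<in>U - {\<one>}. card {e \<in> E. \<alpha> u e = e})"
    by (rule sum.remove[OF finU subgroup.one_closed[OF U]])
  also have "{e \<in> E. \<alpha> \<one> e = e} = E" using act_one[OF a] by auto
  also have "(\<Sum>u\<in>U - {\<one>}. card {e \<in> E. \<alpha> u e = e}) =
      card (SIGMA u : U - {\<one>}. {e \<in> E. \<alpha> u e = e})"
    using finU fin by (subst card_SigmaI) auto
  finally show ?thesis .
qed

lemma sub_orbits_carrier: "sub_orbits (carrier G) E \<alpha> = orbits G E \<alpha>"
  by (simp add: orbits_def orbit_def)

text \<open>Burnside for \<open>U\<close> and for \<open>G\<close> expresses q and M by the numbers
  t and t' of nontrivial fixed pairs, and |G| t \<le> 2 p t' combines them linearly. The coefficient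
  of \<open>card E\<close> is -\<chi>(\<Gamma>).\<close>

lemma card_sub_orbits_le:
  assumes fin: "finite (carrier G)" "finite E" and a: "\<alpha> \<in> actions G E"
    and U: "subgroup U G" "Factorial_Ring.prime (card U)"
    and N: "card (normalizer G U) \<le> 2 * card U"
  shows "real (card (sub_orbits U E \<alpha>)) \<le> 2 * real (card (orbits G E \<alpha>)) +
    (1 / real (card U) - 2 / real (card (carrier G))) * real (card E)"
proof -
  let ?t = "card (SIGMA u : U - {\<one>}. {e \<in> E. \<alpha> u e = e})"
  let ?t' = "card (SIGMA g : carrier G - {\<one>}. {e \<in> E. \<alpha> g e = e})"
  let ?q = "card (sub_orbits U E \<alpha>)" and ?M = "card (orbits G E \<alpha>)"
  let ?p = "card U" and ?g = "card (carrier G)"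
  have 1: "?q * ?p = card E + ?t" by (rule burnside_fixed_pairs[OF fin a U(1)])
  have 2: "?M * ?g = card E + ?t'"
    using burnside_fixed_pairs[OF fin a subgroup_self] by (simp add: sub_orbits_carrier)
  have "?g * ?t \<le> card (normalizer G U) * ?t'" by (rule card_fixed_pairs_le[OF fin a U])
  also have "\<dots> \<le> 2 * ?p * ?t'" by (rule mult_right_mono[OF N]) simp
  finally have 3: "?g * ?t \<le> 2 * ?p * ?t'" .
  have p: "real ?p > 0" using prime_gt_0_nat[OF U(2)] by simp
  have g: "real ?g > 0" using fin one_closed by (auto simp: card_gt_0_iff)
  have "real ?g * real ?t \<le> 2 * real ?p * real ?t'"
    using of_nat_mono[OF 3, where 'a = real] by simp
  moreover have "real ?t = real ?q * real ?p - real (card E)"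
    using arg_cong[OF 1, of real] by simp
  moreover have "real ?t' = real ?M * real ?g - real (card E)"
    using arg_cong[OF 2, of real] by simp
  ultimately have "real ?g * (real ?q * real ?p - real (card E)) \<le>
      2 * real ?p * (real ?M * real ?g - real (card E))" by simp
  then have "real ?q * (real ?p * real ?g) \<le>
      2 * real ?M * (real ?p * real ?g) + (real ?g - 2 * real ?p) * real (card E)"
    by (simp add: algebra_simps)
  also have "\<dots> = (2 * real ?M + (1 / real ?p - 2 / real ?g) * real (card E)) * (real ?p * real ?g)"
    using p g by (simp add: field_simps)
  finally have "real ?q * (real ?p * real ?g) \<le>
      (2 * real ?M + (1 / real ?p - 2 / real ?g) * real (card E)) * (real ?p * real ?g)" .
  then show ?thesis using p g by (simp add: mult_le_cancel_right)
qed

end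

section \<open>Conjugates of an action\<close>

text \<open>Cauchy--Schwarz for the fibre sizes of \<open>f\<close>: collisions are fewest when all
  fibres are equal. Later \<open>f\<close> restricts an action of \<open>G\<close> to
  \<open>U\<close>, and a collision is a compatible pair.\<close>

lemma card_square_le_card_pairs:
  assumes "finite A" "finite S" "f ` A \<subseteq> S"
  shows "(real (card A))\<^sup>2 \<le> real (card S) * real (card {(a, b) \<in> A \<times> A. f a = f b})"
proof -
  let ?c = "\<lambda>s. card {a \<in> A. f a = s}"
  have "card A = (\<Sum>s\<in>S. \<Sum>a\<in>{a \<in> A. f a = s}. 1)"
    using sum.group[OF assms, of "\<lambda>_. 1 :: nat"] by simp
  then have 1: "card A = (\<Sum>s\<in>S. ?c s)" by simp
  have "{(a, b) \<in> A \<times> A. f a = f b} = (\<Union>s\<in>S. {a \<in> A. f a = s} \<times> {a \<in> A. f a = s})"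
    using assms(3) by auto
  also have "card \<dots> = (\<Sum>s\<in>S. card ({a \<in> A. f a = s} \<times> {a \<in> A. f a = s}))"
    by (rule card_UN_disjoint) (use assms in auto)
  finally have 2: "card {(a, b) \<in> A \<times> A. f a = f b} = (\<Sum>s\<in>S. ?c s ^ 2)"
    by (simp add: card_cartesian_product power2_eq_square)
  have "(real (card A))\<^sup>2 = (\<Sum>s\<in>S. real (?c s))\<^sup>2" by (simp add: 1)
  also have "\<dots> \<le> (\<Sum>s\<in>S. (real (?c s))\<^sup>2) * real (card S)"
    by (rule sum_squared_le_sum_of_squares)
  finally show ?thesis unfolding 2 by (simp add: mult.commute)
qed

text \<open>Induction with (1 + 1/m)^m \<le> exp 1. This is the lower half of Stirling's formula, up
  to exponential factors.\<close>

lemma power_self_le_fact_exp: "real m ^ m \<le> fact m * exp (real m)"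
proof (induction m)
  case (Suc m)
  have "real (Suc m) ^ m \<le> real m ^ m * exp 1"
  proof (cases "m = 0")
    case False
    have "real (Suc m) = real m * (1 + 1 / real m)" using False by (simp add: field_simps)
    then have "real (Suc m) ^ m = real m ^ m * (1 + 1 / real m) ^ m"
      by (simp only: power_mult_distrib)
    also have "(1 + 1 / real m) ^ m \<le> exp (1 / real m) ^ m"
      by (intro power_mono) (auto simp: add_nonneg_nonneg)
    also have "exp (1 / real m) ^ m = exp 1" using False by (simp add: exp_of_nat_mult[symmetric])
    finally show ?thesis by (simp add: mult_left_mono)
  qed simp
  also have "\<dots> \<le> (fact m * exp (real m)) * exp 1"
    by (rule mult_right_mono[OF Suc.IH]) simp
  finally have "real (Suc m) * real (Suc m) ^ m \<le> real (Suc m) * ((fact m * exp (real m)) * exp 1)"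
    by (rule mult_left_mono) simp
  then show ?case by (simp add: exp_add mult_ac)
qed simp

context group
begin

definition conj_act :: "'e set \<Rightarrow> ('a \<Rightarrow> 'e \<Rightarrow> 'e) \<Rightarrow> ('e \<Rightarrow> 'e) \<Rightarrow> 'a \<Rightarrow> 'e \<Rightarrow> 'e" where
  "conj_act E \<alpha> D = restrict_act G E (\<lambda>g e. D (\<alpha> g (inv_into E D e)))"

lemma conj_act_apply:
  assumes "bij_betw D E E" "g \<in> carrier G" "e \<in> E"
  shows "conj_act E \<alpha> D g (D e) = D (\<alpha> g e)"
  using assms bij_betw_inv_into_left[OF assms(1,3)] bij_betwE[OF assms(1)]
  by (simp add: conj_act_def)

lemma conj_act_in_actions:
  assumes a: "\<alpha> \<in> actions G E" and D: "bij_betw D E E"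
  shows "conj_act E \<alpha> D \<in> actions G E"
  unfolding conj_act_def
proof (rule restrict_act_in_actions)
  have inv: "inv_into E D e \<in> E" "D (inv_into E D e) = e" if "e \<in> E" for e
    using bij_betw_inv_into_right[OF D that] bij_betwE[OF bij_betw_inv_into[OF D]] that by auto
  have DE: "D e \<in> E" "inv_into E D (D e) = e" if "e \<in> E" for e
    using bij_betwE[OF D] bij_betw_inv_into_left[OF D that] that by auto
  {
    fix g e assume "g \<in> carrier G" "e \<in> E"
    then show "D (\<alpha> g (inv_into E D e)) \<in> E" using act_closed[OF a] inv DE by simp
  next
    fix e assume "e \<in> E"
    then show "D (\<alpha> \<one> (inv_into E D e)) = e" using act_one[OF a] inv by simp
  next
    fix g h e assume "g \<in> carrier G" "h \<in> carrier G" "e \<in> E"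
    then show "D (\<alpha> (g \<otimes> h) (inv_into E D e)) =
        D (\<alpha> g (inv_into E D (D (\<alpha> h (inv_into E D e)))))"
      using act_mult[OF a] act_closed[OF a] inv DE by simp
  }
qed

lemma card_sub_orbits_conj_act:
  assumes a: "\<alpha> \<in> actions G E" and D: "bij_betw D E E" and U: "subgroup U G"
  shows "card (sub_orbits U E (conj_act E \<alpha> D)) = card (sub_orbits U E \<alpha>)"
proof -
  have so: "sub_orbit U (conj_act E \<alpha> D) (D e) = D ` sub_orbit U \<alpha> e" if "e \<in> E" for e
    unfolding sub_orbit_eq_image image_image
    using conj_act_apply[OF D _ that] subgroup.mem_carrier[OF U] by (intro image_cong) auto
  have "sub_orbits U E (conj_act E \<alpha> D) = sub_orbit U (conj_act E \<alpha> D) ` D ` E"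
    using D by (simp add: sub_orbits_eq_image bij_betw_def)
  also have "\<dots> = (`) D ` sub_orbits U E \<alpha>"
    unfolding sub_orbits_eq_image image_image by (intro image_cong HOL.refl so)
  also have "card \<dots> = card (sub_orbits U E \<alpha>)"
  proof (rule card_image, rule inj_on_subset[OF inj_on_image_Pow[OF bij_betw_imp_inj_on[OF D]]])
    show "sub_orbits U E \<alpha> \<subseteq> Pow E"
    proof
      fix Z assume "Z \<in> sub_orbits U E \<alpha>"
      then obtain e where "e \<in> E" "Z = sub_orbit U \<alpha> e" unfolding sub_orbits_eq_image by blast
      then show "Z \<in> Pow E"
        using sub_orbit_subset_orbit[OF U, of \<alpha> e] orbit_subset[OF a, of e] by auto
    qed
  qed
  finally show ?thesis .
qed

section \<open>Relabelings of several copies of a coset space\<close>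

definition copies :: "'a set \<Rightarrow> 'y set \<Rightarrow> 'a \<Rightarrow> 'a set \<times> 'y \<Rightarrow> 'a set \<times> 'y" where
  "copies H Y = restrict_act G ((rcosets H) \<times> Y) (\<lambda>g (C, y). (C #> inv g, y))"

lemma copies_apply:
  "g \<in> carrier G \<Longrightarrow> C \<in> rcosets H \<Longrightarrow> y \<in> Y \<Longrightarrow> copies H Y g (C, y) = (C #> inv g, y)"
  by (simp add: copies_def)

lemma copies_in_actions:
  assumes "subgroup H G"
  shows "copies H Y \<in> actions G ((rcosets H) \<times> Y)"
  unfolding copies_def
  by (rule restrict_act_in_actions)
    (auto simp: rcosets_mult_closed[OF assms] rcosets_mult_one[OF assms]
      rcosets_mult_assoc[OF assms] inv_mult_group)

lemma card_sub_orbits_copies: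
  assumes H: "subgroup H G" and U: "subgroup U G" and fin: "finite (rcosets H)" "finite Y"
  shows "card (sub_orbits U ((rcosets H) \<times> Y) (copies H Y)) =
    card (sub_orbits U (rcosets H) (\<lambda>g C. C #> inv g)) * card Y"
proof -
  let ?S = "sub_orbits U (rcosets H) (\<lambda>g C. C #> inv g)"
  have "sub_orbit U (copies H Y) (C, y) = sub_orbit U (\<lambda>g C. C #> inv g) C \<times> {y}"
    if "C \<in> rcosets H" "y \<in> Y" for C y
    unfolding sub_orbit_eq_image
    using copies_apply[OF _ that] subgroup.mem_carrier[OF U] by auto
  then have "sub_orbits U ((rcosets H) \<times> Y) (copies H Y) = (\<lambda>(Z, y). Z \<times> {y}) ` (?S \<times> Y)"
    unfolding sub_orbits_eq_image by (auto simp: image_iff) blast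
  moreover have "inj_on (\<lambda>(Z, y). Z \<times> {y}) (?S \<times> Y)"
  proof (rule inj_onI, clarify)
    fix Z y Z' y' assume "Z \<in> ?S" "Z' \<in> ?S" "Z \<times> {y} = Z' \<times> {y'}"
    moreover have "Z \<noteq> {}"
      using \<open>Z \<in> ?S\<close> subgroup.one_closed[OF U]
      unfolding sub_orbits_eq_image sub_orbit_eq_image by auto
    ultimately show "Z = Z' \<and> y = y'" by (auto simp: times_eq_iff)
  qed
  ultimately show ?thesis by (simp add: card_image card_cartesian_product)
qed

text \<open>If \<open>D\<close> and \<open>D0\<close> yield the same conjugate, then D0^-1 D is a
  G-automorphism of the disjoint union of copies of G/H. It is determined by the images of the base
  points (H, y), which consist of a coset for each y and an injective map on the index set
  \<open>Y\<close>; these give the two factors.\<close>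

lemma card_conj_fiber_le:
  assumes H: "subgroup H G" and fin: "finite (rcosets H)" "finite Y"
  defines "E \<equiv> (rcosets H) \<times> Y"
  assumes D0: "bij_betw D0 E E"
  shows "card {D \<in> E \<rightarrow>\<^sub>E E. inj_on D E \<and> conj_act E (copies H Y) D = conj_act E (copies H Y) D0}
    \<le> card (rcosets H) ^ card Y * fact (card Y)" (is "card ?F \<le> _")
proof -
  let ?\<alpha> = "copies H Y"
  let ?z = "\<lambda>D e. inv_into E D0 (D e)"
  let ?\<psi> = "\<lambda>D. (\<lambda>y\<in>Y. fst (?z D (H, y)), \<lambda>y\<in>Y. snd (?z D (H, y)))"
  let ?T = "(Y \<rightarrow>\<^sub>E (rcosets H)) \<times> {b \<in> Y \<rightarrow>\<^sub>E Y. inj_on b Y}"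
  have finE: "finite E" using fin by (simp add: E_def)
  have act: "?\<alpha> \<in> actions G E" unfolding E_def by (rule copies_in_actions[OF H])
  have HH: "H \<in> rcosets H" by (rule subgroup.subgroup_in_rcosets[OF H is_group])
  have base: "(H, y) \<in> E" if "y \<in> Y" for y using HH that by (simp add: E_def)
  have trans: "\<exists>g\<in>carrier G. ?\<alpha> g (C, y) = (C', y)"
    if C: "C \<in> rcosets H" "C' \<in> rcosets H" "y \<in> Y" for C C' y
  proof -
    obtain k k' where k: "k \<in> carrier G" "C = H #> k" "k' \<in> carrier G" "C' = H #> k'"
      using C by (auto simp: RCOSETS_def)
    have "C #> inv (inv k' \<otimes> k) = C'"
      using k subgroup.subset[OF H]
      by (simp add: coset_mult_assoc inv_mult_group inv_mult_cancel)
    then show ?thesis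
      using copies_apply[OF _ C(1,3), of "inv k' \<otimes> k"] k by (intro bexI[of _ "inv k' \<otimes> k"]) auto
  qed
  have bij: "bij_betw D E E" if "D \<in> ?F" for D
  proof -
    have D: "D \<in> E \<rightarrow> E" "inj_on D E" using that by auto
    then have "D ` E = E" using endo_inj_surj[OF finE, of D] by auto
    then show ?thesis using D by (simp add: bij_betw_def)
  qed
  have zE: "?z D e \<in> E" and D0z: "D0 (?z D e) = D e" if "D \<in> ?F" "e \<in> E" for D e
    using bij_betwE[OF bij_betw_inv_into[OF D0]] bij_betwE[OF bij[OF that(1)]] that(2)
      bij_betw_inv_into_right[OF D0, of "D e"] by auto
  have equi: "?z D (?\<alpha> g e) = ?\<alpha> g (?z D e)" if D: "D \<in> ?F" and g: "g \<in> carrier G" "e \<in> E" for D g e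
  proof -
    have "D0 (?\<alpha> g (?z D e)) = conj_act E ?\<alpha> D0 g (D0 (?z D e))"
      using conj_act_apply[OF D0 g(1) zE[OF D g(2)], of ?\<alpha>] by simp
    also have "\<dots> = conj_act E ?\<alpha> D g (D e)" using D D0z[OF D g(2)] by simp
    also have "\<dots> = D (?\<alpha> g e)" by (rule conj_act_apply[OF bij[OF D] g])
    finally have "D0 (?\<alpha> g (?z D e)) = D (?\<alpha> g e)" .
    then show ?thesis
      using bij_betw_inv_into_left[OF D0 act_closed[OF act g(1) zE[OF D g(2)]]] by (simp only:)
  qed
  have zinj: "e = e'" if "D \<in> ?F" "e \<in> E" "e' \<in> E" "?z D e = ?z D e'" for D e e'
  proof -
    have "D e = D e'"
      using arg_cong[OF that(4), of D0] unfolding D0z[OF that(1,2)] D0z[OF that(1,3)] .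
    then show ?thesis by (rule inj_onD[OF bij_betw_imp_inj_on[OF bij[OF that(1)]] _ that(2,3)])
  qed
  have "inj_on ?\<psi> ?F"
  proof (rule inj_onI)
    fix D D' assume D: "D \<in> ?F" "D' \<in> ?F" and eq: "?\<psi> D = ?\<psi> D'"
    have b: "?z D (H, y) = ?z D' (H, y)" if "y \<in> Y" for y
    proof (rule prod_eqI)
      have e: "(\<lambda>y\<in>Y. fst (?z D (H, y))) = (\<lambda>y\<in>Y. fst (?z D' (H, y)))"
        "(\<lambda>y\<in>Y. snd (?z D (H, y))) = (\<lambda>y\<in>Y. snd (?z D' (H, y)))"
        using eq by (simp_all only: prod.inject)
      show "fst (?z D (H, y)) = fst (?z D' (H, y))" using fun_cong[OF e(1), of y] that by simp
      show "snd (?z D (H, y)) = snd (?z D' (H, y))" using fun_cong[OF e(2), of y] that by simp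
    qed
    have "D e = D' e" if eE: "e \<in> E" for e
    proof -
      obtain C y where e: "e = (C, y)" "C \<in> rcosets H" "y \<in> Y" using eE by (auto simp: E_def)
      obtain g where g: "g \<in> carrier G" "?\<alpha> g (H, y) = e" using trans[OF HH e(2,3)] e(1) by blast
      have "?z D e = ?z D' e"
        using equi[OF D(1) g(1) base[OF e(3)]] equi[OF D(2) g(1) base[OF e(3)]] b[OF e(3)]
        unfolding g(2) by (simp only:)
      then have "D0 (?z D e) = D0 (?z D' e)" by (rule arg_cong)
      then show ?thesis unfolding D0z[OF D(1) eE] D0z[OF D(2) eE] .
    qed
    then show "D = D'" using D by (intro PiE_ext[of D E "\<lambda>_. E"]) auto
  qed
  moreover have "?\<psi> ` ?F \<subseteq> ?T"
  proof (rule image_subsetI)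
    fix D assume D: "D \<in> ?F"
    have mem: "fst (?z D (H, y)) \<in> rcosets H" "snd (?z D (H, y)) \<in> Y" if "y \<in> Y" for y
      using zE[OF D base[OF that]] by (auto simp: E_def mem_Times_iff)
    \<comment> \<open>If two base points landed in the same copy, some g would carry one image to
      the other. By equivariance g would then carry (H, y) to (H, y'), but \<open>copies\<close>
      preserves the index.\<close>
    have "inj_on (\<lambda>y\<in>Y. snd (?z D (H, y))) Y"
    proof (rule inj_onI)
      fix y y' assume y: "y \<in> Y" "y' \<in> Y"
        "(\<lambda>y\<in>Y. snd (?z D (H, y))) y = (\<lambda>y\<in>Y. snd (?z D (H, y))) y'"
      then obtain g where g: "g \<in> carrier G" "?\<alpha> g (?z D (H, y)) = ?z D (H, y')"
        using trans[OF mem(1)[OF y(1)] mem(1)[OF y(2)] mem(2)[OF y(1)]]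
        by (metis prod.collapse restrict_apply')
      have "?z D (?\<alpha> g (H, y)) = ?z D (H, y')" using equi[OF D g(1) base[OF y(1)]] g(2) by simp
      then have "?\<alpha> g (H, y) = (H, y')"
        by (rule zinj[OF D act_closed[OF act g(1) base[OF y(1)]] base[OF y(2)]])
      then show "y = y'" using copies_apply[OF g(1) HH y(1)] by simp
    qed
    then show "?\<psi> D \<in> ?T" using mem by auto
  qed
  moreover have "finite ?T" using fin by (intro finite_cartesian_product finite_PiE) (auto intro: finite_PiE rev_finite_subset)
  ultimately have "card ?F \<le> card ?T" by (rule card_inj_on_le)
  also have "\<dots> = card (rcosets H) ^ card Y * fact (card Y)"
    using fin card_inj_PiE[OF fin(2,2) HOL.refl] by (simp add: card_cartesian_product card_funcsetE)
  finally show ?thesis .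
qed

text \<open>The n! relabelings of the points are divided by the maximal fibre size. Its factor N!,
  with N = \<open>card Y\<close>, occurs once for each of the two actions in a pair; this is the
  source of the 2 in (q - 2)/d.\<close>

lemma card_conjugates_ge:
  assumes H: "subgroup H G" and fin: "finite (rcosets H)" "finite Y"
  defines "E \<equiv> (rcosets H) \<times> Y"
  assumes "finite (actions G E)"
  shows "fact (card E) \<le> card (rcosets H) ^ card Y * fact (card Y) *
    card ((conj_act E (copies H Y)) ` {D \<in> E \<rightarrow>\<^sub>E E. inj_on D E})"
proof -
  let ?D = "{D \<in> E \<rightarrow>\<^sub>E E. inj_on D E}"
  have finE: "finite E" using fin by (simp add: E_def)
  have finD: "finite ?D" by (rule finite_subset[of _ "E \<rightarrow>\<^sub>E E"]) (auto intro: finite_PiE finE)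
  have "card ?D \<le> card (rcosets H) ^ card Y * fact (card Y) * card ((conj_act E (copies H Y)) ` ?D)"
  proof (rule card_le_mult_of_fibers[OF finD finite_imageI[OF finD] subset_refl])
    fix D0 assume D0: "D0 \<in> ?D"
    then have "D0 ` E = E" using endo_inj_surj[OF finE, of D0] by auto
    then have "bij_betw D0 E E" using D0 by (simp add: bij_betw_def)
    from card_conj_fiber_le[OF H fin, folded E_def, OF this]
    show "card {D \<in> ?D. conj_act E (copies H Y) D = conj_act E (copies H Y) D0}
        \<le> card (rcosets H) ^ card Y * fact (card Y)"
      by (simp add: conj_assoc)
  qed
  then show ?thesis using card_inj_PiE[OF finE finE HOL.refl] by simp
qed

end

section \<open>The lower bound for the growth coefficient\<close>

text \<open>Compare logarithms, divide by N and let N grow: the left side contributes q ln N, the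
  squared factorial 2 ln N and the exponential c d ln N, while everything else stays
  bounded.\<close>

lemma factorial_growth_bound:
  fixes A c :: real
  assumes bound: "\<And>N. N \<ge> 1 \<Longrightarrow> fact (q * N) \<le> A ^ N * (fact N)\<^sup>2 * exp (c * nlog (d * N))"
    and A: "A \<ge> 1" and c: "c \<ge> 0" and q: "q \<ge> 1" and d: "d \<ge> 1"
  shows "real q \<le> 2 + c * real d"
proof (rule ccontr)
  assume "\<not> real q \<le> 2 + c * real d"
  then have t: "real q - 2 - c * real d > 0" by simp
  \<comment> \<open>The terms that stay bounded after division by N: ln A from A^N, q from the
    exponential error in the factorial estimate, and the last one from splitting ln (d N).\<close>
  define B where "B = ln A + real q + c * real d * ln (real d)"
  have le: "(real q - 2 - c * real d) * ln (real N) \<le> B" if N: "N \<ge> 1" for N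
  proof -
    have qN: "real (q * N) > 0" using q N by simp
    have "real (q * N) ^ (q * N) \<le> fact (q * N) * exp (real (q * N))"
      by (rule power_self_le_fact_exp)
    also have "\<dots> \<le> (A ^ N * (fact N)\<^sup>2 * exp (c * nlog (d * N))) * exp (real (q * N))"
      by (rule mult_right_mono[OF bound[OF N]]) simp
    also have "\<dots> \<le> (A ^ N * (real N ^ N)\<^sup>2 * exp (c * nlog (d * N))) * exp (real (q * N))"
    proof -
      have "(fact N :: real) \<le> real N ^ N" using fact_le_power[of N, where 'a = real] by simp
      then show ?thesis using A by (intro mult_right_mono mult_left_mono power_mono) auto
    qed
    finally have "ln (real (q * N) ^ (q * N)) \<le>
        ln ((A ^ N * (real N ^ N)\<^sup>2 * exp (c * nlog (d * N))) * exp (real (q * N)))"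
      using qN A N by (subst ln_le_cancel_iff) auto
    also have "\<dots> = real N * ln A + 2 * (real N * ln (real N)) + c * nlog (d * N) + real (q * N)"
      using A N by (simp add: ln_mult ln_realpow)
    finally have 1: "real (q * N) * ln (real (q * N)) \<le>
        real N * ln A + 2 * (real N * ln (real N)) + c * nlog (d * N) + real (q * N)"
      using qN by (simp add: ln_realpow)
    have "ln (real N) \<le> ln (real (q * N))" using q N by simp
    then have 2: "real (q * N) * ln (real N) \<le> real (q * N) * ln (real (q * N))"
      by (rule mult_left_mono) simp
    have 3: "c * nlog (d * N) = real N * (c * real d * (ln (real d) + ln (real N)))"
      using d N by (simp add: nlog_def ln_mult algebra_simps)
    have "real N * ((real q - 2 - c * real d) * ln (real N)) \<le> real N * B"
      using 1 2 3 unfolding B_def by (simp add: algebra_simps)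
    then show ?thesis using N by simp
  qed
  have "filterlim (\<lambda>N. ln (real N)) at_top sequentially"
    by (rule filterlim_compose[OF ln_at_top filterlim_real_sequentially])
  then have "\<forall>\<^sub>F N in sequentially. ln (real N) > B / (real q - 2 - c * real d)"
    by (simp add: filterlim_at_top_dense)
  then obtain N0 where N0: "\<And>N. N \<ge> N0 \<Longrightarrow> ln (real N) > B / (real q - 2 - c * real d)"
    by (auto simp: eventually_sequentially)
  have "ln (real (max 1 N0)) > B / (real q - 2 - c * real d)" by (rule N0) simp
  then have "B < (real q - 2 - c * real d) * ln (real (max 1 N0))"
    using t by (simp add: divide_less_eq mult.commute)
  with le[of "max 1 N0"] show False by simp
qed

section \<open>Orbits on coset spaces\<close>

context group
begin

text \<open>Equivalently, the number of double cosets H g U. With N copies of G/H there are this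
  many times N orbits of \<open>U\<close>.\<close>

definition coset_orbits :: "'a set \<Rightarrow> 'a set \<Rightarrow> nat" where
  "coset_orbits U H = card (sub_orbits U (rcosets H) (\<lambda>g C. C #> inv g))"

lemma coset_orbits_fixed_points:
  assumes fin: "finite (carrier G)" and H: "subgroup H G" and U: "subgroup U G"
  shows "coset_orbits U H * card U = card (rcosets H) +
    (\<Sum>u\<in>U - {\<one>}. card {C \<in> rcosets H. C #> inv u = C})"
proof -
  let ?\<alpha> = "restrict_act G (rcosets H) (\<lambda>g C. C #> inv g)"
  have act: "?\<alpha> \<in> actions G (rcosets H)"
    by (rule restrict_act_in_actions)
      (auto simp: rcosets_mult_closed[OF H] rcosets_mult_one[OF H] rcosets_mult_assoc[OF H]
        inv_mult_group)
  have finR: "finite (rcosets H)" using fin by (simp add: RCOSETS_def)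
  have finU: "finite U" using fin subgroup.subset[OF U] finite_subset by blast
  have "sub_orbits U (rcosets H) ?\<alpha> = sub_orbits U (rcosets H) (\<lambda>g C. C #> inv g)"
    by (rule sub_orbits_cong) (use subgroup.mem_carrier[OF U] in auto)
  then have "coset_orbits U H * card U = card (rcosets H) +
      card (SIGMA u : U - {\<one>}. {C \<in> rcosets H. ?\<alpha> u C = C})"
    using burnside_fixed_pairs[OF fin finR act U] by (simp add: coset_orbits_def)
  also have "(SIGMA u : U - {\<one>}. {C \<in> rcosets H. ?\<alpha> u C = C}) =
      (SIGMA u : U - {\<one>}. {C \<in> rcosets H. C #> inv u = C})"
    by (rule Sigma_cong) (use subgroup.mem_carrier[OF U] in auto)
  also have "card \<dots> = (\<Sum>u\<in>U - {\<one>}. card {C \<in> rcosets H. C #> inv u = C})"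
    using finU finR by (subst card_SigmaI) auto
  finally show ?thesis .
qed

lemma card_rcosets_one: "card (rcosets {\<one>}) = card (carrier G)"
proof -
  have "rcosets {\<one>} = (\<lambda>g. {g}) ` carrier G"
    by (auto simp: RCOSETS_def r_coset_def)
  then show ?thesis by (simp add: card_image)
qed

text \<open>\<open>U\<close> acts freely on \<open>G\<close> by translation, so only the identity
  contributes to Burnside's sum.\<close>

lemma coset_orbits_one:
  assumes fin: "finite (carrier G)" and U: "subgroup U G"
  shows "coset_orbits U {\<one>} * card U = card (carrier G)"
proof -
  have "{C \<in> rcosets {\<one>}. C #> inv u = C} = {}" if "u \<in> U - {\<one>}" for u
  proof -
    have u: "u \<in> carrier G" "u \<noteq> \<one>" using that subgroup.mem_carrier[OF U] by auto
    have "k \<otimes> inv u \<noteq> k" if "k \<in> carrier G" for k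
      using u that by (metis inv_closed inv_eq_1_iff l_cancel_one)
    then show ?thesis by (auto simp: RCOSETS_def r_coset_def)
  qed
  then have "(\<Sum>u\<in>U - {\<one>}. card {C \<in> rcosets {\<one>}. C #> inv u = C}) = 0"
    by (intro sum.neutral ballI) (simp only: card.empty)
  then show ?thesis
    unfolding coset_orbits_fixed_points[OF fin triv_subgroup U] card_rcosets_one by simp
qed

lemma subgroup_normalizer:
  assumes U: "subgroup U G"
  shows "subgroup U (G\<lparr>carrier := normalizer G U\<rparr>)"
proof -
  note sub = subgroup.subset[OF U]
  have "U \<subseteq> normalizer G U"
  proof
    fix u assume u: "u \<in> U"
    have "u <# U #> inv u = U"
    proof -
      have "u <# U = U" using coset_join3[OF subgroup.mem_carrier[OF U u] U u] .
      moreover have "U #> inv u = U"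
        using coset_join2[OF _ U] subgroup.m_inv_closed[OF U u] sub by blast
      ultimately show ?thesis by simp
    qed
    then show "u \<in> normalizer G U" using mem_normalizer_iff[OF sub] u sub by auto
  qed
  then show ?thesis by (rule subgroup_incl[OF U normalizer_imp_subgroup[OF sub]])
qed

lemma card_dvd_normalizer:
  assumes U: "subgroup U G"
  shows "card U dvd card (normalizer G U)"
proof -
  interpret GN: group "G\<lparr>carrier := normalizer G U\<rparr>"
    by (rule subgroup_imp_group[OF normalizer_imp_subgroup[OF subgroup.subset[OF U]]])
  show ?thesis
    using GN.lagrange[OF subgroup_normalizer[OF U]]
      dvd_triv_right[of "card U" "card (rcosets\<^bsub>G\<lparr>carrier := normalizer G U\<rparr>\<^esub> U)"]
    by (simp add: order_def)
qed

text \<open>A nontrivial u fixes the coset U k if and only if k conjugates u^-1 into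
  \<open>U\<close>, which by primality means that k normalizes \<open>U\<close>. Hence each of the p
  - 1 nontrivial elements fixes the same |N(U)|/p cosets.\<close>

lemma coset_orbits_prime:
  assumes fin: "finite (carrier G)" and U: "subgroup U G" "Factorial_Ring.prime (card U)"
  shows "coset_orbits U U * card U = card (rcosets U) +
    (card U - 1) * (card (normalizer G U) div card U)"
proof -
  note sub = subgroup.subset[OF U(1)]
  have N: "subgroup (normalizer G U) G" by (rule normalizer_imp_subgroup[OF sub])
  let ?GN = "G\<lparr>carrier := normalizer G U\<rparr>"
  interpret GN: group ?GN by (rule subgroup_imp_group[OF N])
  from GN.lagrange[OF subgroup_normalizer[OF U(1)]]
  have "card (rcosets\<^bsub>?GN\<^esub> U) * card U = card (normalizer G U)" by (simp add: order_def)
  moreover have "card U > 0" using prime_gt_0_nat[OF U(2)] .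
  ultimately have f: "card (rcosets\<^bsub>?GN\<^esub> U) = card (normalizer G U) div card U"
    by (metis nonzero_mult_div_cancel_right not_gr_zero)
  have "{C \<in> rcosets U. C #> inv u = C} = rcosets\<^bsub>?GN\<^esub> U" if u: "u \<in> U - {\<one>}" for u
  proof -
    have uc: "u \<in> carrier G" "u \<noteq> \<one>" "u \<in> U" using u sub by auto
    have eq: "U #> k #> inv u = U #> k \<longleftrightarrow> k \<in> normalizer G U" if k: "k \<in> carrier G" for k
    proof -
      have "U #> k #> inv u = U #> k \<longleftrightarrow> k \<otimes> inv u \<otimes> inv k \<in> U"
        using rcos_eq_iff[OF U(1), of "k \<otimes> inv u" k] k uc sub by (simp add: coset_mult_assoc)
      also have "\<dots> \<longleftrightarrow> k \<in> normalizer G U"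
      proof
        assume "k \<otimes> inv u \<otimes> inv k \<in> U"
        moreover have "inv u \<in> U" using subgroup.m_inv_closed[OF U(1) uc(3)] .
        moreover have "inv u \<noteq> \<one>" using uc by simp
        ultimately show "k \<in> normalizer G U"
          using mem_normalizer_of_conj[OF U k] by blast
      next
        assume "k \<in> normalizer G U"
        then show "k \<otimes> inv u \<otimes> inv k \<in> U"
          using conj_mem_of_normalizer[OF sub] subgroup.m_inv_closed[OF U(1) uc(3)] by blast
      qed
      finally show ?thesis .
    qed
    have rN: "rcosets\<^bsub>?GN\<^esub> U = (\<lambda>k. U #> k) ` normalizer G U"
      by (auto simp: RCOSETS_def r_coset_def)
    show ?thesis
    proof (intro equalityI subsetI)
      fix C assume "C \<in> {C \<in> rcosets U. C #> inv u = C}"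
      then obtain k where "k \<in> carrier G" "C = U #> k" "U #> k #> inv u = U #> k"
        by (auto simp: RCOSETS_def)
      then show "C \<in> rcosets\<^bsub>?GN\<^esub> U" unfolding rN using eq by blast
    next
      fix C assume "C \<in> rcosets\<^bsub>?GN\<^esub> U"
      then obtain k where k: "k \<in> normalizer G U" "C = U #> k" unfolding rN by blast
      then have "k \<in> carrier G" using subgroup.subset[OF N] by blast
      then show "C \<in> {C \<in> rcosets U. C #> inv u = C}"
        using eq k rcosetsI[OF sub] by simp
    qed
  qed
  then have "(\<Sum>u\<in>U - {\<one>}. card {C \<in> rcosets U. C #> inv u = C}) =
      (card U - 1) * (card (normalizer G U) div card U)"
    using f subgroup.one_closed[OF U(1)] by simp
  then show ?thesis using coset_orbits_fixed_points[OF fin U(1) U(1)] by simp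
qed

end

section \<open>Compatible pairs built from copies of a coset space\<close>

context double
begin

text \<open>Put n = d N. The set \<open>?A\<close> of relabeled copies has at least n!/(d^N N!)
  elements, and restriction to \<open>U\<close> maps it into the at most K^n n!/Q! actions of
  \<open>U\<close> with Q = q N orbits. Cauchy--Schwarz then bounds the number of pairs below by the
  square of the first number over the second; the result is stated without division.\<close>

lemma card_compatible_pairs_ge:
  assumes fin: "finite (carrier G)" and H: "subgroup H G"
  defines "d \<equiv> card (rcosets H)" and "K \<equiv> group.trans_bound (G\<lparr>carrier := U\<rparr>) + 1"
  shows "fact (d * N) * fact (coset_orbits U H * N) \<le>
    K ^ (d * N) * (real d ^ N * fact N)\<^sup>2 * real (card (compatible_pairs ((rcosets H) \<times> {..<N})))"
proof -
  let ?E = "(rcosets H) \<times> {..<N}"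
  let ?Q = "coset_orbits U H * N"
  let ?GU = "G\<lparr>carrier := U\<rparr>"
  let ?A = "(conj_act ?E (copies H {..<N})) ` {D \<in> ?E \<rightarrow>\<^sub>E ?E. inj_on D ?E}"
  let ?S = "{\<sigma> \<in> actions ?GU ?E. card (orbits ?GU ?E \<sigma>) = ?Q}"
  interpret GU: group ?GU by (rule subgroup_imp_group[OF U])
  have K: "K \<ge> 1" by (simp add: K_def GU.trans_bound_def)
  have finR: "finite (rcosets H)" using fin by (simp add: RCOSETS_def)
  have finU: "finite U" using fin subgroup.subset[OF U] finite_subset by blast
  have finE: "finite ?E" using finR by simp
  have cE: "card ?E = d * N" by (simp add: d_def card_cartesian_product)
  have act: "copies H {..<N} \<in> actions G ?E" by (rule copies_in_actions[OF H])
  have A: "\<alpha> \<in> actions G ?E \<and> card (sub_orbits U ?E \<alpha>) = ?Q" if aA: "\<alpha> \<in> ?A" for \<alpha>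
  proof -
    obtain D where D: "D \<in> ?E \<rightarrow>\<^sub>E ?E" "inj_on D ?E" "\<alpha> = conj_act ?E (copies H {..<N}) D"
      using aA by (elim imageE CollectE conjE)
    have "D ` ?E \<subseteq> ?E" using D(1) by (intro image_subsetI) (rule PiE_mem)
    then have "D ` ?E = ?E" using D(2) by (rule endo_inj_surj[OF finE])
    then have bij: "bij_betw D ?E ?E" using D(2) by (simp only: bij_betw_def)
    show ?thesis
      using conj_act_in_actions[OF act bij] card_sub_orbits_conj_act[OF act bij U]
        card_sub_orbits_copies[OF H U finR, of "{..<N}"] D(3)
      by (simp add: coset_orbits_def)
  qed
  have finA: "finite ?A"
    using A by (intro finite_subset[OF _ finite_actions[OF fin finE]] subsetI) simp
  have finS: "finite ?S" using finite_actions[of ?GU ?E] finU finE by simp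
  have AS: "(\<lambda>\<alpha>. restrict \<alpha> U) ` ?A \<subseteq> ?S"
  proof (rule image_subsetI)
    fix \<alpha> assume "\<alpha> \<in> ?A"
    then have a: "\<alpha> \<in> actions G ?E" "card (sub_orbits U ?E \<alpha>) = ?Q" using A by auto
    have "sub_orbits U ?E (restrict \<alpha> U) = sub_orbits U ?E \<alpha>" by (rule sub_orbits_cong) simp
    then show "restrict \<alpha> U \<in> ?S" using restrict_subgroup_actions[OF a(1) U] a(2) by simp
  qed
  let ?P = "{(\<alpha>, \<beta>) \<in> ?A \<times> ?A. restrict \<alpha> U = restrict \<beta> U}"
  have P: "?P \<subseteq> compatible_pairs ?E"
  proof
    fix z assume "z \<in> ?P"
    then obtain \<alpha> \<beta> where z: "z = (\<alpha>, \<beta>)" "\<alpha> \<in> ?A" "\<beta> \<in> ?A" "restrict \<alpha> U = restrict \<beta> U"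
      by blast
    have "\<alpha> u = \<beta> u" if "u \<in> U" for u using fun_cong[OF z(4), of u] that by simp
    then show "z \<in> compatible_pairs ?E"
      using A[OF z(2)] A[OF z(3)] z(1) by (simp add: compatible_pairs_def)
  qed
  have "(real (card ?A))\<^sup>2 \<le> real (card ?S) * real (card ?P)"
    by (rule card_square_le_card_pairs[OF finA finS AS])
  also have "\<dots> \<le> (K ^ (d * N) * (fact (d * N) / fact ?Q)) * real (card (compatible_pairs ?E))"
  proof (rule mult_mono)
    show "real (card ?S) \<le> K ^ (d * N) * (fact (d * N) / fact ?Q)"
      using GU.card_actions_with_orbits_le[of ?E ?Q] finU finE unfolding cE K_def by simp
    show "real (card ?P) \<le> real (card (compatible_pairs ?E))"
      using card_mono[OF finite_compatible_pairs[OF fin finE] P] by simp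
  qed (use K in auto)
  finally have 1: "(real (card ?A))\<^sup>2 \<le>
      (K ^ (d * N) * (fact (d * N) / fact ?Q)) * real (card (compatible_pairs ?E))" .
  have "fact (d * N) \<le> d ^ N * fact N * card ?A"
    using card_conjugates_ge[OF H finR, of "{..<N}"] finite_actions[OF fin finE] cE
    by (simp add: d_def)
  then have "real (fact (d * N)) \<le> real (d ^ N * fact N * card ?A)" by (rule of_nat_mono)
  then have "fact (d * N) \<le> real d ^ N * fact N * real (card ?A)" by simp
  then have "(fact (d * N))\<^sup>2 \<le> (real d ^ N * fact N * real (card ?A))\<^sup>2"
    by (rule power_mono) simp
  also have "\<dots> = (real d ^ N * fact N)\<^sup>2 * (real (card ?A))\<^sup>2" by (simp only: power_mult_distrib)
  also have "\<dots> \<le> (real d ^ N * fact N)\<^sup>2 *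
      ((K ^ (d * N) * (fact (d * N) / fact ?Q)) * real (card (compatible_pairs ?E)))"
    by (rule mult_left_mono[OF 1]) simp
  finally have "fact (d * N) * fact (d * N) * fact ?Q \<le> fact (d * N) *
      (K ^ (d * N) * (real d ^ N * fact N)\<^sup>2 * real (card (compatible_pairs ?E)))"
    by (simp add: power2_eq_square field_simps)
  then show ?thesis by (simp add: mult.assoc)
qed

text \<open>A smaller growth coefficient leaves room for an exponent \<open>c\<close> below (q -
  2)/d that bounds all s_k. The resulting bound for all actions on d N points contains the same (d
  N)! as the lower bound for pairs; after cancelling it, \<open>factorial_growth_bound\<close> gives
  q \<le> 2 + c d, a contradiction.\<close>

lemma growth_coefficient_amalg_ge:
  assumes fin: "finite (carrier G)" and H: "subgroup H G" and q: "coset_orbits U H > 2"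
  shows "ereal ((real (coset_orbits U H) - 2) / real (card (rcosets H))) \<le> growth_coefficient \<Gamma>"
proof (rule ccontr)
  let ?d = "card (rcosets H)" and ?q = "coset_orbits U H"
  let ?c = "(real ?q - 2) / real ?d"
  let ?K = "group.trans_bound (G\<lparr>carrier := U\<rparr>) + 1"
  assume "\<not> ereal ?c \<le> growth_coefficient \<Gamma>"
  then have "growth_coefficient \<Gamma> < ereal ?c" by simp
  then obtain r where r: "growth_coefficient \<Gamma> < ereal r" "ereal r < ereal ?c"
    using ereal_dense2 by blast
  have finR: "finite (rcosets H)" using fin by (simp add: RCOSETS_def)
  have "H \<in> rcosets H" by (rule subgroup.subgroup_in_rcosets[OF H is_group])
  then have d: "?d \<ge> 1" using finR by (auto simp: Suc_le_eq card_gt_0_iff)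
  have K: "?K \<ge> 1" by (simp add: group.trans_bound_def[OF subgroup_imp_group[OF U]])
  \<comment> \<open>\<open>growth_coefficient_lessD\<close> needs a nonnegative exponent; since q >
    2, raising a negative \<open>r\<close> to 0 keeps it below (q - 2)/d.\<close>
  define c where "c = max r 0"
  have c: "growth_coefficient \<Gamma> < ereal c" "c \<ge> 0" "c < ?c"
    using r d q by (auto simp: c_def max_def intro: less_le_trans)
  obtain C where C: "C \<ge> 0"
    "\<And>k. k \<ge> 1 \<Longrightarrow> real (card (subgroups_of_index \<Gamma> k)) \<le> C * exp (c * nlog k)"
    using growth_coefficient_lessD[OF c(1,2)] by blast
  let ?A = "(?K * (C + 1)) ^ ?d * real ?d ^ 2"
  have "real ?q \<le> 2 + c * real ?d"
  proof (rule factorial_growth_bound[OF _ _ c(2) _ d])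
    fix N :: nat
    let ?E = "(rcosets H) \<times> {..<N}"
    have cE: "card ?E = ?d * N" by (simp add: card_cartesian_product)
    have finE: "finite ?E" using finR by simp
    have h: "real (card (compatible_pairs ?E)) \<le>
        fact (?d * N) * (C + 1) ^ (?d * N) * exp (c * nlog (?d * N))"
      using group.card_actions_le_of_subgroups_of_index_le[OF group_amalg
          finite_actions_amalg[OF fin] c(2) C finE]
      unfolding card_actions_amalg cE .
    have "fact (?d * N) * fact (?q * N) \<le>
        ?K ^ (?d * N) * (real ?d ^ N * fact N)\<^sup>2 * real (card (compatible_pairs ?E))"
      by (rule card_compatible_pairs_ge[OF fin H])
    also have "\<dots> \<le> ?K ^ (?d * N) * (real ?d ^ N * fact N)\<^sup>2 *
        (fact (?d * N) * (C + 1) ^ (?d * N) * exp (c * nlog (?d * N)))"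
      by (rule mult_left_mono[OF h]) (use K in simp)
    also have "\<dots> = fact (?d * N) * (?A ^ N * (fact N)\<^sup>2 * exp (c * nlog (?d * N)))"
      by (simp add: power_mult_distrib power_mult[symmetric] mult_ac)
    finally show "fact (?q * N) \<le> ?A ^ N * (fact N)\<^sup>2 * exp (c * nlog (?d * N))"
      by simp
  next
    have "?K * (C + 1) \<ge> 1" using mult_mono[of 1 ?K 1 "C + 1"] K C by simp
    then have "(?K * (C + 1)) ^ ?d \<ge> 1" by (rule one_le_power)
    moreover have "real ?d ^ 2 \<ge> 1" using d by (intro one_le_power) simp
    ultimately show "?A \<ge> 1"
      using mult_mono[of 1 "(?K * (C + 1)) ^ ?d" 1 "real ?d ^ 2"] by simp
  qed (use q in simp)
  moreover have "c * real ?d < real ?q - 2"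
    using c(3) d by (simp add: less_divide_eq)
  ultimately show False by simp
qed

end

section \<open>A free subgroup of finite index\<close>

text \<open>The complements of domain and range have equal size because \<open>N\<close> is finite,
  so any bijection between them completes the partial one.\<close>

lemma extend_partial_bijection:
  assumes N: "finite N" and R: "R \<subseteq> N \<times> N" "single_valued R" "single_valued (R\<inverse>)"
  shows "\<exists>\<pi>. bij_betw \<pi> N N \<and> (\<forall>(a, b)\<in>R. \<pi> a = b)"
proof -
  define f where "f a = (SOME b. (a, b) \<in> R)" for a
  have f: "f a = b" if "(a, b) \<in> R" for a b
  proof -
    have "(a, f a) \<in> R" unfolding f_def by (rule someI[of _ b]) (rule that)
    then show ?thesis using R(2) that by (meson single_valuedD)
  qed
  have inj: "inj_on f (Domain R)"
  proof (rule inj_onI)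
    fix a a' assume "a \<in> Domain R" "a' \<in> Domain R" "f a = f a'"
    then obtain b b' where "(a, b) \<in> R" "(a', b') \<in> R" by blast
    with \<open>f a = f a'\<close> f have "(b, a) \<in> R\<inverse>" "(b, a') \<in> R\<inverse>" by auto
    then show "a = a'" using R(3) by (meson single_valuedD)
  qed
  have im: "f ` Domain R = Range R"
  proof -
    have "f a \<in> Range R" if "a \<in> Domain R" for a using that f by auto
    moreover have "b \<in> f ` Domain R" if "b \<in> Range R" for b using that f by force
    ultimately show ?thesis by blast
  qed
  have D: "Domain R \<subseteq> N" "Range R \<subseteq> N" using R(1) by auto
  have "card (Domain R) = card (Range R)" using card_image[OF inj] im by simp
  then have "card (N - Domain R) = card (N - Range R)"
    using D N by (simp add: card_Diff_subset finite_subset)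
  then obtain h where h: "bij_betw h (N - Domain R) (N - Range R)"
    using finite_same_card_bij[of "N - Domain R" "N - Range R"] N by auto
  let ?\<pi> = "\<lambda>a. if a \<in> Domain R then f a else h a"
  have "bij_betw ?\<pi> (Domain R) (Range R)"
    using inj im by (simp add: bij_betw_def cong: inj_on_cong)
  moreover have "bij_betw ?\<pi> (N - Domain R) (N - Range R)"
    using h by (subst bij_betw_cong[where g = h]) auto
  ultimately have "bij_betw ?\<pi> (Domain R \<union> (N - Domain R)) (Range R \<union> (N - Range R))"
    by (rule bij_betw_combine) auto
  moreover have "Domain R \<union> (N - Domain R) = N" "Range R \<union> (N - Range R) = N" using D by auto
  ultimately have "bij_betw ?\<pi> N N" by simp
  moreover have "\<forall>(a, b)\<in>R. ?\<pi> a = b" using f by auto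
  ultimately show ?thesis by (intro exI[of _ ?\<pi>]) blast
qed

text \<open>\<open>R s\<close> prescribes how s moves the positions 0, ..., length w: for a letter s
  at i it sends i + 1 to i, for an inverse letter at i it sends i to i + 1, so that every letter
  moves i + 1 to i. A position could get two images or two preimages only from adjacent letters that
  cancel, which reducedness excludes.\<close>

lemma reduced_word_step_relation:
  assumes w: "reduced_word w"
  defines "R \<equiv> \<lambda>s. {(Suc i, i) |i. i < length w \<and> w ! i = (s, True)} \<union>
    {(i, Suc i) |i. i < length w \<and> w ! i = (s, False)}"
  shows "single_valued (R s)" "single_valued ((R s)\<inverse>)"
proof -
  have no: "False" if "Suc i < length w" "w ! i = (s, b)" "w ! Suc i = (s, b')" "b \<noteq> b'" for i b b'
    using w that unfolding reduced_word_def by auto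
  show "single_valued (R s)"
  proof (rule single_valuedI)
    fix a b c assume "(a, b) \<in> R s" "(a, c) \<in> R s"
    then show "b = c" using no[of b True False] no[of c True False] by (auto simp: R_def)
  qed
  show "single_valued ((R s)\<inverse>)"
  proof (rule single_valuedI)
    fix a b c assume "(a, b) \<in> (R s)\<inverse>" "(a, c) \<in> (R s)\<inverse>"
    then show "b = c" using no[of b False True] no[of c False True] by (auto simp: R_def)
  qed
qed

context group
begin

lemma eval_word_simps [simp]:
  "eval_word G [] = \<one>"
  "eval_word G ((s, True) # w) = s \<otimes> eval_word G w"
  "eval_word G ((s, False) # w) = inv s \<otimes> eval_word G w"
  by (simp_all add: eval_word_def)

lemma eval_word_closed:
  "S \<subseteq> carrier G \<Longrightarrow> w \<in> lists (S \<times> UNIV) \<Longrightarrow> eval_word G w \<in> carrier G"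
proof (induction w)
  case (Cons l w)
  obtain s b where l: "l = (s, b)" by (cases l)
  with Cons show ?case by (cases b) auto
qed simp

end

context double
begin

definition regular :: "'a \<Rightarrow> 'a \<times> 'y \<Rightarrow> 'a \<times> 'y" where
  "regular g = (\<lambda>(h, y). (g \<otimes> h, y))"

definition twist :: "'a \<Rightarrow> ('a + 'a) list set" (\<open>\<tau>\<close>) where
  "\<tau> g = \<iota>\<^sub>1 g \<otimes>\<^bsub>\<Gamma>\<^esub> \<iota>\<^sub>2 (inv g)"

lemma twist_closed: "g \<in> carrier G \<Longrightarrow> \<tau> g \<in> carrier \<Gamma>"
  unfolding twist_def
  by (intro monoid.m_closed[OF group.is_monoid[OF group_amalg]] left_closed right_closed inv_closed)

(* The second copy of G acts through the regular action conjugated by D(h, y) = (h, delta(h^-1) y),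
   which commutes with U; the values of delta are otherwise free. *)
lemma exists_prescribed_action:
  assumes bij: "\<And>g. g \<in> carrier G \<Longrightarrow> bij_betw (\<delta> g) Y Y"
    and inv: "\<And>g u y. g \<in> carrier G \<Longrightarrow> u \<in> U \<Longrightarrow> y \<in> Y \<Longrightarrow> \<delta> (g \<otimes> u) y = \<delta> g y"
    and one: "\<And>y. y \<in> Y \<Longrightarrow> \<delta> \<one> y = y"
  shows "\<exists>\<gamma>\<in>actions \<Gamma> (carrier G \<times> Y).
    (\<forall>g\<in>carrier G. \<forall>h\<in>carrier G. \<forall>y\<in>Y. \<gamma> (\<iota>\<^sub>1 g) (h, y) = (g \<otimes> h, y)) \<and>
    (\<forall>g\<in>carrier G. \<forall>y\<in>Y. \<gamma> (\<tau> g) (\<one>, y) = (\<one>, \<delta> g y))"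
proof -
  let ?E = "carrier G \<times> Y"
  let ?\<alpha> = "restrict_act G ?E regular"
  let ?D = "\<lambda>(h, y). (h, \<delta> (inv h) y)"
  let ?\<beta> = "conj_act ?E ?\<alpha> ?D"
  have act: "?\<alpha> \<in> actions G ?E"
    by (rule restrict_act_in_actions) (auto simp: regular_def m_assoc)
  have D: "bij_betw ?D ?E ?E"
  proof (rule bij_betwI')
    fix e e' assume "e \<in> ?E" "e' \<in> ?E"
    then show "(?D e = ?D e') = (e = e')"
      using inj_on_eq_iff[OF bij_betw_imp_inj_on[OF bij]] by auto
  next
    fix e assume "e \<in> ?E"
    then show "?D e \<in> ?E" using bij_betwE[OF bij] by auto
  next
    fix e' assume "e' \<in> ?E"
    then obtain h y' where e': "e' = (h, y')" "h \<in> carrier G" "y' \<in> Y" by auto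
    then have "y' \<in> \<delta> (inv h) ` Y" using bij_betw_imp_surj_on[OF bij[of "inv h"]] by simp
    then obtain y where "y \<in> Y" "y' = \<delta> (inv h) y" by blast
    then show "\<exists>e\<in>?E. e' = ?D e" using e' by (intro bexI[of _ "(h, y)"]) auto
  qed
  have act': "?\<beta> \<in> actions G ?E" by (rule conj_act_in_actions[OF act D])
  have agree: "?\<alpha> u e = ?\<beta> u e" if u: "u \<in> U" and e: "e \<in> ?E" for u e
  proof -
    have uc: "u \<in> carrier G" by (rule subgroup.mem_carrier[OF U u])
    have "e \<in> ?D ` ?E" using bij_betw_imp_surj_on[OF D] e by simp
    then obtain h y where h: "h \<in> carrier G" "y \<in> Y" "e = ?D (h, y)" by blast
    have "\<delta> (inv (u \<otimes> h)) y = \<delta> (inv h) y"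
      using inv[of "inv h" "inv u" y] h uc subgroup.m_inv_closed[OF U u] by (simp add: inv_mult_group)
    moreover have "?\<beta> u e = ?D (?\<alpha> u (h, y))"
      unfolding h(3) using conj_act_apply[OF D uc, of "(h, y)"] h by simp
    ultimately show ?thesis using h uc bij_betwE[OF bij[of "inv h"]] by (simp add: regular_def)
  qed
  let ?\<gamma> = "amalg_act ?E ?\<alpha> ?\<beta>"
  have g: "?\<gamma> \<in> actions \<Gamma> ?E" by (rule amalg_act_in_actions[OF act act' agree])
  have left: "?\<gamma> (\<iota>\<^sub>1 g) e = ?\<alpha> g e" if "g \<in> carrier G" "e \<in> ?E" for g e
    by (rule amalg_act_left[OF act act' agree that])
  have right: "?\<gamma> (\<iota>\<^sub>2 g) e = ?\<beta> g e" if "g \<in> carrier G" "e \<in> ?E" for g e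
    by (rule amalg_act_right[OF act act' agree that])
  have "?\<gamma> (\<iota>\<^sub>1 g) (h, y) = (g \<otimes> h, y)" if "g \<in> carrier G" "h \<in> carrier G" "y \<in> Y" for g h y
    using left[of g "(h, y)"] that by (simp add: regular_def)
  moreover have "?\<gamma> (\<tau> g) (\<one>, y) = (\<one>, \<delta> g y)" if gy: "g \<in> carrier G" "y \<in> Y" for g y
  proof -
    have e: "(\<one>, y) \<in> ?E" "(inv g, \<delta> g y) \<in> ?E" using gy bij_betwE[OF bij[of g]] by auto
    have "?\<gamma> (\<tau> g) (\<one>, y) = ?\<gamma> (\<iota>\<^sub>1 g) (?\<gamma> (\<iota>\<^sub>2 (inv g)) (\<one>, y))"
      unfolding twist_def using act_mult[OF g left_closed right_closed e(1)] gy by simp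
    also have "?\<gamma> (\<iota>\<^sub>2 (inv g)) (\<one>, y) = ?\<beta> (inv g) (\<one>, y)" using right[OF _ e(1)] gy by simp
    also have "\<dots> = ?\<beta> (inv g) (?D (\<one>, y))" using one gy by simp
    also have "\<dots> = ?D (?\<alpha> (inv g) (\<one>, y))" using conj_act_apply[OF D _ e(1)] gy by simp
    also have "\<dots> = (inv g, \<delta> g y)" using gy by (simp add: regular_def)
    also have "?\<gamma> (\<iota>\<^sub>1 g) (inv g, \<delta> g y) = (\<one>, \<delta> g y)"
      using left[OF gy(1) e(2)] gy e(2) by (simp add: regular_def)
    finally show ?thesis .
  qed
  ultimately show ?thesis using g by (intro bexI[of _ ?\<gamma>]) auto
qed

section \<open>Twists and cosets of U\<close>

lemma inv_mult_mem_U_cong: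
  assumes "g \<in> carrier G" "h \<in> carrier G" "u \<in> U"
  shows "inv g \<otimes> (h \<otimes> u) \<in> U \<longleftrightarrow> inv g \<otimes> h \<in> U"
proof -
  have u: "u \<in> carrier G" by (rule subgroup.mem_carrier[OF U assms(3)])
  have "inv g \<otimes> h = inv g \<otimes> (h \<otimes> u) \<otimes> inv u" using assms(1,2) u by (simp add: m_assoc)
  moreover have "inv g \<otimes> (h \<otimes> u) = inv g \<otimes> h \<otimes> u" using assms(1,2) u by (simp add: m_assoc)
  ultimately show ?thesis
    using subgroup.m_closed[OF U] subgroup.m_inv_closed[OF U] assms(3) by metis
qed

lemma mult_mem_U_cong:
  assumes "g \<in> carrier G" "u \<in> U"
  shows "g \<otimes> u \<in> U \<longleftrightarrow> g \<in> U"
  using inv_mult_mem_U_cong[OF one_closed assms] assms subgroup.mem_carrier[OF U assms(2)] by simp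

lemma twist_mult:
  assumes "g \<in> carrier G" "u \<in> U"
  shows "\<tau> (g \<otimes> u) = \<tau> g"
proof -
  interpret A: group \<Gamma> by (rule group_amalg)
  have u: "u \<in> carrier G" by (rule subgroup.mem_carrier[OF U assms(2)])
  note c = left_closed[OF assms(1)] left_closed[OF u] right_closed[OF inv_closed[OF assms(1)]]
    right_closed[OF inv_closed[OF u]]
  have "\<iota>\<^sub>1 u \<otimes>\<^bsub>\<Gamma>\<^esub> \<iota>\<^sub>2 (inv u) = \<one>\<^bsub>\<Gamma>\<^esub>"
    using left_eq_right[OF assms(2)] right_mult[OF u inv_closed[OF u]] right_one u by simp
  then have "\<iota>\<^sub>1 u \<otimes>\<^bsub>\<Gamma>\<^esub> (\<iota>\<^sub>2 (inv u) \<otimes>\<^bsub>\<Gamma>\<^esub> \<iota>\<^sub>2 (inv g)) = \<iota>\<^sub>2 (inv g)"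
    using c by (simp flip: A.m_assoc)
  then show ?thesis
    using c assms(1) u left_mult[OF assms(1) u] right_mult[OF inv_closed[OF u] inv_closed[OF assms(1)]]
    by (simp add: twist_def inv_mult_group A.m_assoc)
qed

lemma twist_one: "\<tau> \<one> = \<one>\<^bsub>\<Gamma>\<^esub>"
  using monoid.l_one[OF group.is_monoid[OF group_amalg]] monoid.one_closed[OF group.is_monoid[OF group_amalg]]
  by (simp add: twist_def left_one right_one)

lemma twist_U: "u \<in> U \<Longrightarrow> \<tau> u = \<one>\<^bsub>\<Gamma>\<^esub>"
  using twist_mult[OF one_closed, of u] twist_one subgroup.mem_carrier[OF U] by simp

text \<open>Two twists are separated by an action with two points over each group element: over the
  identity, the twists of the coset g U swap the two points and all others fix them.
  \<open>g \<notin> U\<close> keeps the prescription at the identity trivial.\<close>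

lemma twist_eqD:
  assumes "g \<in> carrier G" "h \<in> carrier G" "g \<notin> U" "\<tau> g = \<tau> h"
  shows "inv g \<otimes> h \<in> U"
proof -
  define \<delta> where "\<delta> k = (if inv g \<otimes> k \<in> U then Not else id)" for k
  have "inv g \<notin> U" using assms(1,3) subgroup.m_inv_closed[OF U, of "inv g"] by auto
  then have "\<exists>\<gamma>\<in>actions \<Gamma> (carrier G \<times> UNIV).
    (\<forall>g\<in>carrier G. \<forall>h\<in>carrier G. \<forall>y\<in>UNIV. \<gamma> (\<iota>\<^sub>1 g) (h, y) = (g \<otimes> h, y)) \<and>
    (\<forall>g\<in>carrier G. \<forall>y\<in>UNIV. \<gamma> (\<tau> g) (\<one>, y) = (\<one>, \<delta> g y))"
    using assms(1) inv_mult_mem_U_cong[OF assms(1)]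
    by (intro exists_prescribed_action) (auto simp: \<delta>_def bij_betw_def inj_on_def image_iff)
  then obtain \<gamma> where \<gamma>: "\<forall>k\<in>carrier G. \<forall>y\<in>UNIV. \<gamma> (\<tau> k) (\<one>, y) = (\<one>, \<delta> k y)"
    by blast
  have "\<gamma> (\<tau> k) (\<one>, True) = (\<one>, \<delta> k True)" if "k \<in> carrier G" for k
    using \<gamma> that by blast
  from this[OF assms(1)] this[OF assms(2)] have "\<delta> g True = \<delta> h True" using assms(4) by simp
  moreover have "\<delta> g True = False"
    using assms(1) subgroup.one_closed[OF U] by (simp add: \<delta>_def)
  ultimately show ?thesis by (simp add: \<delta>_def split: if_splits)
qed

definition twists :: "('a + 'a) list set set" where
  "twists = \<tau> ` (carrier G - U)"

text \<open>The fibres of \<open>\<tau>\<close> outside \<open>U\<close> are the cosets g U, so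
  there are [G:U] - 1 twists.\<close>

lemma card_twists:
  assumes fin: "finite (carrier G)"
  shows "finite twists" "card twists * card U + card U = card (carrier G)"
proof -
  show "finite twists" using fin by (simp add: twists_def)
  note sub = subgroup.subset[OF U]
  have finU: "finite U" using fin sub finite_subset by blast
  have "card {h \<in> carrier G - U. \<tau> h = s} = card U" if sT: "s \<in> twists" for s
  proof -
    obtain g where g: "g \<in> carrier G" "g \<notin> U" "s = \<tau> g" using sT by (auto simp: twists_def)
    have "{h \<in> carrier G - U. \<tau> h = s} = (\<lambda>u. g \<otimes> u) ` U"
    proof (intro equalityI subsetI)
      fix h assume h: "h \<in> {h \<in> carrier G - U. \<tau> h = s}"
      then have "inv g \<otimes> h \<in> U" using twist_eqD[OF g(1) _ g(2), of h] g(3) by auto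
      moreover have "h = g \<otimes> (inv g \<otimes> h)" using h g(1) by (simp add: inv_mult_cancel)
      ultimately show "h \<in> (\<lambda>u. g \<otimes> u) ` U" by blast
    next
      fix h assume "h \<in> (\<lambda>u. g \<otimes> u) ` U"
      then obtain u where u: "u \<in> U" "h = g \<otimes> u" by blast
      then show "h \<in> {h \<in> carrier G - U. \<tau> h = s}"
        using g twist_mult[OF g(1) u(1)] mult_mem_U_cong[OF g(1) u(1)] sub by auto
    qed
    moreover have "inj_on (\<lambda>u. g \<otimes> u) U" using g(1) sub by (intro inj_onI) (simp add: subset_iff)
    ultimately show ?thesis by (simp add: card_image)
  qed
  moreover have "card (carrier G - U) = (\<Sum>s\<in>twists. card {h \<in> carrier G - U. \<tau> h = s})"
    using sum.group[of "carrier G - U" twists \<tau> "\<lambda>_. 1 :: nat"] fin by (simp add: twists_def)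
  ultimately have "card (carrier G - U) = card twists * card U" by simp
  then show "card twists * card U + card U = card (carrier G)"
    using card_Diff_subset[OF finU sub] card_mono[OF fin sub] by simp
qed

section \<open>The folding map and its kernel\<close>

definition fold_act :: "('a + 'a) list set \<Rightarrow> 'a \<Rightarrow> 'a" where
  "fold_act = amalg_act (carrier G) (restrict_act G (carrier G) (\<otimes>)) (restrict_act G (carrier G) (\<otimes>))"

text \<open>The folding map acts through left multiplication on \<open>G\<close>, a regular action,
  so the stabilizer of the identity is the kernel. In this form the subgroup property and the index
  |G| come from the orbit-stabilizer bijection.\<close>

definition kernel_fold :: "('a + 'a) list set set" where
  "kernel_fold = stabilizer \<Gamma> fold_act \<one>"

lemma fold_act:
  shows "fold_act \<in> actions \<Gamma> (carrier G)"
    and "g \<in> carrier G \<Longrightarrow> h \<in> carrier G \<Longrightarrow> fold_act (\<iota>\<^sub>1 g) h = g \<otimes> h"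
    and "g \<in> carrier G \<Longrightarrow> h \<in> carrier G \<Longrightarrow> fold_act (\<iota>\<^sub>2 g) h = g \<otimes> h"
proof -
  have act: "restrict_act G (carrier G) (\<otimes>) \<in> actions G (carrier G)"
    by (rule restrict_act_in_actions) (auto simp: m_assoc)
  show "fold_act \<in> actions \<Gamma> (carrier G)"
    unfolding fold_act_def by (rule amalg_act_in_actions[OF act act HOL.refl])
  show "fold_act (\<iota>\<^sub>1 g) h = g \<otimes> h" if "g \<in> carrier G" "h \<in> carrier G"
    unfolding fold_act_def using amalg_act_left[OF act act HOL.refl that] that by simp
  show "fold_act (\<iota>\<^sub>2 g) h = g \<otimes> h" if "g \<in> carrier G" "h \<in> carrier G"
    unfolding fold_act_def using amalg_act_right[OF act act HOL.refl that] that by simp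
qed

lemma kernel_fold_subgroup: "subgroup kernel_fold \<Gamma>"
  unfolding kernel_fold_def
  by (rule group_action.stabilizer_subgroup[OF group.act_group_action[OF group_amalg fold_act(1)]])
    simp

lemma card_rcosets_kernel_fold: "card (rcosets\<^bsub>\<Gamma>\<^esub> kernel_fold) = card (carrier G)"
  and finite_rcosets_kernel_fold: "finite (carrier G) \<Longrightarrow> finite (rcosets\<^bsub>\<Gamma>\<^esub> kernel_fold)"
proof -
  have "orbit \<Gamma> fold_act \<one> = carrier G"
  proof
    show "orbit \<Gamma> fold_act \<one> \<subseteq> carrier G"
      by (rule group.orbit_subset[OF group_amalg fold_act(1)]) simp
    have "fold_act (\<iota>\<^sub>1 g) \<one> \<in> orbit \<Gamma> fold_act \<one>" if "g \<in> carrier G" for g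
      unfolding group.orbit_eq_carrier_image[OF group_amalg] using left_closed[OF that] by (rule imageI)
    then show "carrier G \<subseteq> orbit \<Gamma> fold_act \<one>" using fold_act(2)[OF _ one_closed] by auto
  qed
  then have bij: "bij_betw (\<lambda>R. fold_act (inv\<^bsub>\<Gamma>\<^esub> (SOME h. h \<in> R)) \<one>) (rcosets\<^bsub>\<Gamma>\<^esub> kernel_fold) (carrier G)"
    unfolding kernel_fold_def
    using group_action.orbit_stab_fun_is_bij[OF group.act_group_action[OF group_amalg fold_act(1)] one_closed]
    by simp
  show "card (rcosets\<^bsub>\<Gamma>\<^esub> kernel_fold) = card (carrier G)" by (rule bij_betw_same_card[OF bij])
  show "finite (carrier G) \<Longrightarrow> finite (rcosets\<^bsub>\<Gamma>\<^esub> kernel_fold)" using bij_betw_finite[OF bij] by simp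
qed

lemma twists_subset: "twists \<subseteq> kernel_fold"
proof
  fix s assume "s \<in> twists"
  then obtain g where g: "g \<in> carrier G" "s = \<tau> g" by (auto simp: twists_def)
  have "fold_act (\<tau> g) \<one> = fold_act (\<iota>\<^sub>1 g) (fold_act (\<iota>\<^sub>2 (inv g)) \<one>)"
    unfolding twist_def
    by (rule act_mult[OF fold_act(1) left_closed[OF g(1)] right_closed[OF inv_closed[OF g(1)]] one_closed])
  also have "\<dots> = \<one>" using fold_act(2,3) g(1) by simp
  finally show "s \<in> kernel_fold"
    using g twist_closed[OF g(1)] by (simp add: kernel_fold_def stabilizer_def)
qed

lemma twist_in_generate: "g \<in> carrier G \<Longrightarrow> \<tau> g \<in> generate \<Gamma> twists"
  using twist_U generate.one[of \<Gamma> twists] generate.incl[of "\<tau> g" twists \<Gamma>]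
  by (cases "g \<in> U") (auto simp: twists_def)

lemma twists_carrier: "twists \<subseteq> carrier \<Gamma>"
  using twist_closed by (auto simp: twists_def)

text \<open>Multiplying the conjugate by \<open>\<tau> h\<close> on the left cancels the inner
  copies of h and leaves \<open>\<tau> (h \<otimes> g)\<close>. Hence the second copy of
  \<open>G\<close> normalizes the group generated by the twists.\<close>

lemma conj_right_twist:
  assumes "g \<in> carrier G" "h \<in> carrier G"
  shows "\<iota>\<^sub>2 h \<otimes>\<^bsub>\<Gamma>\<^esub> \<tau> g \<otimes>\<^bsub>\<Gamma>\<^esub> \<iota>\<^sub>2 (inv h) = inv\<^bsub>\<Gamma>\<^esub> (\<tau> h) \<otimes>\<^bsub>\<Gamma>\<^esub> \<tau> (h \<otimes> g)"
proof -
  interpret A: group \<Gamma> by (rule group_amalg)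
  note c = left_closed[OF assms(1)] left_closed[OF assms(2)] right_closed[OF assms(2)]
    right_closed[OF inv_closed[OF assms(1)]] right_closed[OF inv_closed[OF assms(2)]]
  have r: "\<iota>\<^sub>2 (inv h) \<otimes>\<^bsub>\<Gamma>\<^esub> \<iota>\<^sub>2 h = \<one>\<^bsub>\<Gamma>\<^esub>"
    using right_mult[OF inv_closed[OF assms(2)] assms(2)] right_one assms(2) by simp
  have "\<tau> h \<otimes>\<^bsub>\<Gamma>\<^esub> (\<iota>\<^sub>2 h \<otimes>\<^bsub>\<Gamma>\<^esub> \<tau> g \<otimes>\<^bsub>\<Gamma>\<^esub> \<iota>\<^sub>2 (inv h)) =
      \<iota>\<^sub>1 h \<otimes>\<^bsub>\<Gamma>\<^esub> ((\<iota>\<^sub>2 (inv h) \<otimes>\<^bsub>\<Gamma>\<^esub> \<iota>\<^sub>2 h) \<otimes>\<^bsub>\<Gamma>\<^esub> (\<tau> g \<otimes>\<^bsub>\<Gamma>\<^esub> \<iota>\<^sub>2 (inv h)))"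
    using c twist_closed[OF assms(1)] by (simp add: twist_def[of h] A.m_assoc)
  also have "\<dots> = \<iota>\<^sub>1 h \<otimes>\<^bsub>\<Gamma>\<^esub> (\<tau> g \<otimes>\<^bsub>\<Gamma>\<^esub> \<iota>\<^sub>2 (inv h))"
    unfolding r using c twist_closed[OF assms(1)] by simp
  also have "\<dots> = \<tau> (h \<otimes> g)"
    using c left_mult[OF assms(2,1)] right_mult[OF inv_closed[OF assms(1)] inv_closed[OF assms(2)]] assms
    by (simp add: twist_def inv_mult_group A.m_assoc)
  finally show ?thesis
    using c twist_closed assms by (metis A.inv_solve_left A.m_closed m_closed)
qed

lemma conj_right_generate:
  assumes "s \<in> generate \<Gamma> twists" "h \<in> carrier G"
  shows "\<iota>\<^sub>2 h \<otimes>\<^bsub>\<Gamma>\<^esub> s \<otimes>\<^bsub>\<Gamma>\<^esub> \<iota>\<^sub>2 (inv h) \<in> generate \<Gamma> twists"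
proof -
  interpret A: group \<Gamma> by (rule group_amalg)
  have gen: "subgroup (generate \<Gamma> twists) \<Gamma>" by (rule A.generate_is_subgroup[OF twists_carrier])
  have c: "\<iota>\<^sub>2 h \<in> carrier \<Gamma>" "\<iota>\<^sub>2 (inv h) \<in> carrier \<Gamma>"
    using right_closed assms(2) by auto
  have inv: "\<iota>\<^sub>2 (inv h) = inv\<^bsub>\<Gamma>\<^esub> (\<iota>\<^sub>2 h)"
    using right_mult[OF inv_closed[OF assms(2)] assms(2)] right_one assms(2) c
    by (intro A.inv_equality[symmetric]) auto
  have tw: "\<iota>\<^sub>2 h \<otimes>\<^bsub>\<Gamma>\<^esub> s \<otimes>\<^bsub>\<Gamma>\<^esub> \<iota>\<^sub>2 (inv h) \<in> generate \<Gamma> twists" if s: "s \<in> twists" for s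
  proof -
    obtain g where g: "g \<in> carrier G" "s = \<tau> g" using s by (auto simp: twists_def)
    show ?thesis
      unfolding g(2) conj_right_twist[OF g(1) assms(2)]
      by (intro subgroup.m_closed[OF gen] subgroup.m_inv_closed[OF gen] twist_in_generate m_closed
          assms(2) g(1))
  qed
  show ?thesis
    using assms(1)
  proof (induction s rule: generate.induct)
    case one
    then show ?case using c generate.one[of \<Gamma>] by (simp add: inv)
  next
    case (incl s)
    then show ?case by (rule tw)
  next
    case (inv s)
    then have s: "s \<in> carrier \<Gamma>" using twists_carrier by blast
    have "\<iota>\<^sub>2 h \<otimes>\<^bsub>\<Gamma>\<^esub> inv\<^bsub>\<Gamma>\<^esub> s \<otimes>\<^bsub>\<Gamma>\<^esub> \<iota>\<^sub>2 (inv h) =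
        inv\<^bsub>\<Gamma>\<^esub> (\<iota>\<^sub>2 h \<otimes>\<^bsub>\<Gamma>\<^esub> s \<otimes>\<^bsub>\<Gamma>\<^esub> \<iota>\<^sub>2 (inv h))"
      using s c(1) by (simp add: \<open>\<iota>\<^sub>2 (inv h) = inv\<^bsub>\<Gamma>\<^esub> (\<iota>\<^sub>2 h)\<close> A.inv_mult_group A.m_assoc)
    then show ?case using subgroup.m_inv_closed[OF gen tw[OF inv]] by simp
  next
    case (eng s s')
    have s: "s \<in> carrier \<Gamma>" "s' \<in> carrier \<Gamma>"
      using eng.hyps subgroup.mem_carrier[OF gen] by auto
    have "\<iota>\<^sub>2 h \<otimes>\<^bsub>\<Gamma>\<^esub> (s \<otimes>\<^bsub>\<Gamma>\<^esub> s') \<otimes>\<^bsub>\<Gamma>\<^esub> \<iota>\<^sub>2 (inv h) =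
        (\<iota>\<^sub>2 h \<otimes>\<^bsub>\<Gamma>\<^esub> s \<otimes>\<^bsub>\<Gamma>\<^esub> \<iota>\<^sub>2 (inv h)) \<otimes>\<^bsub>\<Gamma>\<^esub> (\<iota>\<^sub>2 h \<otimes>\<^bsub>\<Gamma>\<^esub> s' \<otimes>\<^bsub>\<Gamma>\<^esub> \<iota>\<^sub>2 (inv h))"
      using s c(1) by (simp add: inv A.m_assoc A.inv_mult_cancel)
    then show ?case using subgroup.m_closed[OF gen eng.IH] by simp
  qed
qed

text \<open>Since \<open>\<iota>\<^sub>1 h\<close> is \<open>\<tau> h\<close> times
  \<open>\<iota>\<^sub>2 h\<close>, every letter is an element generated by twists times an element
  of the second copy, and that copy can be moved to the right past the subgroup it
  normalizes.\<close>

lemma amalg_decompose: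
  assumes "A \<in> carrier \<Gamma>"
  shows "\<exists>s\<in>generate \<Gamma> twists. \<exists>g\<in>carrier G. A = s \<otimes>\<^bsub>\<Gamma>\<^esub> \<iota>\<^sub>2 g"
proof -
  interpret A: group \<Gamma> by (rule group_amalg)
  have gen: "subgroup (generate \<Gamma> twists) \<Gamma>" by (rule A.generate_is_subgroup[OF twists_carrier])
  have step: "\<exists>s'\<in>generate \<Gamma> twists. \<exists>g'\<in>carrier G.
      r \<otimes>\<^bsub>\<Gamma>\<^esub> \<iota>\<^sub>2 h \<otimes>\<^bsub>\<Gamma>\<^esub> (s \<otimes>\<^bsub>\<Gamma>\<^esub> \<iota>\<^sub>2 g) = s' \<otimes>\<^bsub>\<Gamma>\<^esub> \<iota>\<^sub>2 g'"
    if "r \<in> generate \<Gamma> twists" "s \<in> generate \<Gamma> twists" "g \<in> carrier G" "h \<in> carrier G" for r s g h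
  proof -
    have c: "r \<in> carrier \<Gamma>" "s \<in> carrier \<Gamma>" "\<iota>\<^sub>2 g \<in> carrier \<Gamma>" "\<iota>\<^sub>2 h \<in> carrier \<Gamma>"
      "\<iota>\<^sub>2 (inv h) \<in> carrier \<Gamma>"
      using that subgroup.mem_carrier[OF gen] right_closed by auto
    have r: "\<iota>\<^sub>2 (inv h) \<otimes>\<^bsub>\<Gamma>\<^esub> (\<iota>\<^sub>2 h \<otimes>\<^bsub>\<Gamma>\<^esub> \<iota>\<^sub>2 g) = \<iota>\<^sub>2 g"
      using right_mult[OF inv_closed[OF that(4)] m_closed[OF that(4,3)]] right_mult[OF that(4,3)] that
      by (simp add: inv_mult_cancel)
    have "r \<otimes>\<^bsub>\<Gamma>\<^esub> \<iota>\<^sub>2 h \<otimes>\<^bsub>\<Gamma>\<^esub> (s \<otimes>\<^bsub>\<Gamma>\<^esub> \<iota>\<^sub>2 g) =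
        r \<otimes>\<^bsub>\<Gamma>\<^esub> (\<iota>\<^sub>2 h \<otimes>\<^bsub>\<Gamma>\<^esub> s \<otimes>\<^bsub>\<Gamma>\<^esub> \<iota>\<^sub>2 (inv h)) \<otimes>\<^bsub>\<Gamma>\<^esub> \<iota>\<^sub>2 (h \<otimes> g)"
      using c r right_mult[OF that(4,3)] by (simp add: A.m_assoc)
    then show ?thesis
      using subgroup.m_closed[OF gen that(1) conj_right_generate[OF that(2,4)]] m_closed[OF that(4,3)]
      by blast
  qed
  show ?thesis
    using assms
  proof (induction A rule: amalg_induct)
    case one
    have "\<one>\<^bsub>\<Gamma>\<^esub> = \<one>\<^bsub>\<Gamma>\<^esub> \<otimes>\<^bsub>\<Gamma>\<^esub> \<iota>\<^sub>2 \<one>" using right_one by simp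
    then show ?case using generate.one one_closed by blast
  next
    case (left h A)
    then obtain s g where sg: "s \<in> generate \<Gamma> twists" "g \<in> carrier G" "A = s \<otimes>\<^bsub>\<Gamma>\<^esub> \<iota>\<^sub>2 g" by blast
    have "\<iota>\<^sub>1 h = \<tau> h \<otimes>\<^bsub>\<Gamma>\<^esub> \<iota>\<^sub>2 h"
      using left.hyps(1) left_closed right_closed right_one
      by (simp add: twist_def A.m_assoc right_mult[symmetric])
    then show ?case using step[OF twist_in_generate[OF left.hyps(1)] sg(1,2) left.hyps(1)] sg(3) by simp
  next
    case (right h A)
    then obtain s g where sg: "s \<in> generate \<Gamma> twists" "g \<in> carrier G" "A = s \<otimes>\<^bsub>\<Gamma>\<^esub> \<iota>\<^sub>2 g" by blast
    have "\<iota>\<^sub>2 h = \<one>\<^bsub>\<Gamma>\<^esub> \<otimes>\<^bsub>\<Gamma>\<^esub> \<iota>\<^sub>2 h" using right_closed[OF right.hyps(1)] by simp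
    then show ?case using step[OF generate.one sg(1,2) right.hyps(1)] sg(3) by simp
  qed
qed

text \<open>Write a kernel element as s times \<open>\<iota>\<^sub>2 g\<close> with s generated by
  twists. Both it and s fold to the identity, hence g is the identity.\<close>

lemma generate_twists: "generate \<Gamma> twists = kernel_fold"
proof
  interpret A: group \<Gamma> by (rule group_amalg)
  show sub: "generate \<Gamma> twists \<subseteq> kernel_fold"
    by (rule A.generate_subgroup_incl[OF twists_subset kernel_fold_subgroup])
  show "kernel_fold \<subseteq> generate \<Gamma> twists"
  proof
    fix A assume A: "A \<in> kernel_fold"
    then have "A \<in> carrier \<Gamma>" by (simp add: kernel_fold_def stabilizer_def)
    then obtain s g where sg: "s \<in> generate \<Gamma> twists" "g \<in> carrier G" "A = s \<otimes>\<^bsub>\<Gamma>\<^esub> \<iota>\<^sub>2 g"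
      using amalg_decompose by blast
    have s: "s \<in> carrier \<Gamma>" "fold_act s \<one> = \<one>"
      using sub sg(1) by (auto simp: kernel_fold_def stabilizer_def)
    have "\<one> = fold_act A \<one>" using A by (simp add: kernel_fold_def stabilizer_def)
    also have "\<dots> = fold_act s g"
      unfolding sg(3) using act_mult[OF fold_act(1) s(1) right_closed[OF sg(2)] one_closed]
        fold_act(3)[OF sg(2) one_closed] sg(2) by simp
    finally have "g = \<one>"
      using A.act_inv(1)[OF fold_act(1) s(1) sg(2)] A.act_inv(1)[OF fold_act(1) s(1) one_closed] s(2)
      by simp
    then show "A \<in> generate \<Gamma> twists" using sg right_one s(1) by simp
  qed
qed

text \<open>A reduced word is detected by an action on its own positions: the twists act over the
  identity so that each letter moves i + 1 to i. The whole word then moves the last position to 0,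
  so if it is trivial in \<Gamma> its length must be 0.\<close>

lemma reduced_word_twists_trivial:
  assumes w: "w \<in> lists (twists \<times> UNIV)" "reduced_word w" "eval_word \<Gamma> w = \<one>\<^bsub>\<Gamma>\<^esub>"
  shows "w = []"
proof -
  interpret A: group \<Gamma> by (rule group_amalg)
  let ?n = "length w" and ?N = "{..length w}"
  define R where "R s = {(Suc i, i) |i. i < length w \<and> w ! i = (s, True)} \<union>
    {(i, Suc i) |i. i < length w \<and> w ! i = (s, False)}" for s
  have "\<exists>\<pi>. bij_betw \<pi> ?N ?N \<and> (\<forall>(a, b)\<in>R s. \<pi> a = b)" for s
  proof (rule extend_partial_bijection)
    show "R s \<subseteq> ?N \<times> ?N" by (auto simp: R_def)
  qed (use reduced_word_step_relation[OF w(2), of s] in \<open>simp_all only: R_def finite_atMost\<close>)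
  then have "\<exists>\<pi>. \<forall>s. bij_betw (\<pi> s) ?N ?N \<and> (\<forall>(a, b)\<in>R s. \<pi> s a = b)" by (intro choice allI)
  then obtain \<pi> where \<pi>': "\<forall>s. bij_betw (\<pi> s) ?N ?N \<and> (\<forall>(a, b)\<in>R s. \<pi> s a = b)" by (elim exE)
  have \<pi>: "bij_betw (\<pi> s) ?N ?N" "(a, b) \<in> R s \<Longrightarrow> \<pi> s a = b" for s a b
    using \<pi>'[rule_format, of s] by auto
  define \<delta> where "\<delta> g = (if g \<in> U then id else \<pi> (\<tau> g))" for g
  have "\<exists>\<gamma>\<in>actions \<Gamma> (carrier G \<times> ?N).
    (\<forall>g\<in>carrier G. \<forall>h\<in>carrier G. \<forall>y\<in>?N. \<gamma> (\<iota>\<^sub>1 g) (h, y) = (g \<otimes> h, y)) \<and>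
    (\<forall>g\<in>carrier G. \<forall>y\<in>?N. \<gamma> (\<tau> g) (\<one>, y) = (\<one>, \<delta> g y))"
  proof (rule exists_prescribed_action)
    show "bij_betw (\<delta> g) ?N ?N" for g using \<pi>(1) by (simp add: \<delta>_def)
    show "\<delta> (g \<otimes> u) y = \<delta> g y" if "g \<in> carrier G" "u \<in> U" for g u y
      using mult_mem_U_cong[OF that] twist_mult[OF that] by (simp add: \<delta>_def)
    show "\<delta> \<one> y = y" for y using subgroup.one_closed[OF U] by (simp add: \<delta>_def)
  qed
  then obtain \<gamma> where \<gamma>: "\<gamma> \<in> actions \<Gamma> (carrier G \<times> ?N)"
    "\<And>g y. g \<in> carrier G \<Longrightarrow> y \<in> ?N \<Longrightarrow> \<gamma> (\<tau> g) (\<one>, y) = (\<one>, \<delta> g y)"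
    by blast
  have gs: "\<gamma> s (\<one>, y) = (\<one>, \<pi> s y)" if s: "s \<in> twists" "y \<in> ?N" for s y
  proof -
    obtain g where "g \<in> carrier G" "g \<notin> U" "s = \<tau> g" using s(1) by (auto simp: twists_def)
    then show ?thesis using \<gamma>(2)[of g y] s(2) by (simp add: \<delta>_def)
  qed
  have mem: "fst (w ! i) \<in> twists" if "i < ?n" for i
  proof -
    have "w ! i \<in> set w" using that by simp
    then show ?thesis using w(1) by (auto simp: in_lists_conv_set)
  qed
  \<comment> \<open>Downward induction from the empty suffix: prefixing the letter at i moves the
    position from i + 1 to i.\<close>
  have "\<gamma> (eval_word \<Gamma> (drop i w)) (\<one>, ?n) = (\<one>, i)" if "i \<le> ?n" for i
    using that
  proof (induction i rule: inc_induct)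
    case base
    then show ?case using act_one[OF \<gamma>(1)] by simp
  next
    case (step i)
    obtain s b where sb: "w ! i = (s, b)" by (cases "w ! i")
    have s: "s \<in> twists" "s \<in> carrier \<Gamma>" using mem[of i] step.hyps sb twists_carrier by auto
    have d: "drop i w = (s, b) # drop (Suc i) w"
      using Cons_nth_drop_Suc[of i w] step.hyps sb by simp
    have ev: "eval_word \<Gamma> (drop (Suc i) w) \<in> carrier \<Gamma>"
      using w(1) by (intro A.eval_word_closed[OF twists_carrier]) (auto simp: in_lists_conv_set dest: in_set_dropD)
    have iN: "(\<one>, i) \<in> carrier G \<times> ?N" "(\<one>, ?n) \<in> carrier G \<times> ?N" using step.hyps by auto
    show ?case
    proof (cases b)
      case True
      then have "(Suc i, i) \<in> R s" using sb step.hyps by (simp add: R_def)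
      then have "\<gamma> s (\<one>, Suc i) = (\<one>, i)" using gs[OF s(1), of "Suc i"] \<pi>(2) step.hyps by simp
      then show ?thesis
        using act_mult[OF \<gamma>(1) s(2) ev iN(2)] step.IH True by (simp add: d)
    next
      case False
      then have "(i, Suc i) \<in> R s" using sb step.hyps by (simp add: R_def)
      then have "\<gamma> s (\<one>, i) = (\<one>, Suc i)" using gs[OF s(1), of i] \<pi>(2) step.hyps by simp
      then have "\<gamma> (inv\<^bsub>\<Gamma>\<^esub> s) (\<one>, Suc i) = (\<one>, i)" using A.act_inv(1)[OF \<gamma>(1) s(2) iN(1)] by simp
      then show ?thesis
        using act_mult[OF \<gamma>(1) A.inv_closed[OF s(2)] ev iN(2)] step.IH False by (simp add: d)
    qed
  qed
  from this[of 0] have "\<gamma> \<one>\<^bsub>\<Gamma>\<^esub> (\<one>, ?n) = (\<one>, 0)" using w(3) by simp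
  then show ?thesis using act_one[OF \<gamma>(1), of "(\<one>, ?n)"] by simp
qed

lemma free_basis_twists: "free_basis (\<Gamma>\<lparr>carrier := kernel_fold\<rparr>) twists"
proof -
  interpret A: group \<Gamma> by (rule group_amalg)
  have "eval_word (\<Gamma>\<lparr>carrier := kernel_fold\<rparr>) w = eval_word \<Gamma> w" if "w \<in> lists (twists \<times> UNIV)" for w
    using that
  proof (induction w)
    case (Cons l w)
    obtain s b where l: "l = (s, b)" by (cases l)
    then have "s \<in> kernel_fold" using Cons twists_subset by auto
    then show ?case
      using Cons A.m_inv_consistent[OF kernel_fold_subgroup, of s]
      by (cases b) (simp_all add: eval_word_def l)
  qed (simp add: eval_word_def)
  then show ?thesis
    using twists_subset generate_twists reduced_word_twists_trivial
      A.generate_consistent[OF twists_subset kernel_fold_subgroup]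
    by (auto simp: free_basis_def)
qed

text \<open>Let the twists of elements outside \<open>U\<close> rotate N points cyclically; together
  with left translation by the first copy this is transitive on |G| N points. Infinitely many
  indices thus occur, which settles the case -\<chi>(\<Gamma>) = 0.\<close>

lemma card_subgroups_of_index_ge_one:
  assumes fin: "finite (carrier G)" and proper: "U \<noteq> carrier G" and N: "N \<ge> 1"
  shows "card (subgroups_of_index \<Gamma> (card (carrier G) * N)) \<ge> 1"
proof -
  interpret A: group \<Gamma> by (rule group_amalg)
  let ?E = "carrier G \<times> {..<N}"
  obtain g0 where g0: "g0 \<in> carrier G" "g0 \<notin> U" using proper subgroup.subset[OF U] by blast
  define rot where "rot i = (if Suc i = N then 0 else Suc i)" for i
  have rot: "bij_betw rot {..<N} {..<N}"
  proof -
    have "inj_on rot {..<N}" by (auto simp: inj_on_def rot_def split: if_splits)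
    moreover have "rot ` {..<N} \<subseteq> {..<N}" using N by (auto simp: rot_def)
    ultimately show ?thesis by (simp add: bij_betw_def endo_inj_surj)
  qed
  define \<delta> where "\<delta> g = (if g \<in> U then id else rot)" for g
  have "\<exists>\<gamma>\<in>actions \<Gamma> ?E.
    (\<forall>g\<in>carrier G. \<forall>h\<in>carrier G. \<forall>y\<in>{..<N}. \<gamma> (\<iota>\<^sub>1 g) (h, y) = (g \<otimes> h, y)) \<and>
    (\<forall>g\<in>carrier G. \<forall>y\<in>{..<N}. \<gamma> (\<tau> g) (\<one>, y) = (\<one>, \<delta> g y))"
  proof (rule exists_prescribed_action)
    show "bij_betw (\<delta> g) {..<N} {..<N}" for g using rot by (simp add: \<delta>_def)
    show "\<delta> (g \<otimes> u) y = \<delta> g y" if "g \<in> carrier G" "u \<in> U" for g u y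
      using mult_mem_U_cong[OF that] by (simp add: \<delta>_def)
    show "\<delta> \<one> y = y" for y using subgroup.one_closed[OF U] by (simp add: \<delta>_def)
  qed
  then obtain \<gamma> where \<gamma>: "\<gamma> \<in> actions \<Gamma> ?E"
    "\<And>g h y. g \<in> carrier G \<Longrightarrow> h \<in> carrier G \<Longrightarrow> y < N \<Longrightarrow> \<gamma> (\<iota>\<^sub>1 g) (h, y) = (g \<otimes> h, y)"
    "\<And>g y. g \<in> carrier G \<Longrightarrow> y < N \<Longrightarrow> \<gamma> (\<tau> g) (\<one>, y) = (\<one>, \<delta> g y)"
    by auto
  have base: "(\<one>, 0) \<in> ?E" using N by auto
  have orb1: "(\<one>, i) \<in> orbit \<Gamma> \<gamma> (\<one>, 0)" if "i < N" for i
    using that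
  proof (induction i)
    case 0
    then show ?case by (rule_tac A.orbit_self[OF \<gamma>(1) base])
  next
    case (Suc i)
    have "\<gamma> (\<tau> g0) (\<one>, i) = (\<one>, Suc i)"
      using \<gamma>(3)[OF g0(1), of i] g0(2) Suc.prems by (simp add: \<delta>_def rot_def)
    then show ?case
      using A.orbit_invariant[OF \<gamma>(1) base twist_closed[OF g0(1)] Suc.IH] Suc.prems by simp
  qed
  have orb: "orbit \<Gamma> \<gamma> (\<one>, 0) = ?E"
  proof
    show "orbit \<Gamma> \<gamma> (\<one>, 0) \<subseteq> ?E" by (rule A.orbit_subset[OF \<gamma>(1) base])
    show "?E \<subseteq> orbit \<Gamma> \<gamma> (\<one>, 0)"
    proof
      fix e assume "e \<in> ?E"
      then obtain g i where e: "e = (g, i)" "g \<in> carrier G" "i < N" by auto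
      have "\<gamma> (\<iota>\<^sub>1 g) (\<one>, i) = e" using \<gamma>(2)[OF e(2) one_closed e(3)] e by simp
      then show "e \<in> orbit \<Gamma> \<gamma> (\<one>, 0)"
        using A.orbit_invariant[OF \<gamma>(1) base left_closed[OF e(2)] orb1[OF e(3)]] by simp
    qed
  qed
  have "\<gamma> \<in> A.transitive_actions ?E"
    using \<gamma>(1) A.orbit_eq[OF \<gamma>(1) base] orb by (auto simp: A.transitive_actions_def)
  moreover have finE: "finite ?E" using fin by simp
  have finA: "finite (actions \<Gamma> ?E)" by (rule finite_actions_amalg[OF fin finE])
  have "finite (A.transitive_actions ?E)"
    using finA by (rule rev_finite_subset) (auto simp: A.transitive_actions_def)
  ultimately have "card (A.transitive_actions ?E) > 0" by (auto simp: card_gt_0_iff)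
  moreover have "?E \<noteq> {}" using base by blast
  moreover have "card ?E > 0" using finE base by (auto simp: card_gt_0_iff)
  ultimately have "card (subgroups_of_index \<Gamma> (card ?E)) > 0"
    using A.card_transitive_actions(2)[OF finE _ finA] by (metis mult_is_0 neq0_conv)
  then show ?thesis by (simp add: card_cartesian_product)
qed

end

section \<open>Free bases and homomorphisms modulo 2\<close>

definition letter_act :: "('s \<Rightarrow> 'e \<Rightarrow> 'e) \<Rightarrow> 'e set \<Rightarrow> ('s \<times> bool) list \<Rightarrow> 'e \<Rightarrow> 'e" where
  "letter_act f E w = foldr (\<lambda>(s, b). if b then f s else inv_into E (f s)) w"

lemma letter_act_simps [simp]:
  "letter_act f E [] e = e"
  "letter_act f E ((s, True) # w) e = f s (letter_act f E w e)"
  "letter_act f E ((s, False) # w) e = inv_into E (f s) (letter_act f E w e)"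
  "letter_act f E (v @ w) e = letter_act f E v (letter_act f E w e)"
  by (simp_all add: letter_act_def)

definition inverse_word :: "('s \<times> bool) list \<Rightarrow> ('s \<times> bool) list" where
  "inverse_word w = rev (map (\<lambda>(s, b). (s, \<not> b)) w)"

lemma not_reduced_wordD:
  assumes "\<not> reduced_word w"
  shows "\<exists>u s b v. w = u @ [(s, b), (s, \<not> b)] @ v"
proof -
  obtain i where i: "Suc i < length w" "fst (w ! i) = fst (w ! Suc i)" "snd (w ! i) \<noteq> snd (w ! Suc i)"
    using assms by (auto simp: reduced_word_def)
  obtain s b where sb: "w ! i = (s, b)" by (cases "w ! i")
  have sb': "w ! Suc i = (s, \<not> b)" using i sb by (cases "w ! Suc i") auto
  have "w = take i w @ w ! i # w ! Suc i # drop (Suc (Suc i)) w"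
    using i(1) by (metis Cons_nth_drop_Suc Suc_lessD append_take_drop_id)
  then show ?thesis using sb sb' by (metis append_Cons append_Nil)
qed

context group
begin

lemma eval_word_append:
  assumes "S \<subseteq> carrier G" "v \<in> lists (S \<times> UNIV)" "w \<in> lists (S \<times> UNIV)"
  shows "eval_word G (v @ w) = eval_word G v \<otimes> eval_word G w"
  using assms(2)
proof (induction v rule: list.induct)
  case Nil
  then show ?case using eval_word_closed[OF assms(1,3)] by simp
next
  case (Cons l v)
  obtain s b where l: "l = (s, b)" by (cases l)
  have "s \<in> carrier G" using Cons.prems l assms(1) by auto
  then show ?case
    using Cons eval_word_closed[OF assms(1,3)] eval_word_closed[OF assms(1), of v] l
    by (cases b) (auto simp: m_assoc)
qed

lemma inverse_word_lists: "w \<in> lists (S \<times> UNIV) \<Longrightarrow> inverse_word w \<in> lists (S \<times> UNIV)"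
  by (auto simp: inverse_word_def in_lists_conv_set)

lemma eval_inverse_word:
  assumes S: "S \<subseteq> carrier G" and w: "w \<in> lists (S \<times> UNIV)"
  shows "eval_word G (inverse_word w) = inv (eval_word G w)"
  using w
proof (induction w rule: list.induct)
  case Nil
  then show ?case by (simp add: inverse_word_def)
next
  case (Cons l w)
  obtain s b where l: "l = (s, b)" by (cases l)
  have s: "s \<in> S" "s \<in> carrier G" and w: "w \<in> lists (S \<times> UNIV)" using Cons.prems l S by auto
  have "inverse_word (l # w) = inverse_word w @ [(s, \<not> b)]" by (simp add: inverse_word_def l)
  then have "eval_word G (inverse_word (l # w)) = inv (eval_word G w) \<otimes> eval_word G [(s, \<not> b)]"
    using eval_word_append[OF S inverse_word_lists[OF w], of "[(s, \<not> b)]"] s Cons.IH[OF w] by simp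
  then show ?case
    using s eval_word_closed[OF S w] l by (cases b) (simp_all add: inv_mult_group)
qed

lemma ex_word:
  assumes "S \<subseteq> carrier G" "g \<in> generate G S"
  shows "\<exists>w\<in>lists (S \<times> UNIV). eval_word G w = g"
  using assms(2)
proof (induction g rule: generate.induct)
  case one
  then show ?case by (intro bexI[of _ "[]"]) auto
next
  case (incl s)
  then show ?case using assms(1) by (intro bexI[of _ "[(s, True)]"]) auto
next
  case (inv s)
  then show ?case using assms(1) by (intro bexI[of _ "[(s, False)]"]) auto
next
  case (eng g h)
  then obtain v w where "v \<in> lists (S \<times> UNIV)" "eval_word G v = g"
    "w \<in> lists (S \<times> UNIV)" "eval_word G w = h" by blast
  then show ?case using eval_word_append[OF assms(1)] by (intro bexI[of _ "v @ w"]) auto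
qed

lemma letter_act_closed:
  assumes "\<And>s. s \<in> S \<Longrightarrow> bij_betw (f s) E E" "w \<in> lists (S \<times> UNIV)" "e \<in> E"
  shows "letter_act f E w e \<in> E"
  using assms(2)
proof (induction w)
  case (Cons l w)
  obtain s b where l: "l = (s, b)" by (cases l)
  have s: "s \<in> S" "letter_act f E w e \<in> E" using Cons l by auto
  then show ?case
    using bij_betwE[OF assms(1)[OF s(1)]] bij_betwE[OF bij_betw_inv_into[OF assms(1)[OF s(1)]]] l
    by (cases b) auto
qed (use assms(3) in simp)

text \<open>A nonempty trivial word is not reduced, because the basis is free. Deleting an adjacent
  cancelling pair changes neither its value nor its effect, so induction on the length
  applies.\<close>

lemma letter_act_trivial:
  assumes basis: "free_basis G S" and bij: "\<And>s. s \<in> S \<Longrightarrow> bij_betw (f s) E E"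
    and w: "w \<in> lists (S \<times> UNIV)" "eval_word G w = \<one>" and e: "e \<in> E"
  shows "letter_act f E w e = e"
  using w
proof (induction "length w" arbitrary: w rule: less_induct)
  case less
  have S: "S \<subseteq> carrier G" using basis by (simp add: free_basis_def)
  show ?case
  proof (cases "reduced_word w")
    case True
    then have "w = []" using basis less.prems by (auto simp: free_basis_def)
    then show ?thesis by simp
  next
    case False
    then obtain u s b v where w: "w = u @ [(s, b), (s, \<not> b)] @ v" using not_reduced_wordD by blast
    have l: "u \<in> lists (S \<times> UNIV)" "v \<in> lists (S \<times> UNIV)" "s \<in> S" "[(s, b), (s, \<not> b)] \<in> lists (S \<times> UNIV)"
      using less.prems(1) w by auto
    have sc: "s \<in> carrier G" using l(3) S by blast
    have pair: "eval_word G ([(s, b), (s, \<not> b)] @ v) = eval_word G v"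
      using sc eval_word_closed[OF S l(2)] by (cases b) (simp_all add: inv_mult_cancel)
    have "eval_word G (u @ v) = \<one>"
      using less.prems(2) eval_word_append[OF S l(1)] l pair w by (metis append_in_lists_conv)
    then have "letter_act f E (u @ v) e = e"
      using w l by (intro less.hyps) auto
    moreover have "letter_act f E ([(s, b), (s, \<not> b)] @ v) e = letter_act f E v e"
      using bij_betw_inv_into_left[OF bij[OF l(3)]] bij_betw_inv_into_right[OF bij[OF l(3)]]
        letter_act_closed[OF bij l(2) e] by (cases b) simp_all
    ultimately show ?thesis by (simp only: w letter_act_simps(4))
  qed
qed

text \<open>Both v w^-1 and w^-1 w represent the identity and therefore act trivially.\<close>

lemma letter_act_eq:
  assumes basis: "free_basis G S" and bij: "\<And>s. s \<in> S \<Longrightarrow> bij_betw (f s) E E"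
    and w: "v \<in> lists (S \<times> UNIV)" "w \<in> lists (S \<times> UNIV)" "eval_word G v = eval_word G w" and e: "e \<in> E"
  shows "letter_act f E v e = letter_act f E w e"
proof -
  have S: "S \<subseteq> carrier G" using basis by (simp add: free_basis_def)
  note cl = eval_word_closed[OF S w(1)] eval_word_closed[OF S w(2)]
  note iw = inverse_word_lists[OF w(2)]
  have 1: "eval_word G (v @ inverse_word w) = \<one>" "eval_word G (inverse_word w @ w) = \<one>"
    using eval_word_append[OF S w(1) iw] eval_word_append[OF S iw w(2)] eval_inverse_word[OF S w(2)]
      w(3) cl by auto
  have "letter_act f E (v @ inverse_word w) (letter_act f E w e) = letter_act f E w e"
    by (rule letter_act_trivial[OF basis bij _ 1(1) letter_act_closed[OF bij w(2) e]])
      (use w iw in auto)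
  moreover have "letter_act f E (inverse_word w @ w) e = e"
    by (rule letter_act_trivial[OF basis bij _ 1(2) e]) (use w iw in auto)
  ultimately show ?thesis by simp
qed

text \<open>The universal property of a free basis, in terms of actions: g acts through any word
  representing it, and \<open>letter_act_eq\<close> makes the choice irrelevant.\<close>

lemma free_basis_extends:
  assumes basis: "free_basis G S" and bij: "\<And>s. s \<in> S \<Longrightarrow> bij_betw (f s) E E"
  shows "\<exists>\<gamma>\<in>actions G E. \<forall>s\<in>S. \<forall>e\<in>E. \<gamma> s e = f s e"
proof -
  have S: "S \<subseteq> carrier G" and gen: "generate G S = carrier G"
    using basis by (auto simp: free_basis_def)
  define wd where "wd g = (SOME w. w \<in> lists (S \<times> UNIV) \<and> eval_word G w = g)" for g
  have wd: "wd g \<in> lists (S \<times> UNIV)" "eval_word G (wd g) = g" if "g \<in> carrier G" for g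
    using someI_ex[of "\<lambda>w. w \<in> lists (S \<times> UNIV) \<and> eval_word G w = g"] ex_word[OF S, of g] that gen
    unfolding wd_def by auto
  let ?\<gamma> = "restrict_act G E (\<lambda>g. letter_act f E (wd g))"
  have "?\<gamma> \<in> actions G E"
  proof (rule restrict_act_in_actions)
    show "letter_act f E (wd g) e \<in> E" if "g \<in> carrier G" "e \<in> E" for g e
      by (rule letter_act_closed[OF bij wd(1)[OF that(1)] that(2)])
    show "letter_act f E (wd \<one>) e = e" if "e \<in> E" for e
      by (rule letter_act_trivial[OF basis bij wd[OF one_closed] that])
    show "letter_act f E (wd (g \<otimes> h)) e = letter_act f E (wd g) (letter_act f E (wd h) e)"
      if "g \<in> carrier G" "h \<in> carrier G" "e \<in> E" for g h e
    proof -
      have "letter_act f E (wd (g \<otimes> h)) e = letter_act f E (wd g @ wd h) e"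
        using wd[OF that(1)] wd[OF that(2)] wd[OF m_closed[OF that(1,2)]] that(3)
          eval_word_append[OF S wd(1)[OF that(1)] wd(1)[OF that(2)]]
        by (intro letter_act_eq[OF basis bij]) auto
      then show ?thesis by simp
    qed
  qed
  moreover have "?\<gamma> s e = f s e" if "s \<in> S" "e \<in> E" for s e
  proof -
    have s: "s \<in> carrier G" using that S by blast
    have "letter_act f E (wd s) e = letter_act f E [(s, True)] e"
      using wd[OF s] that s by (intro letter_act_eq[OF basis bij]) auto
    then show ?thesis using s that by simp
  qed
  ultimately show ?thesis by blast
qed

(* Z/2-valued functions on the group that are equivariant under a homomorphism L -> Z/2:
   counting them over cosets of L, and over the edges of the Schreier graph of a free basis,
   computes |Hom(L, Z/2)| in terms of the rank. *)
definition quasi_homs :: "'a set \<Rightarrow> ('a \<Rightarrow> bool) set" where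
  "quasi_homs L = {w \<in> carrier G \<rightarrow>\<^sub>E UNIV. \<forall>l\<in>L. \<forall>g\<in>carrier G. w (l \<otimes> g) = (w l \<noteq> w g)}"

text \<open>\<open>bool\<close> plays the role of Z/2, with inequality as addition.\<close>

definition homs_mod_2 :: "'a set \<Rightarrow> ('a \<Rightarrow> bool) set" where
  "homs_mod_2 L = {\<phi> \<in> L \<rightarrow>\<^sub>E UNIV. \<forall>a\<in>L. \<forall>b\<in>L. \<phi> (a \<otimes> b) = (\<phi> a \<noteq> \<phi> b)}"

text \<open>Once its homomorphism on \<open>L\<close> is chosen, an equivariant function is free on
  one representative of each nontrivial coset. On the coset \<open>L\<close> the representative is
  the identity, where the value is forced to be \<open>False\<close>; hence that coset is
  excluded.\<close>

lemma bij_betw_quasi_homs_homs: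
  assumes L: "subgroup L G"
  shows "\<exists>\<rho>. bij_betw (\<lambda>w. (restrict w L, \<lambda>C\<in>rcosets L - {L}. w (\<rho> C)))
    (quasi_homs L) (homs_mod_2 L \<times> (rcosets L - {L} \<rightarrow>\<^sub>E UNIV))"
proof -
  note sub = subgroup.subset[OF L]
  define \<rho> where "\<rho> C = (if C = L then \<one> else SOME g. g \<in> C)" for C
  have \<rho>: "\<rho> (L #> g) \<in> carrier G" "g \<otimes> inv (\<rho> (L #> g)) \<in> L" "L #> \<rho> (L #> g) = L #> g"
    if g: "g \<in> carrier G" for g
  proof -
    have "\<rho> (L #> g) \<in> L #> g"
    proof (cases "L #> g = L")
      case True
      then show ?thesis using subgroup.one_closed[OF L] by (simp add: \<rho>_def)
    next
      case False
      then show ?thesis using rcos_self[OF g L] by (auto simp: \<rho>_def intro: someI)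
    qed
    then show c: "\<rho> (L #> g) \<in> carrier G" and e: "L #> \<rho> (L #> g) = L #> g"
      using g L r_coset_subset_G[OF sub g] repr_independence[OF _ g L] by auto
    show "g \<otimes> inv (\<rho> (L #> g)) \<in> L" using rcos_eq_iff[OF L g c] e by simp
  qed
  let ?f = "\<lambda>w. (restrict w L, \<lambda>C\<in>rcosets L - {L}. w (\<rho> C))"
  let ?T = "homs_mod_2 L \<times> (rcosets L - {L} \<rightarrow>\<^sub>E (UNIV :: bool set))"
  let ?i = "\<lambda>(\<phi>, a). \<lambda>g\<in>carrier G. \<phi> (g \<otimes> inv (\<rho> (L #> g))) \<noteq> (L #> g \<noteq> L \<and> a (L #> g))"
  have LL: "L #> l = L" if "l \<in> L" for l
    using coset_join2[OF _ L that] sub that by blast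
  have "bij_betw ?f (quasi_homs L) ?T"
  proof (rule bij_betw_byWitness[where f' = ?i])
    show "\<forall>w\<in>quasi_homs L. ?i (?f w) = w"
    proof
      fix w assume w: "w \<in> quasi_homs L"
      have "w g = (w (g \<otimes> inv (\<rho> (L #> g))) \<noteq> w (\<rho> (L #> g)))" if g: "g \<in> carrier G" for g
      proof -
        have "w ((g \<otimes> inv (\<rho> (L #> g))) \<otimes> \<rho> (L #> g)) =
            (w (g \<otimes> inv (\<rho> (L #> g))) \<noteq> w (\<rho> (L #> g)))"
          using w \<rho>(1,2)[OF g] by (simp add: quasi_homs_def)
        then show ?thesis using g \<rho>(1)[OF g] by (simp add: m_assoc)
      qed
      moreover have "\<not> w (\<rho> L)"
      proof -
        have "w (\<one> \<otimes> \<one>) = (w \<one> \<noteq> w \<one>)"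
          using w subgroup.one_closed[OF L] one_closed unfolding quasi_homs_def by blast
        then show ?thesis by (simp add: \<rho>_def)
      qed
      ultimately have "?i (?f w) g = w g" if "g \<in> carrier G" for g
        using that \<rho>(2)[OF that] rcosetsI[OF sub that] by auto
      moreover have "w \<in> extensional (carrier G)" using w by (auto simp: quasi_homs_def PiE_iff)
      ultimately show "?i (?f w) = w" by (intro extensionalityI[of _ "carrier G"]) auto
    qed
    show "\<forall>z\<in>?T. ?f (?i z) = z"
    proof
      fix z assume "z \<in> ?T"
      then obtain \<phi> a where z: "z = (\<phi>, a)" "\<phi> \<in> homs_mod_2 L" "a \<in> rcosets L - {L} \<rightarrow>\<^sub>E UNIV" by auto
      have \<phi>1: "\<not> \<phi> \<one>"
      proof -
        have "\<phi> (\<one> \<otimes> \<one>) = (\<phi> \<one> \<noteq> \<phi> \<one>)"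
          using z(2) subgroup.one_closed[OF L] unfolding homs_mod_2_def by blast
        then show ?thesis by simp
      qed
      have 1: "restrict (?i (\<phi>, a)) L = \<phi>"
      proof (rule extensionalityI[of _ L])
        fix l assume l: "l \<in> L"
        then have "l \<in> carrier G" using sub by blast
        then show "restrict (?i (\<phi>, a)) L l = \<phi> l" using l LL[OF l] by (simp add: \<rho>_def)
      qed (use z(2) in \<open>auto simp: homs_mod_2_def PiE_iff\<close>)
      have 2: "(\<lambda>C\<in>rcosets L - {L}. ?i (\<phi>, a) (\<rho> C)) = a"
      proof (rule extensionalityI[of _ "rcosets L - {L}"])
        fix C assume C: "C \<in> rcosets L - {L}"
        then obtain g where g: "g \<in> carrier G" "C = L #> g" by (auto simp: RCOSETS_def)
        have "?i (\<phi>, a) (\<rho> C) = a C"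
          using \<rho>[OF g(1)] g C \<phi>1 by simp
        then show "(\<lambda>C\<in>rcosets L - {L}. ?i (\<phi>, a) (\<rho> C)) C = a C" using C by simp
      qed (use z(3) in \<open>auto simp: PiE_iff\<close>)
      show "?f (?i z) = z" unfolding z(1) using 1 2 by simp
    qed
    show "?f ` quasi_homs L \<subseteq> ?T"
      using sub by (auto simp: quasi_homs_def homs_mod_2_def subset_iff subgroup.m_closed[OF L])
    show "?i ` ?T \<subseteq> quasi_homs L"
    proof (rule image_subsetI)
      fix z assume "z \<in> ?T"
      then obtain \<phi> a where z: "z = (\<phi>, a)" "\<phi> \<in> homs_mod_2 L" by auto
      have "?i (\<phi>, a) (l \<otimes> g) = (?i (\<phi>, a) l \<noteq> ?i (\<phi>, a) g)" if l: "l \<in> L" and g: "g \<in> carrier G" for l g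
      proof -
        have lc: "l \<in> carrier G" using l sub by blast
        have Lg: "L #> (l \<otimes> g) = L #> g"
          using LL[OF l] coset_mult_assoc[OF sub lc g] by simp
        have "\<phi> (l \<otimes> (g \<otimes> inv (\<rho> (L #> g)))) = (\<phi> l \<noteq> \<phi> (g \<otimes> inv (\<rho> (L #> g))))"
          using z(2) l \<rho>(2)[OF g] by (simp add: homs_mod_2_def)
        then show ?thesis
          using lc g Lg LL[OF l] \<rho>(1)[OF g] by (simp add: m_assoc) (auto simp: \<rho>_def)
      qed
      then show "?i z \<in> quasi_homs L" unfolding z(1) quasi_homs_def by auto
    qed
  qed
  then show ?thesis by blast
qed

text \<open>The label of the edge from C to C s in the Schreier graph is the change of w along it,
  well defined because w is equivariant under \<open>L\<close>. Labels determine w since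
  \<open>S\<close> generates and w is \<open>False\<close> at the identity. Conversely, freeness
  realizes every labelling: it defines a double cover on which the group acts, and w records the
  sheet reached from the base point.\<close>

lemma bij_betw_quasi_homs_free:
  assumes basis: "free_basis G S" and L: "subgroup L G"
  shows "\<exists>\<rho>. bij_betw (\<lambda>w. \<lambda>(s, C)\<in>S \<times> (rcosets L). w (\<rho> C \<otimes> s) \<noteq> w (\<rho> C))
    (quasi_homs L) (S \<times> (rcosets L) \<rightarrow>\<^sub>E UNIV)"
proof -
  have S: "S \<subseteq> carrier G" and gen: "generate G S = carrier G"
    using basis by (auto simp: free_basis_def)
  note sub = subgroup.subset[OF L]
  define \<rho> where "\<rho> C = (SOME g. g \<in> C)" for C :: "'a set"
  have \<rho>: "\<rho> C \<in> carrier G" "L #> \<rho> C = C" if C: "C \<in> rcosets L" for C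
  proof -
    obtain g where g: "g \<in> carrier G" "C = L #> g" using C by (auto simp: RCOSETS_def)
    have "\<rho> C \<in> C" unfolding \<rho>_def g(2) using rcos_self[OF g(1) L] by (rule someI)
    then show "\<rho> C \<in> carrier G" "L #> \<rho> C = C"
      using g L r_coset_subset_G[OF sub g(1)] repr_independence[OF _ g(1) L] by auto
  qed
  let ?f = "\<lambda>w. \<lambda>(s, C)\<in>S \<times> (rcosets L). w (\<rho> C \<otimes> s) \<noteq> w (\<rho> C)"
  have diff: "(w (g \<otimes> s) \<noteq> w g) = (w (\<rho> (L #> g) \<otimes> s) \<noteq> w (\<rho> (L #> g)))"
    if w: "w \<in> quasi_homs L" and g: "g \<in> carrier G" and s: "s \<in> carrier G" for w g s
  proof -
    let ?r = "\<rho> (L #> g)"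
    have r: "?r \<in> carrier G" "L #> ?r = L #> g" using \<rho>[OF rcosetsI[OF sub g]] by auto
    define l where "l = g \<otimes> inv ?r"
    have l: "l \<in> L" unfolding l_def using rcos_eq_iff[OF L g r(1)] r(2) by simp
    have lc: "l \<in> carrier G" using l sub by blast
    have gl: "g = l \<otimes> ?r" using g r(1) by (simp add: l_def m_assoc)
    have wl: "w (l \<otimes> h) = (w l \<noteq> w h)" if "h \<in> carrier G" for h
      using w l that by (simp add: quasi_homs_def)
    have "w g = (w l \<noteq> w ?r)" using wl[OF r(1)] gl by simp
    moreover have "w (g \<otimes> s) = (w l \<noteq> w (?r \<otimes> s))"
      using wl[of "?r \<otimes> s"] gl r(1) s lc by (simp add: m_assoc[symmetric])
    ultimately show ?thesis by auto
  qed
  have "inj_on ?f (quasi_homs L)"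
  proof (rule inj_onI)
    fix w w' assume w: "w \<in> quasi_homs L" "w' \<in> quasi_homs L" and eq: "?f w = ?f w'"
    have step: "(w (g \<otimes> s) = w g) = (w' (g \<otimes> s) = w' g)" if g: "g \<in> carrier G" and s: "s \<in> S" for g s
    proof -
      have "?f w (s, L #> g) = ?f w' (s, L #> g)" using eq by simp
      then have "(w (\<rho> (L #> g) \<otimes> s) \<noteq> w (\<rho> (L #> g))) = (w' (\<rho> (L #> g) \<otimes> s) \<noteq> w' (\<rho> (L #> g)))"
        using s rcosetsI[OF sub g] by simp
      then show ?thesis using diff[OF w(1) g, of s] diff[OF w(2) g, of s] s S by blast
    qed
    have w1: "\<not> v \<one>" if "v \<in> quasi_homs L" for v
    proof -
      have "v (\<one> \<otimes> \<one>) = (v \<one> \<noteq> v \<one>)"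
        using that subgroup.one_closed[OF L] one_closed unfolding quasi_homs_def by blast
      then show ?thesis by simp
    qed
    have "\<forall>h\<in>carrier G. (w (h \<otimes> g) = w h) = (w' (h \<otimes> g) = w' h)" if "g \<in> generate G S" for g
      using that
    proof (induction g rule: generate.induct)
      case one
      then show ?case by simp
    next
      case (incl s)
      then show ?case using step by blast
    next
      case (inv s)
      then have s: "s \<in> carrier G" using S by blast
      have "(w (h \<otimes> inv s) = w h) = (w' (h \<otimes> inv s) = w' h)" if "h \<in> carrier G" for h
        using step[of "h \<otimes> inv s" s] inv s that by (auto simp: m_assoc)
      then show ?case by blast
    next
      case (eng a b)
      have ab: "a \<in> carrier G" "b \<in> carrier G" using eng.hyps gen by auto
      have "(w (h \<otimes> (a \<otimes> b)) = w h) = (w' (h \<otimes> (a \<otimes> b)) = w' h)" if h: "h \<in> carrier G" for h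
        using bspec[OF eng.IH(1) h] bspec[OF eng.IH(2) m_closed[OF h ab(1)]] h ab
        by (auto simp: m_assoc)
      then show ?case by blast
    qed
    then have "w g = w' g" if "g \<in> carrier G" for g
      using that w1[OF w(1)] w1[OF w(2)] gen l_one[OF that] one_closed by metis
    then show "w = w'"
      using w by (intro PiE_ext[of w "carrier G" "\<lambda>_. UNIV"]) (auto simp: quasi_homs_def)
  qed
  moreover have "?f ` quasi_homs L = S \<times> (rcosets L) \<rightarrow>\<^sub>E UNIV"
  proof (intro equalityI subsetI)
    fix \<delta> assume d: "\<delta> \<in> S \<times> (rcosets L) \<rightarrow>\<^sub>E (UNIV :: bool set)"
    let ?E = "(rcosets L) \<times> (UNIV :: bool set)"
    \<comment> \<open>The double cover: s moves a coset backwards along an s-edge, as a left action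
      on right cosets requires, and changes sheet according to the label of that edge.\<close>
    let ?t = "\<lambda>s (C, b). (C #> inv s, b \<noteq> \<delta> (s, C #> inv s))"
    have bij: "bij_betw (?t s) ?E ?E" if s: "s \<in> S" for s
    proof (rule bij_betw_byWitness[where f' = "\<lambda>(C, b). (C #> s, b \<noteq> \<delta> (s, C))"])
      have sc: "s \<in> carrier G" using s S by blast
      have c: "C #> s #> inv s = C" "C #> inv s #> s = C" if "C \<in> rcosets L" for C
        using rcosets_mult_assoc[OF L that, of s "inv s"] rcosets_mult_assoc[OF L that, of "inv s" s]
          rcosets_mult_one[OF L that] sc by auto
      show "\<forall>e\<in>?E. (case ?t s e of (C, b) \<Rightarrow> (C #> s, b \<noteq> \<delta> (s, C))) = e" using c by auto
      show "\<forall>e\<in>?E. ?t s (case e of (C, b) \<Rightarrow> (C #> s, b \<noteq> \<delta> (s, C))) = e" using c by auto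
      show "?t s ` ?E \<subseteq> ?E" using rcosets_mult_closed[OF L] sc by auto
      show "(\<lambda>(C, b). (C #> s, b \<noteq> \<delta> (s, C))) ` ?E \<subseteq> ?E" using rcosets_mult_closed[OF L] sc by auto
    qed
    have "\<exists>\<gamma>\<in>actions G ?E. \<forall>s\<in>S. \<forall>e\<in>?E. \<gamma> s e = ?t s e"
      by (rule free_basis_extends[OF basis bij])
    then obtain \<gamma> where g: "\<gamma> \<in> actions G ?E" and gs: "\<And>s e. s \<in> S \<Longrightarrow> e \<in> ?E \<Longrightarrow> \<gamma> s e = ?t s e"
      by blast
    \<comment> \<open>Every group element commutes with the exchange of the two sheets, so over each
      coset its effect is a single bit c.\<close>
    have cov: "\<forall>C\<in>rcosets L. \<exists>c. \<forall>b. \<gamma> h (C, b) = (C #> inv h, b \<noteq> c)" if "h \<in> generate G S" for h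
      using that
    proof (induction h rule: generate.induct)
      case one
      have "\<gamma> \<one> (C, b) = (C #> inv \<one>, b \<noteq> False)" if "C \<in> rcosets L" for C b
        using act_one[OF g, of "(C, b)"] that rcosets_mult_one[OF L that] by simp
      then show ?case by blast
    next
      case (incl s)
      then show ?case using gs by (intro ballI) auto
    next
      case (inv s)
      have s: "s \<in> carrier G" using inv S by blast
      show ?case
      proof
        fix C assume C: "C \<in> rcosets L"
        have Cs: "C #> s \<in> rcosets L" "C #> s #> inv s = C"
          using rcosets_mult_closed[OF L C s] rcosets_mult_assoc[OF L C s, of "inv s"]
            rcosets_mult_one[OF L C] s by auto
        have "\<gamma> (inv s) (C, b) = (C #> inv (inv s), b \<noteq> \<delta> (s, C))" for b
        proof -
          have "\<gamma> s (C #> s, b \<noteq> \<delta> (s, C)) = (C, b)"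
            using gs[OF inv, of "(C #> s, b \<noteq> \<delta> (s, C))"] Cs by auto
          then show ?thesis
            using act_inv(1)[OF g s, of "(C #> s, b \<noteq> \<delta> (s, C))"] Cs s by simp
        qed
        then show "\<exists>c. \<forall>b. \<gamma> (inv s) (C, b) = (C #> inv (inv s), b \<noteq> c)" by blast
      qed
    next
      case (eng h k)
      have hk: "h \<in> carrier G" "k \<in> carrier G" using eng.hyps gen by auto
      show ?case
      proof
        fix C assume C: "C \<in> rcosets L"
        obtain c where c: "\<And>b. \<gamma> k (C, b) = (C #> inv k, b \<noteq> c)" using eng.IH(2) C by blast
        have Ck: "C #> inv k \<in> rcosets L" using rcosets_mult_closed[OF L C] hk by simp
        obtain c' where c': "\<And>b. \<gamma> h (C #> inv k, b) = (C #> inv k #> inv h, b \<noteq> c')"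
          using eng.IH(1) Ck by blast
        have "\<gamma> (h \<otimes> k) (C, b) = (C #> inv (h \<otimes> k), b \<noteq> (c \<noteq> c'))" for b
          using act_mult[OF g hk, of "(C, b)"] C c c' rcosets_mult_assoc[OF L C, of "inv k" "inv h"] hk
          by (auto simp: inv_mult_group)
        then show "\<exists>c. \<forall>b. \<gamma> (h \<otimes> k) (C, b) = (C #> inv (h \<otimes> k), b \<noteq> c)" by blast
      qed
    qed
    have LL: "L \<in> rcosets L" by (rule subgroup.subgroup_in_rcosets[OF L is_group])
    define w where "w = (\<lambda>g\<in>carrier G. snd (\<gamma> (inv g) (L, False)))"
    have cov': "\<exists>c. \<forall>b. \<gamma> (inv h) (C, b) = (C #> h, b \<noteq> c)" if "h \<in> carrier G" "C \<in> rcosets L" for h C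
      using cov[of "inv h"] that gen by auto
    have wL: "\<gamma> (inv h) (L, b) = (L #> h, b \<noteq> w h)" if h: "h \<in> carrier G" for h b
    proof -
      obtain c where "\<And>b. \<gamma> (inv h) (L, b) = (L #> h, b \<noteq> c)" using cov'[OF h LL] by blast
      then show ?thesis using h by (simp add: w_def)
    qed
    have mult: "\<gamma> (inv (h \<otimes> k)) (L, b) = \<gamma> (inv k) (L #> h, b \<noteq> w h)"
      if "h \<in> carrier G" "k \<in> carrier G" for h k b
      using act_mult[OF g, of "inv k" "inv h" "(L, b)"] that LL wL[OF that(1), of b]
      by (simp add: inv_mult_group)
    have w: "w \<in> quasi_homs L"
    proof -
      have "w (l \<otimes> h) = (w l \<noteq> w h)" if l: "l \<in> L" and h: "h \<in> carrier G" for l h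
      proof -
        have lc: "l \<in> carrier G" using l sub by blast
        have "L #> l = L" using coset_join2[OF lc L l] .
        then have "(L #> (l \<otimes> h), False \<noteq> w (l \<otimes> h)) = (L #> h, (False \<noteq> w l) \<noteq> w h)"
          using mult[OF lc h, of False] wL[OF m_closed[OF lc h], of False] wL[OF h, of "False \<noteq> w l"]
          by simp
        then show ?thesis by simp
      qed
      moreover have "w \<in> carrier G \<rightarrow>\<^sub>E UNIV" by (auto simp: w_def)
      ultimately show ?thesis by (simp add: quasi_homs_def)
    qed
    have ws: "(w (h \<otimes> s) \<noteq> w h) = \<delta> (s, L #> h)" if h: "h \<in> carrier G" and s: "s \<in> S" for h s
    proof -
      have sc: "s \<in> carrier G" using s S by blast
      have Lh: "L #> h \<in> rcosets L" by (rule rcosetsI[OF sub h])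
      have Ls: "L #> h #> s \<in> rcosets L" "L #> h #> s #> inv s = L #> h"
        using rcosets_mult_closed[OF L Lh sc] rcosets_mult_assoc[OF L Lh sc, of "inv s"]
          rcosets_mult_one[OF L Lh] sc by auto
      have "\<gamma> s (L #> h #> s, w h \<noteq> \<delta> (s, L #> h)) = (L #> h, w h)"
        using gs[OF s, of "(L #> h #> s, w h \<noteq> \<delta> (s, L #> h))"] Ls by auto
      then have "\<gamma> (inv s) (L #> h, w h) = (L #> h #> s, w h \<noteq> \<delta> (s, L #> h))"
        using act_inv(1)[OF g sc, of "(L #> h #> s, w h \<noteq> \<delta> (s, L #> h))"] Ls by simp
      then have "w (h \<otimes> s) = (w h \<noteq> \<delta> (s, L #> h))"
        using mult[OF h sc, of False] wL[OF m_closed[OF h sc], of False] by simp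
      then show ?thesis by auto
    qed
    have "?f w = \<delta>"
    proof (rule PiE_ext[OF _ d])
      show "?f w \<in> S \<times> (rcosets L) \<rightarrow>\<^sub>E UNIV" by auto
      fix z assume "z \<in> S \<times> (rcosets L)"
      then obtain s C where z: "z = (s, C)" "s \<in> S" "C \<in> rcosets L" by blast
      show "?f w z = \<delta> z" using ws[OF \<rho>(1)[OF z(3)] z(2)] \<rho>(2)[OF z(3)] z by simp
    qed
    then show "\<delta> \<in> ?f ` quasi_homs L" using w by (rule image_eqI[OF HOL.sym])
  qed auto
  ultimately show ?thesis unfolding bij_betw_def by blast
qed

text \<open>With d = [G:L] this says |Hom(L, Z/2)| = 2^((|S| - 1) d + 1), as Schreier's rank formula
  predicts, but without exhibiting a basis of \<open>L\<close>. The multiplied form keeps the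
  exponents natural numbers.\<close>

lemma card_homs_mod_2:
  assumes basis: "free_basis G S" and finS: "finite S" and L: "subgroup L G" and finL: "finite (rcosets L)"
  shows "2 ^ (card S * card (rcosets L)) * 2 = card (homs_mod_2 L) * 2 ^ card (rcosets L)"
proof -
  have LL: "L \<in> rcosets L" by (rule subgroup.subgroup_in_rcosets[OF L is_group])
  obtain \<rho> where "bij_betw (\<lambda>w. \<lambda>(s, C)\<in>S \<times> (rcosets L). w (\<rho> C \<otimes> s) \<noteq> w (\<rho> C))
    (quasi_homs L) (S \<times> (rcosets L) \<rightarrow>\<^sub>E (UNIV :: bool set))"
    using bij_betw_quasi_homs_free[OF basis L] by blast
  then have 1: "card (quasi_homs L) = 2 ^ (card S * card (rcosets L))"
    using finS finL by (simp add: bij_betw_same_card card_funcsetE card_cartesian_product)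
  obtain \<rho>' where "bij_betw (\<lambda>w. (restrict w L, \<lambda>C\<in>rcosets L - {L}. w (\<rho>' C)))
    (quasi_homs L) (homs_mod_2 L \<times> (rcosets L - {L} \<rightarrow>\<^sub>E (UNIV :: bool set)))"
    using bij_betw_quasi_homs_homs[OF L] by blast
  then have "card (quasi_homs L) = card (homs_mod_2 L) * 2 ^ (card (rcosets L) - 1)"
    using finL LL by (simp add: bij_betw_same_card card_funcsetE card_cartesian_product)
  with 1 have "2 ^ (card S * card (rcosets L)) = card (homs_mod_2 L) * 2 ^ (card (rcosets L) - 1)"
    by (simp only:)
  moreover have "card (rcosets L) > 0" using LL finL by (auto simp: card_gt_0_iff)
  then have "(2 :: nat) ^ card (rcosets L) = 2 * 2 ^ (card (rcosets L) - 1)"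
    by (cases "card (rcosets L)") simp_all
  ultimately show ?thesis by (simp only: mult_ac)
qed

end

section \<open>The Euler characteristic\<close>

context group
begin

text \<open>Cosets of \<open>L\<close> in \<open>F\<close> inject into cosets of \<open>F'\<close>,
  which gives finiteness. Products of chosen representatives of \<open>L\<close> in \<open>F\<close>
  and of \<open>F\<close> in \<open>G\<close> represent each coset of \<open>L\<close> exactly
  once.\<close>

lemma card_rcosets_Int:
  assumes F: "subgroup F G" "finite (rcosets F)" and F': "subgroup F' G" "finite (rcosets F')"
  defines "L \<equiv> F \<inter> F'"
  shows "finite (rcosets\<^bsub>G\<lparr>carrier := F\<rparr>\<^esub> L)"
    and "card (rcosets L) = card (rcosets\<^bsub>G\<lparr>carrier := F\<rparr>\<^esub> L) * card (rcosets F)"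
proof -
  have L: "subgroup L G" unfolding L_def by (rule subgroups_Inter_pair[OF F(1) F'(1)])
  note sub = subgroup.subset[OF F(1)] and subL = subgroup.subset[OF L]
  have LF: "L \<subseteq> F" by (simp add: L_def)
  let ?R = "rcosets\<^bsub>G\<lparr>carrier := F\<rparr>\<^esub> L"
  have R: "?R = (\<lambda>k. L #> k) ` F"
    by (auto simp: RCOSETS_def r_coset_def)
  define f where "f C = (SOME k. k \<in> F \<and> C = L #> k)" for C
  have f: "f C \<in> F" "C = L #> f C" if "C \<in> ?R" for C
    using someI_ex[of "\<lambda>k. k \<in> F \<and> C = L #> k"] that unfolding f_def R by auto
  have "inj_on (\<lambda>C. F' #> f C) ?R"
  proof (rule inj_onI)
    fix C D assume CD: "C \<in> ?R" "D \<in> ?R" "F' #> f C = F' #> f D"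
    have k: "f C \<in> F" "f D \<in> F" "f C \<in> carrier G" "f D \<in> carrier G"
      using f(1) CD sub by auto
    have "f C \<otimes> inv (f D) \<in> F'" using rcos_eq_iff[OF F'(1) k(3,4)] CD(3) by simp
    moreover have "f C \<otimes> inv (f D) \<in> F"
      using subgroup.m_closed[OF F(1) k(1) subgroup.m_inv_closed[OF F(1) k(2)]] .
    ultimately have "L #> f C = L #> f D" using rcos_eq_iff[OF L k(3,4)] by (simp add: L_def)
    then show "C = D" using f(2)[OF CD(1)] f(2)[OF CD(2)] by simp
  qed
  moreover have "(\<lambda>C. F' #> f C) ` ?R \<subseteq> rcosets F'"
    using f(1) sub by (intro image_subsetI rcosetsI subgroup.subset[OF F'(1)]) auto
  ultimately show "finite ?R" using F'(2) by (rule inj_on_finite)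
  define g where "g C = (SOME k. k \<in> carrier G \<and> C = F #> k)" for C
  have g: "g C \<in> carrier G" "C = F #> g C" if "C \<in> rcosets F" for C
    using someI_ex[of "\<lambda>k. k \<in> carrier G \<and> C = F #> k"] that unfolding g_def by (auto simp: RCOSETS_def)
  let ?h = "\<lambda>(C, D). L #> (f C \<otimes> g D)"
  have "inj_on ?h (?R \<times> rcosets F)"
  proof (rule inj_onI, clarify)
    fix C D C' D' assume c: "C \<in> ?R" "D \<in> rcosets F" "C' \<in> ?R" "D' \<in> rcosets F"
      and eq: "L #> (f C \<otimes> g D) = L #> (f C' \<otimes> g D')"
    have k: "f C \<in> F" "f C' \<in> F" "f C \<in> carrier G" "f C' \<in> carrier G" "g D \<in> carrier G" "g D' \<in> carrier G"
      using f(1) g(1) c sub by auto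
    have l: "f C \<otimes> g D \<otimes> inv (f C' \<otimes> g D') \<in> L"
      using rcos_eq_iff[OF L m_closed[OF k(3,5)] m_closed[OF k(4,6)]] eq by simp
    then have lF: "f C \<otimes> g D \<otimes> inv (f C' \<otimes> g D') \<in> F" using LF by blast
    have "inv (f C) \<otimes> (f C \<otimes> g D \<otimes> inv (f C' \<otimes> g D')) \<otimes> f C' \<in> F"
      by (rule subgroup.m_closed[OF F(1)
            subgroup.m_closed[OF F(1) subgroup.m_inv_closed[OF F(1) k(1)] lF] k(2)])
    moreover have "inv (f C) \<otimes> (f C \<otimes> g D \<otimes> inv (f C' \<otimes> g D')) \<otimes> f C' = g D \<otimes> inv (g D')"
      using k by (simp add: m_assoc inv_mult_group inv_mult_cancel)
    ultimately have D: "D = D'" using rcos_eq_iff[OF F(1) k(5,6)] g(2)[OF c(2)] g(2)[OF c(4)] by simp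
    have "f C \<otimes> g D \<otimes> inv (f C' \<otimes> g D') = f C \<otimes> inv (f C')"
      unfolding D using k by (simp add: m_assoc inv_mult_group inv_mult_cancel)
    then have "L #> f C = L #> f C'" using rcos_eq_iff[OF L k(3,4)] l by simp
    then show "C = C' \<and> D = D'" using D f(2)[OF c(1)] f(2)[OF c(3)] by simp
  qed
  moreover have "?h ` (?R \<times> rcosets F) = rcosets L"
  proof (intro equalityI subsetI)
    fix z assume "z \<in> ?h ` (?R \<times> rcosets F)"
    then obtain C D where "C \<in> ?R" "D \<in> rcosets F" "z = L #> (f C \<otimes> g D)" by auto
    then show "z \<in> rcosets L" using f(1) g(1) sub subL by (auto intro!: rcosetsI)
  next
    fix z assume "z \<in> rcosets L"
    then obtain k where k: "k \<in> carrier G" "z = L #> k" by (auto simp: RCOSETS_def)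
    define D where "D = F #> k"
    have D: "D \<in> rcosets F" using rcosetsI[OF sub k(1)] by (simp add: D_def)
    define c where "c = k \<otimes> inv (g D)"
    have c: "c \<in> F" using rcos_eq_iff[OF F(1) k(1) g(1)[OF D]] g(2)[OF D] by (simp add: c_def D_def)
    then have C: "L #> c \<in> ?R" unfolding R by blast
    have fc: "f (L #> c) \<in> carrier G" "L #> f (L #> c) = L #> c"
      using f[OF C] sub by auto
    have "L #> (f (L #> c) \<otimes> g D) = L #> (c \<otimes> g D)"
      using coset_mult_assoc[OF subL fc(1) g(1)[OF D]] coset_mult_assoc[OF subL _ g(1)[OF D], of c]
        fc(2) c sub by auto
    also have "c \<otimes> g D = k" using k(1) g(1)[OF D] by (simp add: c_def m_assoc)
    finally have "z = ?h (L #> c, D)" using k(2) by simp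
    then show "z \<in> ?h ` (?R \<times> rcosets F)" using C D by (intro image_eqI[where x = "(L #> c, D)"]) auto
  qed
  ultimately have "bij_betw ?h (?R \<times> rcosets F) (rcosets L)" by (simp add: bij_betw_def)
  then show "card (rcosets L) = card ?R * card (rcosets F)"
    by (simp add: bij_betw_same_card[symmetric] card_cartesian_product)
qed

lemma homs_mod_2_subgroup: "group.homs_mod_2 (G\<lparr>carrier := F\<rparr>) L = homs_mod_2 L"
  if "subgroup F G"
  using group.homs_mod_2_def[OF subgroup_imp_group[OF that]] by (simp add: homs_mod_2_def)

text \<open>Eliminating |Hom(L, Z/2)| from the two counts gives (1 - |S|) [F:L] = (1 - |S'|) [F':L].
  Division by [G:L], factored through either subgroup, yields the claim.\<close>

lemma euler_characteristic_unique:
  assumes F: "subgroup F G" "finite (rcosets F)" "finite S" "free_basis (G\<lparr>carrier := F\<rparr>) S"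
    and F': "subgroup F' G" "finite (rcosets F')" "finite S'" "free_basis (G\<lparr>carrier := F'\<rparr>) S'"
  shows "(1 - real (card S)) / real (card (rcosets F)) = (1 - real (card S')) / real (card (rcosets F'))"
proof -
  define L where "L = F \<inter> F'"
  have L: "subgroup L G" unfolding L_def by (rule subgroups_Inter_pair[OF F(1) F'(1)])
  have LF: "subgroup L (G\<lparr>carrier := F\<rparr>)" "subgroup L (G\<lparr>carrier := F'\<rparr>)"
    using subgroup_incl[OF L F(1)] subgroup_incl[OF L F'(1)] by (auto simp: L_def)
  let ?R = "rcosets\<^bsub>G\<lparr>carrier := F\<rparr>\<^esub> L" and ?R' = "rcosets\<^bsub>G\<lparr>carrier := F'\<rparr>\<^esub> L"
  have fin: "finite ?R" "finite ?R'"
    using card_rcosets_Int(1)[OF F(1,2) F'(1,2)] card_rcosets_Int(1)[OF F'(1,2) F(1,2)]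
    by (simp_all add: L_def Int_commute)
  have idx: "card (rcosets L) = card ?R * card (rcosets F)" "card (rcosets L) = card ?R' * card (rcosets F')"
    using card_rcosets_Int(2)[OF F(1,2) F'(1,2)] card_rcosets_Int(2)[OF F'(1,2) F(1,2)]
    by (simp_all add: L_def Int_commute)
  have 1: "2 ^ (card S * card ?R) * 2 = card (homs_mod_2 L) * 2 ^ card ?R"
    using group.card_homs_mod_2[OF subgroup_imp_group[OF F(1)] F(4,3) LF(1) fin(1)]
    by (simp only: homs_mod_2_subgroup[OF F(1)])
  have 2: "2 ^ (card S' * card ?R') * 2 = card (homs_mod_2 L) * 2 ^ card ?R'"
    using group.card_homs_mod_2[OF subgroup_imp_group[OF F'(1)] F'(4,3) LF(2) fin(2)]
    by (simp only: homs_mod_2_subgroup[OF F'(1)])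
  have "(2::nat) ^ (card S * card ?R + 1 + card ?R') = (2 ^ (card S * card ?R) * 2) * 2 ^ card ?R'"
    by (simp add: power_add)
  also have "\<dots> = (2 ^ (card S' * card ?R') * 2) * 2 ^ card ?R"
    unfolding 1 2 by (simp only: mult_ac)
  also have "\<dots> = 2 ^ (card S' * card ?R' + 1 + card ?R)" by (simp add: power_add)
  finally have "card S * card ?R + 1 + card ?R' = card S' * card ?R' + 1 + card ?R"
    by (rule power_inject_exp[THEN iffD1, rotated]) simp
  then have "real (card S * card ?R + 1 + card ?R') = real (card S' * card ?R' + 1 + card ?R)"
    by (rule arg_cong)
  then have r: "(1 - real (card S)) * real (card ?R) = (1 - real (card S')) * real (card ?R')"
    by (simp add: algebra_simps)
  have "L \<in> ?R" "L \<in> ?R'" "F \<in> rcosets F" "F' \<in> rcosets F'"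
    using subgroup.subgroup_in_rcosets[OF LF(1) subgroup_imp_group[OF F(1)]]
      subgroup.subgroup_in_rcosets[OF LF(2) subgroup_imp_group[OF F'(1)]]
      subgroup.subgroup_in_rcosets[OF F(1) is_group] subgroup.subgroup_in_rcosets[OF F'(1) is_group]
    by auto
  then have "card ?R > 0" "card ?R' > 0" "card (rcosets F) > 0" "card (rcosets F') > 0"
    using fin F(2) F'(2) by (auto simp: card_gt_0_iff)
  then have pos: "real (card ?R) > 0" "real (card ?R') > 0" "real (card (rcosets F)) > 0"
    "real (card (rcosets F')) > 0" by simp_all
  have "real (card ?R) * real (card (rcosets F)) = real (card ?R') * real (card (rcosets F'))"
    using idx by (metis of_nat_mult)
  then have "((1 - real (card S)) * real (card ?R)) / (real (card ?R) * real (card (rcosets F))) =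
      ((1 - real (card S')) * real (card ?R')) / (real (card ?R') * real (card (rcosets F')))"
    using r by simp
  then show ?thesis using pos by simp
qed

lemma euler_characteristic_eq:
  assumes "subgroup F G" "finite (rcosets F)" "finite S" "free_basis (G\<lparr>carrier := F\<rparr>) S"
  shows "euler_characteristic G = (1 - real (card S)) / real (card (rcosets F))"
  unfolding euler_characteristic_def
proof (rule the_equality)
  show "\<exists>F' S'. subgroup F' G \<and> finite (rcosets F') \<and> finite S' \<and>
      free_basis (G\<lparr>carrier := F'\<rparr>) S' \<and>
      (1 - real (card S)) / real (card (rcosets F)) = (1 - real (card S')) / real (card (rcosets F'))"
    using assms by blast
next
  fix q
  assume "\<exists>F' S'. subgroup F' G \<and> finite (rcosets F') \<and> finite S' \<and>
      free_basis (G\<lparr>carrier := F'\<rparr>) S' \<and> q = (1 - real (card S')) / real (card (rcosets F'))"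
  then obtain F' S' where "subgroup F' G" "finite (rcosets F')" "finite S'"
    "free_basis (G\<lparr>carrier := F'\<rparr>) S'" "q = (1 - real (card S')) / real (card (rcosets F'))" by blast
  then show "q = (1 - real (card S)) / real (card (rcosets F))"
    using euler_characteristic_unique[OF _ _ _ _ assms] by simp
qed

end

text \<open>Each nonzero count contributes a nonnegative term, and such terms occur at infinitely
  many indices, which an upper limit below 0 excludes.\<close>

lemma growth_coefficient_nonnegI:
  assumes "\<And>N. N \<ge> 1 \<Longrightarrow> card (subgroups_of_index G (d * N)) \<ge> 1" "d \<ge> 1"
  shows "growth_coefficient G \<ge> 0"
proof (rule ccontr)
  assume "\<not> growth_coefficient G \<ge> 0"
  then have "growth_coefficient G < 0" by simp
  then have "\<forall>\<^sub>F n in sequentially. (let s = card (subgroups_of_index G n) in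
      if s = 0 then -\<infinity> else ereal (ln (real s) / (real n * ln (real n)))) < 0"
    unfolding growth_coefficient_def by (rule Limsup_lessD)
  then obtain n0 where n0: "\<And>n. n \<ge> n0 \<Longrightarrow> (let s = card (subgroups_of_index G n) in
      if s = 0 then -\<infinity> else ereal (ln (real s) / (real n * ln (real n)))) < 0"
    by (auto simp: eventually_sequentially)
  define n where "n = d * max 1 n0"
  have "1 * max 1 n0 \<le> n" unfolding n_def by (rule mult_right_mono[OF assms(2)]) simp
  then have n: "n \<ge> n0" "n \<ge> 1" by simp_all
  have s: "card (subgroups_of_index G n) \<ge> 1" unfolding n_def by (rule assms(1)) simp
  then have "ln (real (card (subgroups_of_index G n))) / (real n * ln (real n)) \<ge> 0"
    using n by (intro divide_nonneg_nonneg mult_nonneg_nonneg ln_ge_zero) auto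
  then show False using n0[OF n(1)] s by (simp add: Let_def)
qed

section \<open>Comparison of the growth coefficient with the Euler characteristic\<close>

context double
begin

lemma euler_characteristic_amalg:
  assumes fin: "finite (carrier G)"
  shows "euler_characteristic \<Gamma> = 2 / real (card (carrier G)) - 1 / real (card U)"
proof -
  have "U \<noteq> {}" "carrier G \<noteq> {}" using subgroup.one_closed[OF U] one_closed by auto
  then have pos: "real (card U) > 0" "real (card (carrier G)) > 0"
    using fin finite_subset[OF subgroup.subset[OF U] fin] by (auto simp: card_gt_0_iff)
  have "real (card twists) * real (card U) + real (card U) = real (card (carrier G))"
    using card_twists(2)[OF fin] by (metis of_nat_add of_nat_mult)
  then have t: "real (card twists) = real (card (carrier G)) / real (card U) - 1"
    using pos by (simp add: field_simps)
  have "euler_characteristic \<Gamma> = (1 - real (card twists)) / real (card (carrier G))"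
    using group.euler_characteristic_eq[OF group_amalg kernel_fold_subgroup
        finite_rcosets_kernel_fold[OF fin] card_twists(1)[OF fin] free_basis_twists]
    by (simp only: card_rcosets_kernel_fold)
  then show ?thesis unfolding t using pos by (simp add: field_simps)
qed

lemma growth_coefficient_eq_iff:
  assumes fin: "finite (carrier G)" and p: "Factorial_Ring.prime (card U)" and proper: "U \<noteq> carrier G"
  shows "growth_coefficient \<Gamma> = ereal (- euler_characteristic \<Gamma>) \<longleftrightarrow>
    card (normalizer G U) \<le> 2 * card U"
proof -
  let ?p = "card U" and ?g = "card (carrier G)"
  let ?q = "coset_orbits U {\<one>}"
  define e where "e = 1 / real ?p - 2 / real ?g"
  have p0: "?p > 0" by (rule prime_gt_0_nat[OF p])
  have g: "real ?g = real ?q * real ?p"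
    using coset_orbits_one[OF fin U] by (metis of_nat_mult)
  have "?p < ?g" by (rule psubset_card_mono[OF fin psubsetI[OF subgroup.subset[OF U] proper]])
  then have q2: "?q \<ge> 2"
  proof (rule contrapos_pp)
    assume "\<not> ?q \<ge> 2"
    then have "?q * ?p \<le> 1 * ?p" by (intro mult_right_mono) auto
    then show "\<not> ?p < ?g" by (simp add: coset_orbits_one[OF fin U])
  qed
  have e: "e = (real ?q - 2) / real ?g" "e \<ge> 0"
    using p0 q2 g by (auto simp: e_def field_simps)
  have chi: "- euler_characteristic \<Gamma> = e"
    by (simp add: euler_characteristic_amalg[OF fin] e_def)
  \<comment> \<open>For H = 1 the bound (q - 2)/|G| equals e. If q = 2, that is |G| = 2 p, then e =
    0 and the existence of subgroups at infinitely many indices suffices.\<close>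
  have lower: "ereal e \<le> growth_coefficient \<Gamma>"
  proof (cases "?q > 2")
    case True
    then show ?thesis
      using growth_coefficient_amalg_ge[OF fin triv_subgroup] card_rcosets_one e by simp
  next
    case False
    then have "e = 0" using e q2 by simp
    moreover have "growth_coefficient \<Gamma> \<ge> 0"
      by (rule growth_coefficient_nonnegI[OF card_subgroups_of_index_ge_one[OF fin proper]])
        (use \<open>?p < ?g\<close> in simp_all)
    ultimately show ?thesis by (simp add: zero_ereal_def)
  qed
  show ?thesis
  proof
    assume N: "card (normalizer G U) \<le> 2 * ?p"
    have "growth_coefficient \<Gamma> \<le> ereal e"
      using card_sub_orbits_le[OF fin _ _ U p N]
      by (intro growth_coefficient_amalg_le[OF fin e(2)]) (simp add: e_def)
    then show "growth_coefficient \<Gamma> = ereal (- euler_characteristic \<Gamma>)"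
      using lower chi by simp
  next
    assume eq: "growth_coefficient \<Gamma> = ereal (- euler_characteristic \<Gamma>)"
    show "card (normalizer G U) \<le> 2 * ?p"
    proof (rule ccontr)
      assume N: "\<not> card (normalizer G U) \<le> 2 * ?p"
      let ?r = "coset_orbits U U" and ?d = "card (rcosets U)"
      let ?f = "card (normalizer G U) div ?p"
      have d: "?d * ?p = ?g" using lagrange[OF U] by (simp add: order_def)
      have r: "?r * ?p = ?d + (?p - 1) * ?f" by (rule coset_orbits_prime[OF fin U p])
      have "?p dvd card (normalizer G U)" by (rule card_dvd_normalizer[OF U])
      \<comment> \<open>p divides |N(U)|, so exceeding 2 p means being at least 3 p.\<close>
      then have f: "?f \<ge> 3" using N p0 by (auto elim!: dvdE)
      have p1: "real (?p - 1) = real ?p - 1" using p0 by simp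
      have r': "real ?r * real ?p = real ?d + (real ?p - 1) * real ?f"
        using arg_cong[OF r, of real] p1 by simp
      have d': "real ?d * real ?p = real ?g" using arg_cong[OF d, of real] by simp
      have d0: "real ?d > 0" using d \<open>?p < ?g\<close> by (cases "?d = 0") auto
      have pr: "real ?p > 0" using p0 by simp
      have ed: "e * real ?d * real ?p = real ?d - 2"
        using d' d0 pr by (simp add: e_def field_simps flip: d')
      have "real ?p \<ge> 2" using prime_ge_2_nat[OF p] by simp
      then have "(real ?p - 1) * real ?f \<ge> (real ?p - 1) * 3" using f by (intro mult_left_mono) auto
      \<comment> \<open>With f \<ge> 3, p (r - 2) is at least d + p - 3, which exceeds d - 2 because
        p \<ge> 2.\<close>
      then have "(real ?r - 2) * real ?p > e * real ?d * real ?p"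
        unfolding ed using r' \<open>real ?p \<ge> 2\<close> by (simp add: algebra_simps)
      then have lt: "e * real ?d < real ?r - 2" using pr by simp
      moreover have "e * real ?d \<ge> 0" using e(2) by simp
      ultimately have "?r > 2" by linarith
      from growth_coefficient_amalg_ge[OF fin U this]
      have "(real ?r - 2) / real ?d \<le> e" using eq chi by simp
      then show False using lt d0 by (simp add: divide_le_eq)
    qed
  qed
qed

end

text \<open>The last hypothesis excludes the case that x generates \<open>G\<close>. There \<Gamma>
  is cyclic of order p, so no subgroup has index above p and the growth coefficient is minus
  infinity, while -\<chi>(\<Gamma>) = -1/p and the normalizer has order p; the equivalence would
  fail.\<close>

theorem proposition2:
  fixes G :: "('a, 'm) monoid_scheme" and x :: 'a and p :: nat
  assumes "group G" and "finite (carrier G)"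
    and "x \<in> carrier G" and "Factorial_Ring.prime p" and "group.ord G x = p"
    and "carrier G \<noteq> generate G {x}"
  shows "let \<iota> = (\<lambda>k::int. x [^]\<^bsub>G\<^esub> k);
             \<Gamma> = amalgamated_product G G (integer_mod_group p) \<iota> \<iota>
         in growth_coefficient \<Gamma> = ereal (- euler_characteristic \<Gamma>)
              \<longleftrightarrow> card (normalizer G (generate G {x})) \<le> 2 * p"
proof -
  interpret group G by (rule assms(1))
  let ?U = "generate G {x}" and ?\<iota> = "\<lambda>k::int. x [^]\<^bsub>G\<^esub> k"
  have p: "p > 0" by (rule prime_gt_0_nat[OF assms(4)])
  \<comment> \<open>Exponents matter only modulo the order p, so the residues 0, ..., p - 1 already
    give all powers of x.\<close>
  have im: "?\<iota> ` carrier (integer_mod_group p) = ?U"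
  proof -
    have "x [^]\<^bsub>G\<^esub> k = x [^]\<^bsub>G\<^esub> (k mod int p)" for k :: int
      using int_pow_eq[OF assms(3), of "k mod int p" k] assms(5) by (simp add: mod_eq_dvd_iff)
    moreover have "k mod int p \<in> carrier (integer_mod_group p)" for k
      using p by (simp add: carrier_integer_mod_group)
    ultimately show ?thesis unfolding generate_pow[OF assms(3)] by auto
  qed
  have "subgroup ?U G" by (rule generate_is_subgroup) (use assms(3) in simp)
  then interpret double G "integer_mod_group p" ?\<iota> ?U
    by (intro double.intro double_axioms.intro assms(1) im)
  have "card ?U = p" using generate_pow_card[OF assms(3)] assms(5) by simp
  then show ?thesis
    using growth_coefficient_eq_iff[OF assms(2)] assms(4,6) by (simp add: Let_def amalg_def)
qed

end
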